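(* There exist a closed $3$-dimensional Riemannian manifold $(M,g)$ of class $C^\infty$ and a smooth steady solution $v_0$ of the incompressible Euler equations on $(M,g)$ such that $v_0$ is isolated in $C^1$.
   Context: Manifolds are connected and oriented; closed means compact without boundary. A steady solution of the incompressible Euler equations (steady Euler flow) on a Riemannian manifold $(M,g)$ is a vector field $v$ on $M$ such that, for some scalar function $p$ (the pressure), $$\nabla_v v=-\nabla_g p,\qquad \operatorname{div}_g v=0 ,$$ where $\nabla_v$ is the covariant derivative of the Levi-Civita connection of $g$, and $\nabla_g$, $\operatorname{div}_g$ are the gradient and divergence of $g$. A steady solution $v_0$ is isolated in $C^1$ if it is the only steady Euler flow in a $C^1$-neighborhood of $v_0$, modulo the symmetries of the equations. That is, there is a neighborhood of $v_0$ in the $C^1$-topology on vector fields such that every steady Euler flow $v$ on $(M,g)$ lying in that neighborhood is obtained from $v_0$ by a symmetry of the steady equations, the symmetries being multiplication by a nonzero real constant, push-forward by isometries of $(M,g)$, and compositions of these. *)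

theory Defs
  imports "HOL-Analysis.Analysis"
begin

section \<open>Calculus on open subsets of Euclidean space\<close>

definition partial :: "'n \<Rightarrow> (real^'n \<Rightarrow> 'b) \<Rightarrow> real^'n \<Rightarrow> 'b::real_normed_vector" where
  "partial i f y = frechet_derivative f (at y) (axis i 1)"

lemma partial_cong_open:
  assumes "open S" "y \<in> S" "\<And>z. z \<in> S \<Longrightarrow> f z = f' z"
  shows "partial i f y = partial i f' y"
proof -
  have "(f has_derivative D) (at y) \<longleftrightarrow> (f' has_derivative D) (at y)" for D
    using has_derivative_transform_within_open[of f D y UNIV S f']
      has_derivative_transform_within_open[of f' D y UNIV S f] assms by auto
  then show ?thesis
    by (simp add: partial_def frechet_derivative_def)
qed

(* Only meaningful for open S. *)
fun Ck_on :: "nat \<Rightarrow> (real^'n) set \<Rightarrow> (real^'n \<Rightarrow> 'b::real_normed_vector) \<Rightarrow> bool" where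
  "Ck_on 0 S f \<longleftrightarrow> continuous_on S f"
| "Ck_on (Suc k) S f \<longleftrightarrow> (\<forall>y\<in>S. f differentiable (at y)) \<and> (\<forall>i. Ck_on k S (partial i f))"

definition smooth_on :: "(real^'n) set \<Rightarrow> (real^'n \<Rightarrow> 'b::real_normed_vector) \<Rightarrow> bool" where
  "smooth_on S f \<longleftrightarrow> (\<forall>k. Ck_on k S f)"


section \<open>Oriented manifolds\<close>

(* A chart is a pair of a domain and a coordinate map; the values of the coordinate map
   outside the domain are irrelevant. *)
type_synonym ('a, 'n) chart = "'a set \<times> ('a \<Rightarrow> real^'n)"

abbreviation chart_dom :: "('a, 'n::finite) chart \<Rightarrow> 'a set" where
  "chart_dom \<equiv> fst"

abbreviation chart_map :: "('a, 'n::finite) chart \<Rightarrow> 'a \<Rightarrow> real^'n" where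
  "chart_map \<equiv> snd"

definition chart_img :: "('a, 'n::finite) chart \<Rightarrow> (real^'n) set" where
  "chart_img c = chart_map c ` chart_dom c"

definition chart_inv :: "('a, 'n::finite) chart \<Rightarrow> real^'n \<Rightarrow> 'a" where
  "chart_inv c = inv_into (chart_dom c) (chart_map c)"

definition transition :: "('a, 'n::finite) chart \<Rightarrow> ('a, 'n) chart \<Rightarrow> real^'n \<Rightarrow> real^'n" where
  "transition c d = chart_map d \<circ> chart_inv c"

definition oriented_atlas :: "'a topology \<Rightarrow> ('a, 'n::finite) chart set \<Rightarrow> bool" where
  "oriented_atlas X A \<longleftrightarrow>
     (\<forall>c\<in>A. openin X (chart_dom c) \<and> open (chart_img c) \<and>
        homeomorphic_map (subtopology X (chart_dom c)) (top_of_set (chart_img c)) (chart_map c)) \<and>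
     (\<Union>c\<in>A. chart_dom c) = topspace X \<and>
     (\<forall>c\<in>A. \<forall>d\<in>A.
        smooth_on (chart_map c ` (chart_dom c \<inter> chart_dom d)) (transition c d) \<and>
        (\<forall>y\<in>chart_map c ` (chart_dom c \<inter> chart_dom d).
           det (matrix (frechet_derivative (transition c d) (at y))) > 0))"

(* There is no boundary because charts map onto open subsets of the full Euclidean space.
   The atlas is not required to be maximal; every notion below depends only on
   the smooth structure that it generates. *)
definition closed_oriented_manifold :: "'a topology \<Rightarrow> ('a, 'n::finite) chart set \<Rightarrow> bool" where
  "closed_oriented_manifold X A \<longleftrightarrow>
     topspace X \<noteq> {} \<and> connected_space X \<and> compact_space X \<and>
     Hausdorff_space X \<and> second_countable X \<and> oriented_atlas X A"

definition Ck_function :: "nat \<Rightarrow> ('a, 'n::finite) chart set \<Rightarrow> ('a \<Rightarrow> real) \<Rightarrow> bool" where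
  "Ck_function k A f \<longleftrightarrow> (\<forall>c\<in>A. Ck_on k (chart_img c) (f \<circ> chart_inv c))"


section \<open>Tangent vectors and vector fields\<close>

(* A tangent vector at x is the family of its components in all charts of the atlas
   around x, related by the Jacobians of the transition maps; the components in charts that
   do not contain x are set to 0, so that equality of tangent vectors is equality of functions. *)
type_synonym ('a, 'n) tangent = "('a, 'n) chart \<Rightarrow> real^'n"

definition tangent_space :: "('a, 'n::finite) chart set \<Rightarrow> 'a \<Rightarrow> ('a, 'n) tangent set" where
  "tangent_space A x = {\<xi>.
     (\<forall>c. \<not> (c \<in> A \<and> x \<in> chart_dom c) \<longrightarrow> \<xi> c = 0) \<and>
     (\<forall>c\<in>A. \<forall>d\<in>A. x \<in> chart_dom c \<inter> chart_dom d \<longrightarrow>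
        \<xi> d = frechet_derivative (transition c d) (at (chart_map c x)) (\<xi> c))}"

(* The i-th coordinate vector of the chart c at the point x of its domain. *)
definition coord_vector :: "('a, 'n::finite) chart set \<Rightarrow> ('a, 'n) chart \<Rightarrow> 'n \<Rightarrow> 'a \<Rightarrow> ('a, 'n) tangent" where
  "coord_vector A c i x =
     (\<lambda>d. if d \<in> A \<and> x \<in> chart_dom d then partial i (transition c d) (chart_map c x) else 0)"

definition field_loc :: "('a, 'n::finite) chart \<Rightarrow> ('a \<Rightarrow> ('a, 'n) tangent) \<Rightarrow> real^'n \<Rightarrow> real^'n" where
  "field_loc c v y = v (chart_inv c y) c"

(* Fields are extensional (undefined outside the manifold), so that two fields that agree on
   the manifold are equal. *)
definition Ck_vector_field ::
  "nat \<Rightarrow> 'a topology \<Rightarrow> ('a, 'n::finite) chart set \<Rightarrow> ('a \<Rightarrow> ('a, 'n) tangent) \<Rightarrow> bool" where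
  "Ck_vector_field k X A v \<longleftrightarrow>
     v \<in> (\<Pi>\<^sub>E x\<in>topspace X. tangent_space A x) \<and>
     (\<forall>c\<in>A. Ck_on k (chart_img c) (field_loc c v))"

definition smooth_vector_field ::
  "'a topology \<Rightarrow> ('a, 'n::finite) chart set \<Rightarrow> ('a \<Rightarrow> ('a, 'n) tangent) \<Rightarrow> bool" where
  "smooth_vector_field X A v \<longleftrightarrow> (\<forall>k. Ck_vector_field k X A v)"

(* The C^1 topology on the space of C^1 vector fields: C^1-closeness in charts, uniformly on
   compact sets.  On a compact manifold it is the topology of any C^1 norm. *)
definition C1_topology ::
  "'a topology \<Rightarrow> ('a, 'n::finite) chart set \<Rightarrow> ('a \<Rightarrow> ('a, 'n) tangent) topology" where
  "C1_topology X A = topology_generated_by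
     {{w. Ck_vector_field 1 X A w \<and>
          (\<forall>y\<in>K. norm (field_loc c w y - field_loc c v y) < \<epsilon> \<and>
             (\<forall>i. norm (partial i (field_loc c w) y - partial i (field_loc c v) y) < \<epsilon>))}
      | c K v \<epsilon>. c \<in> A \<and> compact K \<and> K \<subseteq> chart_img c \<and> Ck_vector_field 1 X A v \<and> (0::real) < \<epsilon>}"


section \<open>Riemannian metrics\<close>

type_synonym ('a, 'n) metric = "'a \<Rightarrow> ('a, 'n) tangent \<Rightarrow> ('a, 'n) tangent \<Rightarrow> real"

definition metric_loc ::
  "('a, 'n::finite) chart set \<Rightarrow> ('a, 'n) metric \<Rightarrow> ('a, 'n) chart \<Rightarrow> real^'n \<Rightarrow> real^'n^'n" where
  "metric_loc A g c y =
     (\<chi> i j. g (chart_inv c y) (coord_vector A c i (chart_inv c y)) (coord_vector A c j (chart_inv c y)))"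

definition smooth_riemannian_metric ::
  "'a topology \<Rightarrow> ('a, 'n::finite) chart set \<Rightarrow> ('a, 'n) metric \<Rightarrow> bool" where
  "smooth_riemannian_metric X A g \<longleftrightarrow>
     (\<forall>x\<in>topspace X.
        (\<forall>\<xi>\<in>tangent_space A x. \<forall>\<eta>\<in>tangent_space A x. g x \<xi> \<eta> = g x \<eta> \<xi>) \<and>
        (\<forall>\<xi>\<in>tangent_space A x. \<forall>\<eta>\<in>tangent_space A x. \<forall>\<zeta>\<in>tangent_space A x. \<forall>a b.
           g x (\<lambda>c. a *\<^sub>R \<xi> c + b *\<^sub>R \<eta> c) \<zeta> = a * g x \<xi> \<zeta> + b * g x \<eta> \<zeta>) \<and>
        (\<forall>\<xi>\<in>tangent_space A x. \<xi> \<noteq> (\<lambda>c. 0) \<longrightarrow> g x \<xi> \<xi> > 0)) \<and>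
     (\<forall>c\<in>A. smooth_on (chart_img c) (metric_loc A g c))"

(* The Christoffel symbols (upper index first) of the Levi-Civita connection of the local
   metric G. *)
definition christoffel :: "(real^'n \<Rightarrow> real^'n^'n) \<Rightarrow> 'n \<Rightarrow> 'n \<Rightarrow> 'n \<Rightarrow> real^'n \<Rightarrow> real" where
  "christoffel G k i j y =
     1 / 2 * (\<Sum>l\<in>UNIV. matrix_inv (G y) $ k $ l *
       (partial i (\<lambda>z. G z $ j $ l) y + partial j (\<lambda>z. G z $ i $ l) y - partial l (\<lambda>z. G z $ i $ j) y))"

lemma christoffel_levi_civita:
  fixes G :: "real^'n \<Rightarrow> real^'n^'n" and \<Gamma> :: "'n \<Rightarrow> 'n \<Rightarrow> 'n \<Rightarrow> real"
  assumes "open S" "y \<in> S" and sym: "\<And>z. z \<in> S \<Longrightarrow> transpose (G z) = G z" and inv: "invertible (G y)"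
  shows "(\<forall>k i j. \<Gamma> k i j = christoffel G k i j y) \<longleftrightarrow>
     (\<forall>k i j. \<Gamma> k i j = \<Gamma> k j i) \<and>
     (\<forall>l i j. partial l (\<lambda>z. G z $ i $ j) y =
        (\<Sum>m\<in>UNIV. \<Gamma> m l i * G y $ m $ j) + (\<Sum>m\<in>UNIV. \<Gamma> m l j * G y $ i $ m))"
proof -
  have symc: "G z $ i $ j = G z $ j $ i" if "z \<in> S" for z i j
    using arg_cong[OF sym[OF that], of "\<lambda>M. M $ j $ i"] by (simp add: transpose_def)
  define d where "d l i j = partial l (\<lambda>z. G z $ i $ j) y" for l i j
  have dsym: "d l i j = d l j i" for l i j
    unfolding d_def by (rule partial_cong_open[OF assms(1,2)]) (rule symc)
  have Gsym: "G y $ i $ j = G y $ j $ i" for i j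
    by (rule symc[OF assms(2)])
  define P where "P = matrix_inv (G y)"
  have PG: "P ** G y = mat 1" "G y ** P = mat 1"
    using someI_ex[OF inv[unfolded invertible_def]] by (simp_all add: P_def matrix_inv_def)
  have GP': "(\<Sum>m\<in>UNIV. G y $ n $ m * P $ m $ l) = (if n = l then 1 else 0)" for n l
    using arg_cong[OF PG(2), of "\<lambda>M. M $ n $ l"] by (simp add: matrix_matrix_mult_def mat_def)
  have PG': "(\<Sum>m\<in>UNIV. P $ n $ m * G y $ m $ l) = (if n = l then 1 else 0)" for n l
    using arg_cong[OF PG(1), of "\<lambda>M. M $ n $ l"] by (simp add: matrix_matrix_mult_def mat_def)
  define h where "h i j l = (d i j l + d j i l - d l i j) / 2" for i j l
  have chr: "christoffel G k i j y = (\<Sum>l\<in>UNIV. P $ k $ l * h i j l)" for k i j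
    by (simp add: christoffel_def P_def h_def d_def sum_distrib_left)
  have low: "(\<Sum>m\<in>UNIV. christoffel G m i j y * G y $ m $ n) = h i j n" for i j n
  proof -
    have "(\<Sum>m\<in>UNIV. christoffel G m i j y * G y $ m $ n) =
        (\<Sum>m\<in>UNIV. \<Sum>l\<in>UNIV. h i j l * (G y $ n $ m * P $ m $ l))"
      unfolding chr sum_distrib_right by (intro sum.cong refl) (simp only: Gsym[of n] mult_ac)
    also have "\<dots> = (\<Sum>l\<in>UNIV. h i j l * (\<Sum>m\<in>UNIV. G y $ n $ m * P $ m $ l))"
      by (subst sum.swap) (simp add: sum_distrib_left)
    also have "\<dots> = h i j n"
      unfolding GP' by (simp add: if_distrib cong: if_cong)
    finally show ?thesis .
  qed
  show ?thesis
    unfolding d_def[symmetric]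
  proof (intro iffI conjI allI)
    fix k i j
    assume "\<forall>k i j. \<Gamma> k i j = christoffel G k i j y"
    then show "\<Gamma> k i j = \<Gamma> k j i"
      by (simp add: chr h_def dsym[of _ i j] add.commute)
  next
    fix l i j
    assume "\<forall>k i j. \<Gamma> k i j = christoffel G k i j y"
    then have "(\<Sum>m\<in>UNIV. \<Gamma> m l i * G y $ m $ j) + (\<Sum>m\<in>UNIV. \<Gamma> m l j * G y $ i $ m) = h l i j + h l j i"
      using low[of l i j] low[of l j i] by (simp add: Gsym[of i])
    also have "\<dots> = d l i j"
      using dsym[of l i j] dsym[of i l j] dsym[of j l i] by (simp add: h_def field_simps)
    finally show "d l i j = (\<Sum>m\<in>UNIV. \<Gamma> m l i * G y $ m $ j) + (\<Sum>m\<in>UNIV. \<Gamma> m l j * G y $ i $ m)"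
      by simp
  next
    fix k i j
    assume asm: "(\<forall>k i j. \<Gamma> k i j = \<Gamma> k j i) \<and>
      (\<forall>l i j. d l i j = (\<Sum>m\<in>UNIV. \<Gamma> m l i * G y $ m $ j) + (\<Sum>m\<in>UNIV. \<Gamma> m l j * G y $ i $ m))"
    define L where "L i j n = (\<Sum>m\<in>UNIV. \<Gamma> m i j * G y $ m $ n)" for i j n
    have Lsym: "L i j n = L j i n" for i j n
      using asm unfolding L_def by (intro sum.cong refl arg_cong2[of _ _ _ _ "(*)"]) blast
    have dL: "d l i j = L l i j + L l j i" for l i j
      using asm by (simp add: L_def Gsym[of i])
    have hL: "h i j n = L i j n" for n
      using Lsym[of i j n] Lsym[of i n j] Lsym[of j n i] by (simp add: h_def dL field_simps)
    have "christoffel G k i j y = (\<Sum>n\<in>UNIV. \<Sum>m\<in>UNIV. \<Gamma> m i j * (P $ k $ n * G y $ n $ m))"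
      unfolding chr hL L_def sum_distrib_left
      by (intro sum.cong refl) (simp only: Gsym mult_ac)
    also have "\<dots> = (\<Sum>m\<in>UNIV. \<Gamma> m i j * (\<Sum>n\<in>UNIV. P $ k $ n * G y $ n $ m))"
      by (subst sum.swap) (simp add: sum_distrib_left)
    also have "\<dots> = \<Gamma> k i j"
      unfolding PG' by (simp add: if_distrib cong: if_cong)
    finally show "\<Gamma> k i j = christoffel G k i j y" by simp
  qed
qed

(* In coordinates, the covariant derivative at y of the field w in the direction u. *)
definition cov_deriv ::
  "(real^'n \<Rightarrow> real^'n^'n) \<Rightarrow> real^'n \<Rightarrow> (real^'n \<Rightarrow> real^'n) \<Rightarrow> real^'n \<Rightarrow> real^'n" where
  "cov_deriv G u w y = frechet_derivative w (at y) u +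
     (\<chi> k. \<Sum>i\<in>UNIV. \<Sum>j\<in>UNIV. christoffel G k i j y * u $ i * w y $ j)"

(* The divergence is the trace of the covariant derivative. *)
definition divergence :: "(real^'n \<Rightarrow> real^'n^'n) \<Rightarrow> (real^'n \<Rightarrow> real^'n) \<Rightarrow> real^'n \<Rightarrow> real" where
  "divergence G w y = (\<Sum>i\<in>UNIV. cov_deriv G (axis i 1) w y $ i)"

definition gradient :: "(real^'n \<Rightarrow> real^'n^'n) \<Rightarrow> (real^'n \<Rightarrow> real) \<Rightarrow> real^'n \<Rightarrow> real^'n" where
  "gradient G f y = matrix_inv (G y) *v (\<chi> j. partial j f y)"


section \<open>Isometries and push-forward\<close>

definition smooth_map :: "'a topology \<Rightarrow> ('a, 'n::finite) chart set \<Rightarrow> ('a \<Rightarrow> 'a) \<Rightarrow> bool" where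
  "smooth_map X A \<psi> \<longleftrightarrow> continuous_map X X \<psi> \<and>
     (\<forall>c\<in>A. \<forall>d\<in>A. smooth_on (chart_map c ` (chart_dom c \<inter> \<psi> -` chart_dom d))
        (chart_map d \<circ> \<psi> \<circ> chart_inv c))"

(* The result does not depend on the choice of the chart c around x. *)
definition differential ::
  "('a, 'n::finite) chart set \<Rightarrow> ('a \<Rightarrow> 'a) \<Rightarrow> 'a \<Rightarrow> ('a, 'n) tangent \<Rightarrow> ('a, 'n) tangent" where
  "differential A \<psi> x \<xi> =
     (let c = (SOME c. c \<in> A \<and> x \<in> chart_dom c) in
      (\<lambda>d. if d \<in> A \<and> \<psi> x \<in> chart_dom d
          then frechet_derivative (chart_map d \<circ> \<psi> \<circ> chart_inv c) (at (chart_map c x)) (\<xi> c) else 0))"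

definition isometry ::
  "'a topology \<Rightarrow> ('a, 'n::finite) chart set \<Rightarrow> ('a, 'n) metric \<Rightarrow> ('a \<Rightarrow> 'a) \<Rightarrow> bool" where
  "isometry X A g \<psi> \<longleftrightarrow>
     bij_betw \<psi> (topspace X) (topspace X) \<and>
     smooth_map X A \<psi> \<and> smooth_map X A (inv_into (topspace X) \<psi>) \<and>
     (\<forall>x\<in>topspace X. \<forall>\<xi>\<in>tangent_space A x. \<forall>\<eta>\<in>tangent_space A x.
        g (\<psi> x) (differential A \<psi> x \<xi>) (differential A \<psi> x \<eta>) = g x \<xi> \<eta>)"

definition push_forward ::
  "'a topology \<Rightarrow> ('a, 'n::finite) chart set \<Rightarrow> ('a \<Rightarrow> 'a) \<Rightarrow> ('a \<Rightarrow> ('a, 'n) tangent) \<Rightarrow> 'a \<Rightarrow> ('a, 'n) tangent" where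
  "push_forward X A \<psi> v =
     (\<lambda>x\<in>topspace X. let x' = inv_into (topspace X) \<psi> x in differential A \<psi> x' (v x'))"

definition scale_field ::
  "'a topology \<Rightarrow> real \<Rightarrow> ('a \<Rightarrow> ('a, 'n::finite) tangent) \<Rightarrow> 'a \<Rightarrow> ('a, 'n) tangent" where
  "scale_field X a v = (\<lambda>x\<in>topspace X. \<lambda>c. a *\<^sub>R v x c)"


section \<open>Steady Euler flows\<close>

definition steady_euler ::
  "'a topology \<Rightarrow> ('a, 'n::finite) chart set \<Rightarrow> ('a, 'n) metric \<Rightarrow> ('a \<Rightarrow> ('a, 'n) tangent) \<Rightarrow> bool" where
  "steady_euler X A g v \<longleftrightarrow> Ck_vector_field 1 X A v \<and>
     (\<exists>p. Ck_function 1 A p \<and>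
       (\<forall>c\<in>A. \<forall>y\<in>chart_img c.
          cov_deriv (metric_loc A g c) (field_loc c v y) (field_loc c v) y =
            - gradient (metric_loc A g c) (p \<circ> chart_inv c) y \<and>
          divergence (metric_loc A g c) (field_loc c v) y = 0))"

(* The fields obtained from v0 by the symmetries of the steady Euler equations. *)
inductive_set symmetry_orbit ::
  "'a topology \<Rightarrow> ('a, 'n::finite) chart set \<Rightarrow> ('a, 'n) metric \<Rightarrow> ('a \<Rightarrow> ('a, 'n) tangent) \<Rightarrow>
   ('a \<Rightarrow> ('a, 'n) tangent) set"
  for X :: "'a topology" and A :: "('a, 'n::finite) chart set" and g :: "('a, 'n::finite) metric"
    and v0 :: "'a \<Rightarrow> ('a, 'n) tangent"
where
  base: "v0 \<in> symmetry_orbit X A g v0"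
| scale: "v \<in> symmetry_orbit X A g v0 \<Longrightarrow> a \<noteq> 0 \<Longrightarrow> scale_field X a v \<in> symmetry_orbit X A g v0"
| push: "v \<in> symmetry_orbit X A g v0 \<Longrightarrow> isometry X A g \<psi> \<Longrightarrow>
    push_forward X A \<psi> v \<in> symmetry_orbit X A g v0"

definition C1_isolated ::
  "'a topology \<Rightarrow> ('a, 'n::finite) chart set \<Rightarrow> ('a, 'n) metric \<Rightarrow> ('a \<Rightarrow> ('a, 'n) tangent) \<Rightarrow> bool" where
  "C1_isolated X A g v0 \<longleftrightarrow>
     (\<exists>N. openin (C1_topology X A) N \<and> v0 \<in> N \<and>
        (\<forall>v\<in>N. steady_euler X A g v \<longrightarrow> v \<in> symmetry_orbit X A g v0))"

end

theory Submission
  imports Defs "HOL-Probability.Distributions"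
begin

text \<open>The manifold is the suspension of a hyperbolic automorphism of the torus, with the metric
  e^(-2z)dx^2+e^(2z)dy^2+dz^2 of the geometry Sol, and the steady flow is v_0=\<partial>_z. It is
  an Anosov flow, it preserves the volume dx dy dz, and its dual 1-form dz is closed, so
  v_0 is a harmonic field. A vector field on the manifold is handled as a field W on the
  universal cover \<real>^3 that is equivariant under the deck group.

  Let W be a steady flow that is C^1-close to v_0, with pressure p and dual form \<alpha>.
  The Bernoulli function B=p+|W|^2/2 satisfies dB=-\<iota>_W d\<alpha> and is therefore a first
  integral. The main dynamical fact (theorem \<open>first_integral_constant\<close>) is that continuous first
  integrals of W are constant: by a Lyapunov-Perron fixed point, every vertical line is shadowed
  by an orbit of W; this defines a continuous equivariant map H, which is onto by
  Brouwer's theorem. If \<phi> is a first integral, \<phi> \<circ> H is invariant under the deck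
  group and does not depend on z, so it is a function on the torus that is invariant under a
  hyperbolic automorphism, and uniform continuity along the contracted and expanded directions makes
  it constant.

  Thus B is constant and \<iota>_W d\<alpha>=0, which means that curl W = \<lambda> W for a
  function \<lambda>. Since \<lambda> is merely continuous, that it is a first integral cannot be seen
  by differentiation; lemma \<open>vorticity_transport\<close> obtains it from Kelvin's theorem for small
  squares that are carried along an orbit. So \<lambda> is constant as well. It vanishes
  (\<open>constant_vorticity_zero\<close>): on a horizontal plane \<alpha> is bounded, hence its circulation
  around a square of side h is O(h), while Stokes' theorem makes it at least a multiple of
  |\<lambda>|h^2.

  Hence \<alpha> is closed and coclosed. The first Betti number of the manifold is one, so
  \<alpha>=c dz+dG with a harmonic function G on the manifold. Translations in x and y
  are isometries of the cover, so differences of translates of G are bounded harmonic functions,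
  and they fade at one end of the cover; a maximum principle with barriers affine in z shows that
  they vanish (\<open>closed_coclosed_rigid\<close>). Therefore W=c \<partial>_z, a multiple of v_0.\<close>

section \<open>The deck group\<close>

definition pt :: "real \<Rightarrow> real \<Rightarrow> real \<Rightarrow> real^3" where
  "pt x y z = x *\<^sub>R axis 1 1 + y *\<^sub>R axis 2 1 + z *\<^sub>R axis 3 1"

lemma pt_nth [simp]: "pt x y z $ 1 = x" "pt x y z $ 2 = y" "pt x y z $ 3 = z"
  by (simp_all add: pt_def axis_def)

lemma vec3_eq_iff: "p = q \<longleftrightarrow> p $ 1 = q $ 1 \<and> p $ 2 = q $ 2 \<and> p $ 3 = q $ 3"
  for p q :: "real^3"
  by (simp add: vec_eq_iff forall_3)

lemma pt_collapse [simp]: "pt (q $ 1) (q $ 2) (q $ 3) = q"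
  by (simp add: vec3_eq_iff)

lemma continuous_on_pt [continuous_intros]:
  "continuous_on S f \<Longrightarrow> continuous_on S g \<Longrightarrow> continuous_on S h \<Longrightarrow>
    continuous_on S (\<lambda>x. pt (f x) (g x) (h x))"
  unfolding pt_def by (intro continuous_intros)

definition ell :: real where "ell = ln (2 + sqrt 3)"

lemma exp_ell: "exp ell = 2 + sqrt 3" "exp (- ell) = 2 - sqrt 3"
proof -
  have p: "2 + sqrt 3 > (0::real)" by (simp add: add_pos_nonneg)
  show 1: "exp ell = 2 + sqrt 3" using p by (simp add: ell_def)
  have "(2 + sqrt 3) * (2 - sqrt 3) = (1::real)" by (simp add: algebra_simps)
  then show "exp (- ell) = 2 - sqrt 3" using p by (simp add: exp_minus 1 field_simps)
qed

lemma ell_bounds: "1 < ell" "exp ell < 4"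
proof -
  have s: "sqrt 3 < 2" "sqrt 3 > (1::real)" by (simp_all add: real_less_lsqrt real_less_rsqrt)
  then show "exp ell < 4" by (simp add: exp_ell)
  have "exp 1 < exp ell" using s exp_le unfolding exp_ell by linarith
  then show "1 < ell" by simp
qed

text \<open>The ring \<int>[sqrt 3], embedded in the plane by its two real embeddings. Multiplication by
  the unit 2+sqrt 3 becomes the hyperbolic map (a,b) \<mapsto> (e^ell a, e^(-ell) b), so x and y
  are coordinates along its eigendirections.\<close>

definition Lat :: "(real \<times> real) set" where
  "Lat = {(of_int k + of_int m * sqrt 3, of_int k - of_int m * sqrt 3) | k m. True}"

lemma LatI: "(of_int k + of_int m * sqrt 3, of_int k - of_int m * sqrt 3) \<in> Lat"
  unfolding Lat_def by blast

lemma Lat_zero [simp]: "(0, 0) \<in> Lat"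
  using LatI[of 0 0] by simp

lemma Lat_add: "(a, b) \<in> Lat \<Longrightarrow> (a', b') \<in> Lat \<Longrightarrow> (a + a', b + b') \<in> Lat"
proof -
  assume "(a, b) \<in> Lat" "(a', b') \<in> Lat"
  then obtain k m k' m' where ab: "a = of_int k + of_int m * sqrt 3" "b = of_int k - of_int m * sqrt 3"
    "a' = of_int k' + of_int m' * sqrt 3" "b' = of_int k' - of_int m' * sqrt 3"
    unfolding Lat_def by blast
  show ?thesis using LatI[of "k + k'" "m + m'"] unfolding ab by (simp add: algebra_simps)
qed

lemma Lat_uminus: "(a, b) \<in> Lat \<Longrightarrow> (- a, - b) \<in> Lat"
proof -
  assume "(a, b) \<in> Lat"
  then obtain k m where ab: "a = of_int k + of_int m * sqrt 3" "b = of_int k - of_int m * sqrt 3"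
    unfolding Lat_def by blast
  show ?thesis using LatI[of "- k" "- m"] unfolding ab by simp
qed

lemma Lat_scale1: "(a, b) \<in> Lat \<Longrightarrow> (exp ell * a, exp (- ell) * b) \<in> Lat"
  "(a, b) \<in> Lat \<Longrightarrow> (exp (- ell) * a, exp ell * b) \<in> Lat"
proof -
  assume "(a, b) \<in> Lat"
  then obtain k m where ab: "a = of_int k + of_int m * sqrt 3" "b = of_int k - of_int m * sqrt 3"
    unfolding Lat_def by blast
  show "(exp ell * a, exp (- ell) * b) \<in> Lat"
    using LatI[of "2 * k + 3 * m" "k + 2 * m"] unfolding exp_ell ab by (simp add: algebra_simps)
  show "(exp (- ell) * a, exp ell * b) \<in> Lat"
    using LatI[of "2 * k - 3 * m" "2 * m - k"] unfolding exp_ell ab by (simp add: algebra_simps)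
qed

lemma Lat_scale: "(a, b) \<in> Lat \<Longrightarrow> (exp (of_int n * ell) * a, exp (- (of_int n * ell)) * b) \<in> Lat"
proof (induction n rule: int_induct[where k = 0])
  case base then show ?case by simp
next
  case (step1 i)
  show ?case using Lat_scale1(1)[OF step1.IH[OF step1.prems]]
    by (simp add: algebra_simps exp_add exp_diff exp_minus divide_inverse)
next
  case (step2 i)
  show ?case using Lat_scale1(2)[OF step2.IH[OF step2.prems]]
    by (simp add: algebra_simps exp_add exp_diff exp_minus divide_inverse)
qed

text \<open>The sum of the two embeddings of k+m sqrt 3 is the even integer 2k, which vanishes under
  these bounds.\<close>

lemma Lat_discrete:
  assumes "(a, b) \<in> Lat" "\<bar>a\<bar> < 1" "\<bar>b\<bar> < 1"
  shows "a = 0" "b = 0"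
proof -
  obtain k m where ab: "a = of_int k + of_int m * sqrt 3" "b = of_int k - of_int m * sqrt 3"
    using assms(1) unfolding Lat_def by blast
  have s: "sqrt 3 > 1" by (simp add: real_less_rsqrt)
  have "\<bar>2 * of_int k :: real\<bar> < 2" using assms(2,3) ab by linarith
  then have "\<bar>of_int k :: real\<bar> < of_int 1" by simp
  then have k: "k = 0" by linarith
  then have "\<bar>of_int m\<bar> * sqrt 3 < 1" using assms(2) ab by (simp add: abs_mult)
  moreover have "\<bar>of_int m :: real\<bar> \<le> \<bar>of_int m\<bar> * sqrt 3" using s by (simp add: mult_le_cancel_left1)
  ultimately have "\<bar>of_int m :: real\<bar> < of_int 1" by simp
  then have "m = 0" by linarith
  with k ab show "a = 0" "b = 0" by simp_all
qed

definition deck :: "int \<Rightarrow> real \<Rightarrow> real \<Rightarrow> real^3 \<Rightarrow> real^3" where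
  "deck n a b q = pt (exp (of_int n * ell) * q $ 1 + a) (exp (- (of_int n * ell)) * q $ 2 + b) (q $ 3 + of_int n * ell)"

definition invariant :: "(real^3 \<Rightarrow> 'b) \<Rightarrow> bool" where
  "invariant \<phi> \<longleftrightarrow> (\<forall>n a b q. (a, b) \<in> Lat \<longrightarrow> \<phi> (deck n a b q) = \<phi> q)"

lemma invariantD: "invariant \<phi> \<Longrightarrow> (a, b) \<in> Lat \<Longrightarrow> \<phi> (deck n a b q) = \<phi> q"
  unfolding invariant_def by blast

text \<open>A box that meets every orbit of the deck group. Estimates for invariant functions need to be
  checked on this compact set only.\<close>

definition fund_box :: "(real^3) set" where
  "fund_box = {q. \<bar>q $ 1\<bar> \<le> 3 \<and> \<bar>q $ 2\<bar> \<le> 3 \<and> 0 \<le> q $ 3 \<and> q $ 3 \<le> ell}"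

lemma compact_fund_box: "compact fund_box"
proof -
  have "fund_box = cbox (pt (-3) (-3) 0) (pt 3 3 ell)"
    by (auto simp: fund_box_def mem_box_cart forall_3 abs_le_iff)
  then show ?thesis by (metis compact_cbox)
qed

text \<open>Round both coordinates with respect to the basis (1,1), (sqrt 3,-sqrt 3) of the plane.\<close>

lemma Lat_reduce: "\<exists>a b. (a, b) \<in> Lat \<and> \<bar>x + a\<bar> \<le> 3 \<and> \<bar>y + b\<bar> \<le> 3"
proof -
  define s where "s = (x + y) / 2"
  define t where "t = (x - y) / (2 * sqrt 3)"
  have s3: "sqrt 3 > 0" "sqrt 3 < 2" by (simp_all add: real_less_lsqrt)
  have x: "x = s + t * sqrt 3" and y: "y = s - t * sqrt 3"
    using s3 by (simp_all add: s_def t_def field_simps)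
  have ls: "\<bar>s + of_int (- \<lfloor>s\<rfloor>)\<bar> \<le> 1" "\<bar>t + of_int (- \<lfloor>t\<rfloor>)\<bar> \<le> 1" by (simp_all add: abs_le_iff) linarith+
  then have "\<bar>t + of_int (- \<lfloor>t\<rfloor>)\<bar> * sqrt 3 \<le> 1 * 2" using s3 by (intro mult_mono) auto
  then have "\<bar>(t + of_int (- \<lfloor>t\<rfloor>)) * sqrt 3\<bar> \<le> 2" by (simp add: abs_mult)
  with ls(1) have "\<bar>x + (of_int (- \<lfloor>s\<rfloor>) + of_int (- \<lfloor>t\<rfloor>) * sqrt 3)\<bar> \<le> 3"
    "\<bar>y + (of_int (- \<lfloor>s\<rfloor>) - of_int (- \<lfloor>t\<rfloor>) * sqrt 3)\<bar> \<le> 3"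
    unfolding x y abs_le_iff distrib_right by linarith+
  then show ?thesis using LatI by blast
qed

lemma deck_into_fund_box: "\<exists>n a b. (a, b) \<in> Lat \<and> deck n a b q \<in> fund_box"
proof -
  define n where "n = - \<lfloor>q $ 3 / ell\<rfloor>"
  have l: "ell > 0" using ell_bounds by simp
  have "of_int \<lfloor>q $ 3 / ell\<rfloor> * ell \<le> q $ 3" "q $ 3 \<le> (of_int \<lfloor>q $ 3 / ell\<rfloor> + 1) * ell"
    using l by (simp_all flip: pos_le_divide_eq pos_divide_le_eq) (linarith+)?
  then have z: "0 \<le> q $ 3 + of_int n * ell" "q $ 3 + of_int n * ell \<le> ell"
    by (simp_all add: n_def algebra_simps)
  obtain a b where "(a, b) \<in> Lat" "\<bar>exp (of_int n * ell) * q $ 1 + a\<bar> \<le> 3"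
    "\<bar>exp (- (of_int n * ell)) * q $ 2 + b\<bar> \<le> 3"
    using Lat_reduce by meson
  with z show ?thesis by (auto simp: deck_def fund_box_def intro!: exI[of _ n])
qed

lemma invariant_from_fund_box:
  assumes "invariant \<phi>" "\<And>q. q \<in> fund_box \<Longrightarrow> P (\<phi> q)"
  shows "P (\<phi> q)"
proof -
  obtain n a b where "(a, b) \<in> Lat" "deck n a b q \<in> fund_box" using deck_into_fund_box by blast
  then show ?thesis using assms(2)[of "deck n a b q"] invariantD[OF assms(1), of a b n q] by simp
qed

lemma invariant_bounded:
  fixes \<phi> :: "real^3 \<Rightarrow> real"
  assumes "invariant \<phi>" "continuous_on UNIV \<phi>"
  shows "\<exists>B. \<forall>q. \<bar>\<phi> q\<bar> \<le> B"
proof -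
  have "compact (\<phi> ` fund_box)"
    using compact_fund_box assms(2) by (intro compact_continuous_image) (auto intro: continuous_on_subset)
  then obtain B where "\<And>q. q \<in> fund_box \<Longrightarrow> \<bar>\<phi> q\<bar> \<le> B"
    by (fastforce dest: compact_imp_bounded simp: bounded_iff)
  then show ?thesis using invariant_from_fund_box[OF assms(1), where P = "\<lambda>u. \<bar>u\<bar> \<le> B"]
    by (intro exI[of _ B]) simp
qed

section \<open>Exponential averages along vertical lines\<close>

text \<open>Averages over the past and the future of a vertical line with exponentially decaying weights
  invert 1+\<partial>_z and 1-\<partial>_z on bounded functions. They are written as expectations
  for the exponential distribution, so that bounds and continuity come from probability measures.\<close>

abbreviation expo :: "real measure" where
  "expo \<equiv> density lborel (exponential_density 1)"

lemma prob_space_expo: "prob_space expo"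
  by (rule prob_space_exponential_density) simp

lemma integrable_expo:
  fixes u :: "real \<Rightarrow> real"
  assumes "continuous_on UNIV u" "\<And>s. \<bar>u s\<bar> \<le> B"
  shows "integrable expo u"
proof -
  interpret prob_space expo by (rule prob_space_expo)
  show ?thesis
    by (rule integrable_const_bound[of _ B])
      (use assms in \<open>auto intro: borel_measurable_continuous_onI\<close>)
qed

lemma expo_bound:
  fixes u :: "real \<Rightarrow> real"
  assumes "continuous_on UNIV u" "\<And>s. \<bar>u s\<bar> \<le> B"
  shows "\<bar>LINT s|expo. u s\<bar> \<le> B"
proof -
  interpret prob_space expo by (rule prob_space_expo)
  have i: "integrable expo u" by (rule integrable_expo[OF assms])
  have "(LINT s|expo. u s) \<le> (LINT s|expo. B)"
    using i assms(2) by (intro integral_mono) (auto simp: abs_le_iff)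
  moreover have "(LINT s|expo. - B) \<le> (LINT s|expo. u s)"
    using i assms(2) by (intro integral_mono) (auto simp: abs_le_iff intro: minus_le_iff[THEN iffD1])
  ultimately show ?thesis by (simp add: prob_space del: space_density)
qed

lemma continuous_on_expo:
  fixes u :: "'a::metric_space \<Rightarrow> real \<Rightarrow> real"
  assumes 1: "\<And>q. continuous_on UNIV (u q)" and 2: "\<And>s. continuous_on UNIV (\<lambda>q. u q s)"
    and B: "\<And>q s. \<bar>u q s\<bar> \<le> B"
  shows "continuous_on UNIV (\<lambda>q. LINT s|expo. u q s)"
proof -
  interpret prob_space expo by (rule prob_space_expo)
  have "(\<lambda>n. LINT s|expo. u (x n) s) \<longlonglongrightarrow> (LINT s|expo. u a s)" if "x \<longlonglongrightarrow> a" for x a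
  proof (rule integral_dominated_convergence[where w = "\<lambda>_. B"])
    show "AE s in expo. (\<lambda>n. u (x n) s) \<longlonglongrightarrow> u a s"
      using continuous_on_tendsto_compose[OF 2 that] by simp
  qed (use 1 B in \<open>auto intro: borel_measurable_continuous_onI\<close>)
  then show ?thesis by (auto simp: continuous_on_sequentially o_def)
qed

text \<open>After the substitution t=z-s the average is e^(-z) times the integral of e^t \<phi>(t) over t \<le> z, to
  which the fundamental theorem of calculus applies.\<close>

lemma expo_has_derivative:
  fixes \<phi> :: "real \<Rightarrow> real"
  assumes c: "continuous_on UNIV \<phi>" and B: "\<And>s. \<bar>\<phi> s\<bar> \<le> B"
  shows "((\<lambda>z. LINT s|expo. \<phi> (z - s)) has_real_derivative \<phi> z - (LINT s|expo. \<phi> (z - s))) (at z)"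
proof -
  have [measurable]: "\<phi> \<in> borel_measurable borel" by (rule borel_measurable_continuous_onI[OF c])
  define h where "h t = exp t * \<phi> t" for t
  have J: "(LINT s|expo. \<phi> (z - s)) = exp (- z) * (LINT t:{..z}|lborel. h t)" 
    and I: "set_integrable lborel {..z} h" for z
  proof -
    have "integrable expo (\<lambda>s. \<phi> (z - s))"
      by (rule integrable_expo[of _ B]) (use c B in \<open>auto intro!: continuous_intros intro: continuous_on_compose2\<close>)
    then have i: "integrable lborel (\<lambda>s. exponential_density 1 s *\<^sub>R \<phi> (z - s))"
      by (subst (asm) integrable_density) (auto simp: exponential_density_def)
    have e: "exponential_density 1 (z - t) * \<phi> t = exp (- z) * (indicator {..z} t * h t)" for t
      by (auto simp: exponential_density_def h_def exp_diff exp_minus field_simps indicator_def)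
    have "(LINT s|expo. \<phi> (z - s)) = (LINT s|lborel. exponential_density 1 s *\<^sub>R \<phi> (z - s))"
      by (subst integral_density) (auto simp: exponential_density_def)
    also have "\<dots> = (LINT t|lborel. exponential_density 1 (z - t) * \<phi> t)"
      by (subst lborel_integral_real_affine[of "-1" _ z]) auto
    also have "\<dots> = exp (- z) * (LINT t:{..z}|lborel. h t)"
      unfolding e set_lebesgue_integral_def by simp
    finally show "(LINT s|expo. \<phi> (z - s)) = exp (- z) * (LINT t:{..z}|lborel. h t)" .
    have "integrable lborel (\<lambda>t. exponential_density 1 (z - t) * \<phi> t)"
      using lborel_integrable_real_affine[OF i, of "-1" z] by simp
    then show "set_integrable lborel {..z} h"
      unfolding e set_integrable_def by (simp add: integrable_mult_right_iff)
  qed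
  have hc: "continuous_on S h" for S
    unfolding h_def by (intro continuous_intros continuous_on_subset[OF c]) auto
  define b where "b = z - 1"
  have split: "(LINT t:{..x}|lborel. h t) = integral {..b} h + integral {b..x} h" if "b \<le> x" for x
  proof -
    have "integral ({..b} \<union> {b..x}) h = integral {..b} h + integral {b..x} h"
      using set_borel_integral_eq_integral(1)[OF I] integrable_continuous_real[OF hc]
      by (intro integral_Un) (auto simp: that Int_atMost intro: negligible_subset[of "{b}"])
    moreover have "{..b} \<union> {b..x} = {..x}" using that by auto
    ultimately show ?thesis using set_borel_integral_eq_integral(2)[OF I] by simp
  qed
  have "((\<lambda>x. integral {b..x} h) has_real_derivative h z) (at z within {b..z + 1})"
    by (rule integral_has_real_derivative) (use hc in \<open>auto simp: b_def\<close>)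
  then have d: "((\<lambda>x. integral {b..x} h) has_real_derivative h z) (at z)"
    by (subst (asm) at_within_interior) (auto simp: b_def)
  have "((\<lambda>x. exp (- x) * (integral {..b} h + integral {b..x} h)) has_real_derivative
      \<phi> z - exp (- z) * (integral {..b} h + integral {b..z} h)) (at z)"
    by (rule derivative_eq_intros d refl | simp)+ (simp add: h_def exp_minus field_simps)
  then have "((\<lambda>x. exp (- x) * (integral {..b} h + integral {b..x} h)) has_real_derivative
      \<phi> z - (LINT s|expo. \<phi> (z - s))) (at z)"
    by (simp add: J split b_def)
  then show ?thesis
    by (rule has_field_derivative_transform_within_open[of _ _ _ "{b<..}"])
      (auto simp: J split b_def)
qed

lemma expo_has_derivative_forward:
  fixes \<phi> :: "real \<Rightarrow> real"
  assumes c: "continuous_on UNIV \<phi>" and B: "\<And>s. \<bar>\<phi> s\<bar> \<le> B"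
  shows "((\<lambda>z. LINT s|expo. \<phi> (z + s)) has_real_derivative (LINT s|expo. \<phi> (z + s)) - \<phi> z) (at z)"
proof -
  have "((\<lambda>z. LINT s|expo. \<phi> (- (z - s))) has_real_derivative \<phi> (- (- z)) - (LINT s|expo. \<phi> (- (- z - s)))) (at (- z))"
    by (rule expo_has_derivative[where \<phi> = "\<lambda>s. \<phi> (- s)" and B = B])
      (use B in \<open>auto intro!: continuous_intros continuous_on_compose2[OF c]\<close>)
  then have "((\<lambda>z. LINT s|expo. \<phi> (s - z)) has_real_derivative \<phi> z - (LINT s|expo. \<phi> (z + s))) (at (- z))"
    by (simp add: add.commute)
  then have "((\<lambda>z. LINT s|expo. \<phi> (s - - z)) has_real_derivative (\<phi> z - (LINT s|expo. \<phi> (z + s))) * - 1) (at z)"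
    by (rule DERIV_chain2) (auto intro!: derivative_eq_intros)
  then show ?thesis by (simp add: add.commute)
qed

section \<open>Shadowing and first integrals\<close>

abbreviation e3 :: "real^3" where "e3 \<equiv> axis 3 1"

text \<open>The displacement k is measured in the orthonormal frame e^z\<partial>_x, e^(-z)\<partial>_y of the
  Sol metric.\<close>

definition shadow :: "(real^3 \<Rightarrow> real \<times> real) \<Rightarrow> real^3 \<Rightarrow> real^3" where
  "shadow k q = pt (q $ 1 + exp (q $ 3) * fst (k q)) (q $ 2 + exp (- (q $ 3)) * snd (k q)) (q $ 3)"

text \<open>The Lyapunov-Perron operator. If f and g are the frame components of a field with vertical
  component one, a fixed point k makes shadow k map vertical lines to orbits: the
  first component of k is then the bounded solution of k_1'=-k_1+f and the second that of
  k_2'=k_2+g along each vertical line.\<close>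

definition perron :: "(real^3 \<Rightarrow> real) \<Rightarrow> (real^3 \<Rightarrow> real) \<Rightarrow> (real^3 \<Rightarrow> real \<times> real) \<Rightarrow> real^3 \<Rightarrow> real \<times> real" where
  "perron f g k q = (LINT s|expo. f (shadow k (q - s *\<^sub>R e3)), - (LINT s|expo. g (shadow k (q + s *\<^sub>R e3))))"

text \<open>A Lipschitz condition for the frame norm in horizontal planes. The constant 1/8 makes the
  Lyapunov-Perron operator a contraction with factor 1/2.\<close>

definition frame_lipschitz :: "(real^3 \<Rightarrow> real) \<Rightarrow> bool" where
  "frame_lipschitz f \<longleftrightarrow> (\<forall>x y x' y' z. \<bar>f (pt x y z) - f (pt x' y' z)\<bar> \<le>
     1 / 8 * (exp (- z) * \<bar>x - x'\<bar> + exp z * \<bar>y - y'\<bar>))"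

lemma shadow_lipschitz:
  assumes "frame_lipschitz f"
  shows "\<bar>f (shadow k q) - f (shadow k' q)\<bar> \<le> 1 / 4 * dist (k q) (k' q)"
proof -
  have "\<bar>f (shadow k q) - f (shadow k' q)\<bar> \<le> 1 / 8 *
    (exp (- (q $ 3)) * \<bar>exp (q $ 3) * (fst (k q) - fst (k' q))\<bar> +
     exp (q $ 3) * \<bar>exp (- (q $ 3)) * (snd (k q) - snd (k' q))\<bar>)"
    using assms[unfolded frame_lipschitz_def, rule_format, of "shadow k q $ 1" "shadow k q $ 2" "q $ 3" "shadow k' q $ 1" "shadow k' q $ 2"]
    by (simp add: shadow_def algebra_simps)
  also have "\<dots> = 1 / 8 * (\<bar>fst (k q) - fst (k' q)\<bar> + \<bar>snd (k q) - snd (k' q)\<bar>)"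
    by (simp add: abs_mult flip: mult.assoc exp_add)
  also have "\<dots> \<le> 1 / 8 * (dist (k q) (k' q) + dist (k q) (k' q))"
    using dist_fst_le[of "k q" "k' q"] dist_snd_le[of "k q" "k' q"] by (simp add: dist_real_def)
  finally show ?thesis by simp
qed

lemma continuous_on_shadow [continuous_intros]:
  assumes "continuous_on UNIV k" "continuous_on S u"
  shows "continuous_on S (\<lambda>x. shadow k (u x))"
proof -
  have "continuous_on UNIV (shadow k)"
    unfolding shadow_def by (intro continuous_intros assms(1))
  from continuous_on_compose2[OF this assms(2)] show ?thesis by auto
qed

lemma shadow_deck:
  "deck n a b (shadow (\<lambda>q. k (deck n a b q)) p) = shadow k (deck n a b p)"
  by (simp add: vec3_eq_iff deck_def shadow_def algebra_simps exp_add exp_minus exp_diff divide_inverse)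

lemma deck_shift: "deck n a b (q + s *\<^sub>R e3) = deck n a b q + s *\<^sub>R e3"
  by (simp add: vec3_eq_iff deck_def axis_def)

lemma perron_deck:
  assumes "invariant f" "invariant g" "(a, b) \<in> Lat"
  shows "perron f g (\<lambda>q. k (deck n a b q)) q = perron f g k (deck n a b q)"
proof -
  have "f (shadow (\<lambda>q. k (deck n a b q)) p) = f (shadow k (deck n a b p))"
    "g (shadow (\<lambda>q. k (deck n a b q)) p) = g (shadow k (deck n a b p))" for p
    using assms invariantD shadow_deck by metis+
  then show ?thesis
    unfolding perron_def using deck_shift[of n a b q] deck_shift[of n a b q "- s" for s] by simp
qed

lemma perron_bcontfun:
  assumes f: "continuous_on UNIV f" "\<And>q. \<bar>f q\<bar> \<le> B" and g: "continuous_on UNIV g" "\<And>q. \<bar>g q\<bar> \<le> B"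
    and k: "continuous_on UNIV k"
  shows "perron f g k \<in> bcontfun"
proof (rule bcontfun_normI[where b = "B + B"])
  note [continuous_intros] = continuous_on_compose2[OF f(1)] continuous_on_compose2[OF g(1)] continuous_on_shadow[OF k]
  show "continuous_on UNIV (perron f g k)"
    unfolding perron_def
    by (intro continuous_on_Pair continuous_on_minus continuous_on_expo[of _ B])
      (use f(2) g(2) in \<open>auto intro!: continuous_intros\<close>)
  have "\<bar>LINT s|expo. f (shadow k (q - s *\<^sub>R e3))\<bar> \<le> B" "\<bar>LINT s|expo. g (shadow k (q + s *\<^sub>R e3))\<bar> \<le> B" for q
    by (rule expo_bound, (intro continuous_intros f(2) g(2) subset_UNIV)+)+
  then show "norm (perron f g k q) \<le> B + B" for q
    unfolding perron_def by (intro norm_Pair_le[THEN order_trans] add_mono) auto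
qed

lemma perron_contraction:
  assumes f: "continuous_on UNIV f" "\<And>q. \<bar>f q\<bar> \<le> B" "frame_lipschitz f"
    and g: "continuous_on UNIV g" "\<And>q. \<bar>g q\<bar> \<le> B" "frame_lipschitz g"
    and k: "continuous_on UNIV k" "continuous_on UNIV k'" and d: "\<And>q. dist (k q) (k' q) \<le> d"
  shows "dist (perron f g k q) (perron f g k' q) \<le> 1 / 2 * d"
proof -
  note [continuous_intros] = continuous_on_compose2[OF f(1)] continuous_on_compose2[OF g(1)]
    continuous_on_shadow[OF k(1)] continuous_on_shadow[OF k(2)]
  have est: "\<bar>(LINT s|expo. u (shadow k (p s))) - (LINT s|expo. u (shadow k' (p s)))\<bar> \<le> 1 / 4 * d"
    if u: "continuous_on UNIV u" "\<And>q. \<bar>u q\<bar> \<le> B" "frame_lipschitz u" and p: "continuous_on UNIV p" for u p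
  proof -
    note [continuous_intros] = continuous_on_compose2[OF u(1)]
    have i: "integrable expo (\<lambda>s. u (shadow k (p s)))" "integrable expo (\<lambda>s. u (shadow k' (p s)))"
      by (rule integrable_expo[of _ B], (intro continuous_intros u(2) p subset_UNIV)+)+
    have "\<bar>u (shadow k q) - u (shadow k' q)\<bar> \<le> 1 / 4 * d" for q
      using shadow_lipschitz[OF u(3), of k q k'] d[of q] by linarith
    then have "\<bar>LINT s|expo. u (shadow k (p s)) - u (shadow k' (p s))\<bar> \<le> 1 / 4 * d"
      by (intro expo_bound) (intro continuous_intros p subset_UNIV)
    then show ?thesis using i by simp
  qed
  have c: "continuous_on UNIV (\<lambda>s. q - s *\<^sub>R e3)" "continuous_on UNIV (\<lambda>s. q + s *\<^sub>R e3)"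
    by (intro continuous_intros)+
  have "dist (perron f g k q) (perron f g k' q) \<le> 1 / 4 * d + 1 / 4 * d"
    unfolding perron_def dist_norm diff_Pair
    by (intro norm_Pair_le[THEN order_trans] add_mono; unfold real_norm_def)
      (use est[OF f c(1)] est[OF g c(2)] in linarith)+
  then show ?thesis by simp
qed

text \<open>The deck group commutes with the operator, so composing the fixed point with a deck
  transformation gives another fixed point; uniqueness makes the fixed point invariant.\<close>

lemma perron_fixed_point:
  assumes f: "continuous_on UNIV f" "invariant f" "frame_lipschitz f"
    and g: "continuous_on UNIV g" "invariant g" "frame_lipschitz g"
  obtains k where "continuous_on UNIV k" "bounded (range k)" "invariant k" "perron f g k = k"
proof -
  obtain B1 B2 where "\<And>q. \<bar>f q\<bar> \<le> B1" "\<And>q. \<bar>g q\<bar> \<le> B2"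
    using invariant_bounded f(1,2) g(1,2) by metis
  then have B: "\<bar>f q\<bar> \<le> max B1 B2" "\<bar>g q\<bar> \<le> max B1 B2" for q
    by (simp_all add: le_max_iff_disj)
  define P where "P c = Bcontfun (perron f g (apply_bcontfun c))" for c
  have bc: "perron f g (apply_bcontfun c) \<in> bcontfun" for c :: "(real^3) \<Rightarrow>\<^sub>C (real \<times> real)"
    by (rule perron_bcontfun[OF f(1) B(1) g(1) B(2)]) auto
  have P: "apply_bcontfun (P c) = perron f g (apply_bcontfun c)" for c
    unfolding P_def by (rule Bcontfun_inverse[OF bc])
  have "dist (P c) (P c') \<le> 1 / 2 * dist c c'" for c c'
    by (rule dist_bound, unfold P, rule perron_contraction[OF f(1) B(1) f(3) g(1) B(2) g(3)])
      (auto simp: dist_bounded)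
  then have ex: "\<exists>!c. P c = c"
    by (intro banach_fix_type[of "1/2"]) auto
  then obtain c where c: "P c = c" and u: "\<And>c'. P c' = c' \<Longrightarrow> c' = c" by blast
  have "invariant (apply_bcontfun c)"
    unfolding invariant_def
  proof (intro allI impI)
    fix n a b q assume ab: "(a, b) \<in> Lat"
    let ?k = "\<lambda>q. apply_bcontfun c (deck n a b q)"
    have "?k \<in> bcontfun"
    proof (rule bcontfun_normI)
      show "continuous_on UNIV ?k"
        by (rule continuous_on_compose2[OF continuous_on_apply_bcontfun[of UNIV]])
          (auto simp: deck_def intro!: continuous_intros)
      show "norm (?k q) \<le> norm c" for q by (rule norm_bounded)
    qed
    then have k: "apply_bcontfun (Bcontfun ?k) = ?k" by (rule Bcontfun_inverse)
    have "P (Bcontfun ?k) = Bcontfun ?k"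
    proof (rule bcontfun_eqI)
      fix x
      show "apply_bcontfun (P (Bcontfun ?k)) x = apply_bcontfun (Bcontfun ?k) x"
        unfolding P k perron_deck[OF f(2) g(2) ab] by (metis P c)
    qed
    then have "Bcontfun ?k = c" by (rule u)
    then show "apply_bcontfun c (deck n a b q) = apply_bcontfun c q" using k by metis
  qed
  then show thesis
    using that[of "apply_bcontfun c"] P[of c] c by (metis continuous_on_apply_bcontfun bounded_apply_bcontfun)
qed

lemma shadow_orbit:
  assumes f: "continuous_on UNIV f" "\<And>q. \<bar>f q\<bar> \<le> B" and g: "continuous_on UNIV g" "\<And>q. \<bar>g q\<bar> \<le> B"
    and k: "continuous_on UNIV k" "perron f g k = k"
  shows "((\<lambda>z. shadow k (pt x y z) $ 1) has_real_derivative exp z * f (shadow k (pt x y z))) (at z)"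
    "((\<lambda>z. shadow k (pt x y z) $ 2) has_real_derivative exp (- z) * g (shadow k (pt x y z))) (at z)"
proof -
  have k1: "fst (k (pt x y z)) = (LINT s|expo. f (shadow k (pt x y (z - s))))" 
    and k2: "snd (k (pt x y z)) = - (LINT s|expo. g (shadow k (pt x y (z + s))))" for z
  proof -
    have "pt x y z - s *\<^sub>R e3 = pt x y (z - s)" "pt x y z + s *\<^sub>R e3 = pt x y (z + s)" for s
      by (simp_all add: vec3_eq_iff axis_def)
    then show "fst (k (pt x y z)) = (LINT s|expo. f (shadow k (pt x y (z - s))))"
      "snd (k (pt x y z)) = - (LINT s|expo. g (shadow k (pt x y (z + s))))"
      by (subst k(2)[symmetric], simp add: perron_def)+
  qed
  note [continuous_intros] = continuous_on_compose2[OF f(1)] continuous_on_compose2[OF g(1)] continuous_on_shadow[OF k(1)]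
  have "continuous_on UNIV (\<lambda>s. f (shadow k (pt x y s)))" by (intro continuous_intros subset_UNIV)
  note d1 = expo_has_derivative[OF this f(2)]
  have "continuous_on UNIV (\<lambda>s. g (shadow k (pt x y s)))" by (intro continuous_intros subset_UNIV)
  note d2 = expo_has_derivative_forward[OF this g(2)]
  have e1: "shadow k (pt x y z) $ 1 = x + exp z * (LINT s|expo. f (shadow k (pt x y (z - s))))"
    and e2: "shadow k (pt x y z) $ 2 = y - exp (- z) * (LINT s|expo. g (shadow k (pt x y (z + s))))" for z
    using k1[of z] k2[of z] by (simp_all add: shadow_def[of k "pt x y z"])
  show "((\<lambda>z. shadow k (pt x y z) $ 1) has_real_derivative exp z * f (shadow k (pt x y z))) (at z)"
    unfolding e1 by (auto intro!: derivative_eq_intros d1) (simp add: algebra_simps)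
  show "((\<lambda>z. shadow k (pt x y z) $ 2) has_real_derivative exp (- z) * g (shadow k (pt x y z))) (at z)"
    unfolding e2 by (auto intro!: derivative_eq_intros d2) (simp add: algebra_simps)
qed

text \<open>On a horizontal plane the map differs from the identity by a bounded displacement, so every
  point has a preimage by Brouwer's theorem on a large disc.\<close>

lemma shadow_surj:
  assumes k: "continuous_on UNIV k" "bounded (range k)"
  shows "\<exists>p. shadow k p = q"
proof -
  obtain B where nB: "\<And>u. norm (k u) \<le> B" using k(2) by (auto simp: bounded_iff)
  have B: "\<bar>fst (k u)\<bar> \<le> B" "\<bar>snd (k u)\<bar> \<le> B" for u
    using norm_fst_le[of "fst (k u)" "snd (k u)"] norm_snd_le[of "snd (k u)" "fst (k u)"] nB[of u] by simp_all
  define z where "z = q $ 3"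
  \<comment> \<open>A fixed point of this map is the horizontal position of a preimage of q.\<close>
  define T where "T u = (q $ 1 - exp z * fst (k (pt (fst u) (snd u) z)), q $ 2 - exp (- z) * snd (k (pt (fst u) (snd u) z)))" for u
  define R where "R = (\<bar>q $ 1\<bar> + exp z * B) + (\<bar>q $ 2\<bar> + exp (- z) * B) + 1"
  have "0 \<le> B" using B(1)[of 0] by linarith
  then have "R > 0" unfolding R_def by (intro add_nonneg_pos add_nonneg_nonneg mult_nonneg_nonneg) auto
  moreover have "continuous_on (cball 0 R) T"
    unfolding T_def by (intro continuous_intros continuous_on_compose2[OF k(1)] subset_UNIV)
  moreover have "T \<in> cball 0 R \<rightarrow> cball 0 R"
  proof
    fix u
    have "norm (T u) \<le> norm (fst (T u)) + norm (snd (T u))"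
      by (metis norm_Pair_le prod.collapse)
    also have "\<dots> \<le> (\<bar>q $ 1\<bar> + exp z * B) + (\<bar>q $ 2\<bar> + exp (- z) * B)"
      unfolding T_def fst_conv snd_conv real_norm_def
      by (intro add_mono abs_triangle_ineq4[THEN order_trans]) (auto simp: abs_mult B)
    finally show "T u \<in> cball 0 R" by (simp add: R_def)
  qed
  ultimately obtain u where u: "T u = u" using brouwer_ball by blast
  then have "shadow k (pt (fst u) (snd u) z) = q"
    unfolding vec3_eq_iff shadow_def T_def prod_eq_iff by (simp add: z_def algebra_simps)
  then show ?thesis by blast
qed

text \<open>Uniform continuity on a compact set that contains a neighbourhood of a fundamental domain of the
  lattice extends to the whole plane by periodicity.\<close>

lemma periodic_uniformly_continuous:
  fixes \<phi> :: "real^3 \<Rightarrow> real"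
  assumes c: "continuous_on UNIV \<phi>" and i: "invariant \<phi>" and e: "e > 0"
  shows "\<exists>d>0. \<forall>x y h h'. \<bar>h\<bar> < d \<longrightarrow> \<bar>h'\<bar> < d \<longrightarrow> \<bar>\<phi> (pt (x + h) (y + h') 0) - \<phi> (pt x y 0)\<bar> < e"
proof -
  have "uniformly_continuous_on (cbox (-4, -4) (4, 4)) (\<lambda>u. \<phi> (pt (fst u) (snd u) 0))"
    by (intro compact_uniformly_continuous continuous_intros continuous_on_compose2[OF c]) auto
  then obtain d where d: "d > 0" and *: "\<And>u u' :: real \<times> real. u \<in> cbox (-4, -4) (4, 4) \<Longrightarrow> u' \<in> cbox (-4, -4) (4, 4) \<Longrightarrow>
      dist u' u < d \<Longrightarrow> dist (\<phi> (pt (fst u') (snd u') 0)) (\<phi> (pt (fst u) (snd u) 0)) < e"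
    unfolding uniformly_continuous_on_def using e by metis
  define d' where "d' = min 1 (d / 2)"
  show ?thesis
  proof (intro exI[of _ d'] conjI allI impI)
    show "d' > 0" using d by (simp add: d'_def)
    fix x y h h' :: real assume h: "\<bar>h\<bar> < d'" "\<bar>h'\<bar> < d'"
    obtain a b where ab: "(a, b) \<in> Lat" "\<bar>x + a\<bar> \<le> 3" "\<bar>y + b\<bar> \<le> 3" using Lat_reduce by blast
    have tr: "\<phi> (pt (x + a) (y + b) 0) = \<phi> (pt x y 0)" for x y
      using invariantD[OF i ab(1), of 0 "pt x y 0"] by (simp add: deck_def)
    have "dist (x + a + h, y + b + h') (x + a, y + b) \<le> \<bar>h\<bar> + \<bar>h'\<bar>"
      unfolding dist_norm diff_Pair by (rule norm_Pair_le[THEN order_trans]) auto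
    also have "\<dots> < d" using h unfolding d'_def by linarith
    finally have "dist (\<phi> (pt (x + a + h) (y + b + h') 0)) (\<phi> (pt (x + a) (y + b) 0)) < e"
      using *[of "(x + a, y + b)" "(x + a + h, y + b + h')"] ab(2,3) h unfolding d'_def
      by (auto simp: abs_le_iff abs_less_iff)
    then show "\<bar>\<phi> (pt (x + h) (y + h') 0) - \<phi> (pt x y 0)\<bar> < e"
      using tr[of x y] tr[of "x + h" "y + h'"] by (simp add: dist_real_def algebra_simps)
  qed
qed

text \<open>The values of \<phi> at (x,y) and (0,y) equal those at (e^(-n ell)x,e^(n ell)y) and
  (0,e^(n ell)y), which are as close as desired for large n; the second coordinate is
  removed in the same way with the inverse automorphism.\<close>

lemma invariant_vertical_constant:
  fixes \<phi> :: "real^3 \<Rightarrow> real"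
  assumes c: "continuous_on UNIV \<phi>" and i: "invariant \<phi>" and v: "\<And>x y z. \<phi> (pt x y z) = \<phi> (pt x y 0)"
  shows "\<phi> q = \<phi> 0"
proof -
  define l where "l x y = \<phi> (pt x y 0)" for x y
  have scale: "l (exp (of_int n * ell) * x) (exp (- (of_int n * ell)) * y) = l x y" for n x y
    using invariantD[OF i Lat_zero, of n "pt x y 0"]
      v[of "exp (of_int n * ell) * x" "exp (- (of_int n * ell)) * y" "of_int n * ell"]
    unfolding l_def deck_def by simp
  have small: "\<exists>n::nat. exp (- (real n * ell)) * \<bar>x\<bar> < d" if "d > 0" for x d :: real
  proof -
    have "(\<lambda>n::nat. exp (- ell) ^ n * \<bar>x\<bar>) \<longlonglongrightarrow> 0 * \<bar>x\<bar>"
      using ell_bounds by (intro tendsto_intros LIMSEQ_power_zero) auto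
    then have "\<forall>\<^sub>F n in sequentially. exp (- ell) ^ n * \<bar>x\<bar> < d"
      using that by (simp add: order_tendstoD)
    then show ?thesis by (auto simp: eventually_sequentially simp flip: exp_of_nat_mult)
  qed
  have eq0: "l x y = l 0 y" for x y
  proof (rule ccontr)
    assume ne: "l x y \<noteq> l 0 y"
    then obtain d where d: "d > 0"
      "\<forall>x' y' h h'. \<bar>h\<bar> < d \<longrightarrow> \<bar>h'\<bar> < d \<longrightarrow> \<bar>l (x' + h) (y' + h') - l x' y'\<bar> < \<bar>l x y - l 0 y\<bar>"
      using periodic_uniformly_continuous[OF c i, of "\<bar>l x y - l 0 y\<bar>", folded l_def] by auto
    obtain n :: nat where n: "exp (- (real n * ell)) * \<bar>x\<bar> < d" using small[OF d(1)] by blast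
    show False
      using d(2)[rule_format, of "exp (- (real n * ell)) * x" 0 0 "exp (real n * ell) * y"] n d(1)
        scale[of "- int n" x y] scale[of "- int n" 0 y] by (simp add: abs_mult)
  qed
  have eq1: "l 0 y = l 0 0" for y
  proof (rule ccontr)
    assume ne: "l 0 y \<noteq> l 0 0"
    then obtain d where d: "d > 0"
      "\<forall>x' y' h h'. \<bar>h\<bar> < d \<longrightarrow> \<bar>h'\<bar> < d \<longrightarrow> \<bar>l (x' + h) (y' + h') - l x' y'\<bar> < \<bar>l 0 y - l 0 0\<bar>"
      using periodic_uniformly_continuous[OF c i, of "\<bar>l 0 y - l 0 0\<bar>", folded l_def] by auto
    obtain n :: nat where n: "exp (- (real n * ell)) * \<bar>y\<bar> < d" using small[OF d(1)] by blast
    show False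
      using d(2)[rule_format, of 0 "exp (- (real n * ell)) * y" 0 0] n d(1) scale[of "int n" 0 y] by (simp add: abs_mult)
  qed
  have "\<phi> q = l (q $ 1) (q $ 2)" using v[of "q $ 1" "q $ 2" "q $ 3"] by (simp add: l_def)
  also have "\<dots> = l 0 0" using eq0 eq1 by metis
  also have "\<dots> = \<phi> 0" by (simp add: l_def pt_def)
  finally show ?thesis .
qed

text \<open>The composition of a first integral with the shadowing map is constant on vertical lines, hence
  constant, and the shadowing map is onto. The orbits are parametrized by z.\<close>

theorem first_integral_constant:
  fixes \<phi> :: "real^3 \<Rightarrow> real"
  assumes f: "continuous_on UNIV f" "invariant f" "frame_lipschitz f"
    and g: "continuous_on UNIV g" "invariant g" "frame_lipschitz g"
    and \<phi>: "continuous_on UNIV \<phi>" "invariant \<phi>"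
    and first_integral: "\<And>X Y z. (\<And>z. (X has_real_derivative exp z * f (pt (X z) (Y z) z)) (at z)) \<Longrightarrow>
       (\<And>z. (Y has_real_derivative exp (- z) * g (pt (X z) (Y z) z)) (at z)) \<Longrightarrow>
       \<phi> (pt (X z) (Y z) z) = \<phi> (pt (X 0) (Y 0) 0)"
  shows "\<exists>c. \<forall>q. \<phi> q = c"
proof -
  obtain k where k: "continuous_on UNIV k" "bounded (range k)" "invariant k" "perron f g k = k"
    using perron_fixed_point[OF f g] .
  obtain B1 B2 where "\<And>q. \<bar>f q\<bar> \<le> B1" "\<And>q. \<bar>g q\<bar> \<le> B2"
    using invariant_bounded f(1,2) g(1,2) by metis
  then have B: "\<bar>f q\<bar> \<le> max B1 B2" "\<bar>g q\<bar> \<le> max B1 B2" for q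
    by (simp_all add: le_max_iff_disj)
  note orb = shadow_orbit[OF f(1) B(1) g(1) B(2) k(1,4)]
  have col: "pt (shadow k (pt x y z) $ 1) (shadow k (pt x y z) $ 2) z = shadow k (pt x y z)" for x y z
    by (simp add: vec3_eq_iff) (simp add: shadow_def)
  have vert: "\<phi> (shadow k (pt x y z)) = \<phi> (shadow k (pt x y 0))" for x y z
    using first_integral[of "\<lambda>z. shadow k (pt x y z) $ 1" "\<lambda>z. shadow k (pt x y z) $ 2" z] orb
    unfolding col by blast
  have inv: "invariant (\<lambda>q. \<phi> (shadow k q))"
    unfolding invariant_def
  proof (intro allI impI)
    fix n a b q assume ab: "(a, b) \<in> Lat"
    have "(\<lambda>q. k (deck n a b q)) = k" using invariantD[OF k(3) ab] by blast
    then have "shadow k (deck n a b q) = deck n a b (shadow k q)"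
      using shadow_deck[of n a b k q] by simp
    then show "\<phi> (shadow k (deck n a b q)) = \<phi> (shadow k q)"
      using invariantD[OF \<phi>(2) ab] by simp
  qed
  have "\<phi> (shadow k p) = \<phi> (shadow k 0)" for p
    by (rule invariant_vertical_constant[OF _ inv vert])
      (intro continuous_intros continuous_on_compose2[OF \<phi>(1)] k(1) subset_UNIV)
  then have "\<phi> q = \<phi> (shadow k 0)" for q
    using shadow_surj[OF k(1,2), of q] by metis
  then show ?thesis by blast
qed

section \<open>Transport of the vorticity\<close>

abbreviation e1 :: "real^3" where "e1 \<equiv> axis 1 1"
abbreviation e2 :: "real^3" where "e2 \<equiv> axis 2 1"

text \<open>Continuous differentiability on all of \<real>^3 together with its gradient, in the form that
  the chain rule along curves uses.\<close>

definition C1_grad :: "(real^3 \<Rightarrow> real) \<Rightarrow> (real^3 \<Rightarrow> real^3) \<Rightarrow> bool" where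
  "C1_grad u u' \<longleftrightarrow> continuous_on UNIV u' \<and> (\<forall>q. (u has_derivative (\<lambda>h. u' q \<bullet> h)) (at q))"

lemma C1_grad_cont:
  assumes "C1_grad u u'" shows "continuous_on UNIV u" "continuous_on UNIV u'"
  using assms unfolding C1_grad_def by (auto intro: has_derivative_continuous_on has_derivative_at_withinI)

lemma C1_grad_chain:
  assumes "C1_grad u u'" "(\<gamma> has_vector_derivative v) (at t within S)"
  shows "((\<lambda>t. u (\<gamma> t)) has_real_derivative u' (\<gamma> t) \<bullet> v) (at t within S)"
proof -
  have "(u has_derivative (\<lambda>h. u' (\<gamma> t) \<bullet> h)) (at (\<gamma> t))" using assms(1) by (simp add: C1_grad_def)
  from has_derivative_compose[OF assms(2)[unfolded has_vector_derivative_def] this]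
  show ?thesis
    unfolding has_field_derivative_def by (rule has_derivative_eq_rhs) (simp add: fun_eq_iff)
qed

lemma C1_grad_line:
  assumes "C1_grad u u'"
  shows "((\<lambda>t. u (q + t *\<^sub>R v)) has_real_derivative u' (q + t *\<^sub>R v) \<bullet> v) (at t within S)"
  by (rule C1_grad_chain[OF assms]) (auto intro!: derivative_eq_intros)

lemma inner_3: "u \<bullet> v = u $ 1 * v $ 1 + u $ 2 * v $ 2 + u $ 3 * v $ 3" for u v :: "real^3"
  by (simp add: inner_vec_def sum_3)

lemma inner_axes [simp]: "u \<bullet> e1 = u $ 1" "u \<bullet> e2 = u $ 2" "u \<bullet> e3 = u $ 3" for u :: "real^3"
  by (simp_all add: inner_axis)

lemma C1_grad_lin_approx:
  assumes u: "C1_grad u u'" and q: "\<And>q. dist q p < d \<Longrightarrow> dist (u' q) (u' p) < \<eta>"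
    and b: "dist b p < d" "dist c p < d"
  shows "\<bar>u c - u b - u' p \<bullet> (c - b)\<bar> \<le> norm (c - b) * \<eta>"
proof -
  have ball: "b + t *\<^sub>R (c - b) \<in> ball p d" if "t \<in> {0..1}" for t
    using convexD_alt[OF convex_ball, of b p d c t] b that
    by (simp add: dist_commute algebra_simps)
  have "norm (u c - u b - u' p \<bullet> (c - b)) \<le> norm (c - b) * \<eta>"
  proof (rule differentiable_bound_linearization[where S = "ball p d" and f' = "\<lambda>q h. u' q \<bullet> h" and ?x0.0 = p])
    show "(u has_derivative (\<bullet>) (u' x)) (at x within ball p d)" for x
      using u by (auto simp: C1_grad_def intro: has_derivative_at_withinI)
    show "onorm ((\<bullet>) (u' x) - (\<bullet>) (u' p)) \<le> \<eta>" if "x \<in> ball p d" for x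
    proof (rule onorm_le)
      fix h
      have "norm (u' x \<bullet> h - u' p \<bullet> h) \<le> norm (u' x - u' p) * norm h"
        using Cauchy_Schwarz_ineq2[of "u' x - u' p" h] by (simp add: inner_diff_left)
      also have "\<dots> \<le> \<eta> * norm h"
        using q[of x] that by (intro mult_right_mono) (auto simp: dist_commute dist_norm norm_minus_commute)
      finally show "norm (((\<bullet>) (u' x) - (\<bullet>) (u' p)) h) \<le> \<eta> * norm h" by simp
    qed
    show "p \<in> ball p d" using b by (metis mem_ball dist_self order_le_less_trans zero_le_dist)
  qed (use ball in auto)
  then show ?thesis by simp
qed

lemma tube_continuity:
  fixes u :: "real^3 \<Rightarrow> 'a::metric_space" and P :: "real \<Rightarrow> real^3"
  assumes u: "continuous_on UNIV u" and P: "continuous_on UNIV P" and \<eta>: "\<eta> > 0"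
  shows "\<exists>d>0. \<forall>z\<in>{A..B}. \<forall>q. dist q (P z) < d \<longrightarrow> dist (u q) (u (P z)) < \<eta>"
proof -
  have "compact (P ` {A..B})" by (intro compact_continuous_image continuous_on_subset[OF P]) auto
  then obtain R where R: "\<And>z. z \<in> {A..B} \<Longrightarrow> norm (P z) \<le> R"
    by (fastforce dest: compact_imp_bounded simp: bounded_iff)
  have "uniformly_continuous_on (cball 0 (R + 1)) u"
    by (intro compact_uniformly_continuous continuous_on_subset[OF u]) auto
  then obtain d where d: "d > 0" "\<And>q q'. q \<in> cball 0 (R + 1) \<Longrightarrow> q' \<in> cball 0 (R + 1) \<Longrightarrow> dist q' q < d \<Longrightarrow> dist (u q') (u q) < \<eta>"
    unfolding uniformly_continuous_on_def using \<eta> by metis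
  show ?thesis
  proof (intro exI[of _ "min d 1"] conjI ballI allI impI)
    fix z q assume z: "z \<in> {A..B}" and q: "dist q (P z) < min d 1"
    have "norm q \<le> norm (P z) + dist q (P z)" by (simp add: dist_norm norm_triangle_sub)
    then have "norm q \<le> R + 1" using R[OF z] q by linarith
    moreover have "norm (P z) \<le> R + 1" using R[OF z] by linarith
    ultimately show "dist (u q) (u (P z)) < \<eta>" using q by (intro d(2)) auto
  qed (use d in auto)
qed

text \<open>The circulation of a_1dx+a_2dy+a_3dz around the horizontal square of side h with lower left
  corner p, divided by h.\<close>

definition circ :: "(real^3 \<Rightarrow> real) \<Rightarrow> (real^3 \<Rightarrow> real) \<Rightarrow> real^3 \<Rightarrow> real \<Rightarrow> real" where
  "circ a1 a2 p h = integral {0..1} (\<lambda>s. a2 (p + h *\<^sub>R e1 + (s * h) *\<^sub>R e2) - a2 (p + (s * h) *\<^sub>R e2)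
     - a1 (p + h *\<^sub>R e2 + (s * h) *\<^sub>R e1) + a1 (p + (s * h) *\<^sub>R e1))"

lemma integral_line:
  assumes "C1_grad m m'"
  shows "((\<lambda>s. h * (m' (p + (s * h) *\<^sub>R v) \<bullet> v)) has_integral m (p + h *\<^sub>R v) - m p) {0..1}"
proof -
  have "((\<lambda>s. m (p + (s * h) *\<^sub>R v)) has_vector_derivative h * (m' (p + (s * h) *\<^sub>R v) \<bullet> v)) (at s within {0..1})" for s
  proof -
    have "((\<lambda>s. m (p + (s * h) *\<^sub>R v)) has_real_derivative m' (p + (s * h) *\<^sub>R v) \<bullet> (h *\<^sub>R v)) (at s within {0..1})"
      by (rule C1_grad_chain[OF assms]) (auto intro!: derivative_eq_intros)
    then show ?thesis by (simp add: has_real_derivative_iff_has_vector_derivative)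
  qed
  from fundamental_theorem_of_calculus[OF _ this] show ?thesis by simp
qed

lemma circ_stokes:
  assumes a: "C1_grad a1 a1'" "C1_grad a2 a2'" and lower: "\<And>q. q $ 3 = p $ 3 \<Longrightarrow> m \<le> a2' q $ 1 - a1' q $ 2" and h: "h \<ge> 0"
  shows "h * m \<le> circ a1 a2 p h"
proof -
  note c = C1_grad_cont[OF a(1)] C1_grad_cont[OF a(2)]
  note ci [continuous_intros] = continuous_on_compose2[OF c(1)] continuous_on_compose2[OF c(2)] continuous_on_compose2[OF c(3)] continuous_on_compose2[OF c(4)]
  define U where "U s t = h * (a2' (p + (s * h) *\<^sub>R e2 + (t * h) *\<^sub>R e1) $ 1)" for s t
  define V where "V s t = h * (a1' (p + (s * h) *\<^sub>R e1 + (t * h) *\<^sub>R e2) $ 2)" for s t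
  have U: "a2 (p + h *\<^sub>R e1 + (s * h) *\<^sub>R e2) - a2 (p + (s * h) *\<^sub>R e2) = integral {0..1} (U s)" for s
    using integral_line[OF a(2), of h "p + (s * h) *\<^sub>R e2" e1]
    by (intro integral_unique[symmetric]) (simp add: U_def[abs_def] add_ac)
  have V: "a1 (p + h *\<^sub>R e2 + (s * h) *\<^sub>R e1) - a1 (p + (s * h) *\<^sub>R e1) = integral {0..1} (V s)" for s
    using integral_line[OF a(1), of h "p + (s * h) *\<^sub>R e1" e2]
    by (intro integral_unique[symmetric]) (simp add: V_def[abs_def] add_ac)
  have cU: "continuous_on S (\<lambda>x. U (fst x) (snd x))" and cV: "continuous_on S (\<lambda>x. V (fst x) (snd x))"
    and cV': "continuous_on S (\<lambda>x. V (snd x) (fst x))" for S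
    unfolding U_def V_def by (intro continuous_intros subset_UNIV)+
  have cU1: "continuous_on S (U s)" and cV1: "continuous_on S (V s)" and cV2: "continuous_on S (\<lambda>s. V s t)" for S s t
    unfolding U_def V_def by (intro continuous_intros subset_UNIV)+
  have IU: "continuous_on {0..1} (\<lambda>s. integral {0..1} (U s))" and IV: "continuous_on {0..1} (\<lambda>s. integral {0..1} (V s))"
    and IV': "continuous_on {0..1} (\<lambda>t. integral {0..1} (\<lambda>s. V s t))"
    using integral_continuous_on_param[of "{0..1}" 0 1 U] integral_continuous_on_param[of "{0..1}" 0 1 V]
      integral_continuous_on_param[of "{0..1}" 0 1 "\<lambda>t s. V s t"] cU cV cV'
    by (simp_all add: case_prod_beta')
  have swap: "integral {0..1} (\<lambda>s. integral {0..1} (V s)) = integral {0..1} (\<lambda>t. integral {0..1} (\<lambda>s. V s t))"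
    using integral_swap_continuous[of 0 0 1 1 V] cV by (simp add: case_prod_beta')
  have "circ a1 a2 p h = integral {0..1} (\<lambda>s. integral {0..1} (U s) - integral {0..1} (V s))"
    unfolding circ_def U[symmetric] V[symmetric] by (simp add: algebra_simps)
  also have "\<dots> = integral {0..1} (\<lambda>s. integral {0..1} (U s)) - integral {0..1} (\<lambda>s. integral {0..1} (V s))"
    by (intro integral_diff integrable_continuous_real IU IV)
  also have "\<dots> = integral {0..1} (\<lambda>s. integral {0..1} (U s) - integral {0..1} (\<lambda>t. V t s))"
    unfolding swap by (intro integral_diff[symmetric] integrable_continuous_real IU IV')
  also have "\<dots> = integral {0..1} (\<lambda>s. integral {0..1} (\<lambda>t. U s t - V t s))"
    by (intro arg_cong[of _ _ "integral _"] ext integral_diff[symmetric] integrable_continuous_real cU1 cV2)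
  also have "\<dots> \<ge> integral {0..1} (\<lambda>s::real. integral {0..1} (\<lambda>t::real. h * m))"
  proof (intro integral_le integrable_continuous_real)
    fix s t :: real
    define Q where "Q = p + (s * h) *\<^sub>R e2 + (t * h) *\<^sub>R e1"
    have Q: "Q = p + (t * h) *\<^sub>R e1 + (s * h) *\<^sub>R e2" by (simp add: Q_def add_ac)
    have "m \<le> a2' Q $ 1 - a1' Q $ 2" by (rule lower) (simp add: Q_def axis_def)
    then have "h * m \<le> h * (a2' Q $ 1 - a1' Q $ 2)" using h by (rule mult_left_mono)
    also have "\<dots> = U s t - V t s"
      unfolding U_def V_def Q_def[symmetric] Q[symmetric] by (simp add: algebra_simps)
    finally show "h * m \<le> U s t - V t s" .
  next
    show "continuous_on {0..1} (\<lambda>s. integral {0..1} (\<lambda>t. U s t - V t s))"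
      using integral_continuous_on_param[of "{0..1}" 0 1 "\<lambda>s t. U s t - V t s"] cU cV'
      by (simp add: case_prod_beta' continuous_on_diff)
  qed (auto intro!: continuous_intros cU1 cV2)
  finally show ?thesis by simp
qed

definition flux_increment :: "(real^3 \<Rightarrow> real) \<Rightarrow> (real^3 \<Rightarrow> real) \<Rightarrow> real^3 \<Rightarrow> real^3 \<Rightarrow> real^3 \<Rightarrow> real" where
  "flux_increment u w p d q = (u (q + d) - u p) * w (q + d) - (u q - u p) * w q"

text \<open>Kelvin's theorem. The hypotheses on the curl say that da is annihilated by the
  field V=(f,g,1). While the corner follows an orbit, the square is translated rigidly with the
  constant velocity V(P(z)). By Cartan's formula the Lie derivative of a with respect to that
  constant field is an exact form, whose circulation vanishes, plus the contraction of da with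
  V(P(z))-V; only this difference remains under the integral.\<close>

lemma circ_deriv:
  assumes a: "C1_grad a1 a1'" "C1_grad a2 a2'" "C1_grad a3 a3'"
    and w: "\<And>q. w q = a2' q $ 1 - a1' q $ 2"
    and k1: "\<And>q. a3' q $ 1 - a1' q $ 3 = - g q * w q" and k2: "\<And>q. a3' q $ 2 - a2' q $ 3 = f q * w q"
    and fg: "continuous_on UNIV f" "continuous_on UNIV g"
    and P: "\<And>z. (P has_vector_derivative pt (f (P z)) (g (P z)) 1) (at z)"
  shows "((\<lambda>z. circ a1 a2 (P z) h) has_real_derivative
     - integral {0..1} (\<lambda>s. flux_increment f w (P z) (h *\<^sub>R e1) (P z + (s * h) *\<^sub>R e2)
       + flux_increment g w (P z) (h *\<^sub>R e2) (P z + (s * h) *\<^sub>R e1))) (at z)"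
proof -
  note c = C1_grad_cont[OF a(1)] C1_grad_cont[OF a(2)] C1_grad_cont[OF a(3)]
  have Pc: "continuous_on UNIV P"
    by (rule continuous_on_vector_derivative[OF has_vector_derivative_at_within[OF P]])
  have wc: "continuous_on UNIV w" unfolding w by (intro continuous_intros c)
  note ci [continuous_intros] = c[THEN continuous_on_compose2] continuous_on_compose2[OF Pc] 
    continuous_on_compose2[OF fg(1)] continuous_on_compose2[OF fg(2)] continuous_on_compose2[OF wc]
  define V where "V z = pt (f (P z)) (g (P z)) 1" for z
  define q1 q2 q3 q4 where "q1 z s = P z + h *\<^sub>R e1 + (s * h) *\<^sub>R e2" and "q2 z s = P z + (s * h) *\<^sub>R e2"
    and "q3 z s = P z + h *\<^sub>R e2 + (s * h) *\<^sub>R e1" and "q4 z s = P z + (s * h) *\<^sub>R e1" for z s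
  define D where "D z s = a2' (q1 z s) \<bullet> V z - a2' (q2 z s) \<bullet> V z - a1' (q3 z s) \<bullet> V z + a1' (q4 z s) \<bullet> V z" for z s
  have dq: "((\<lambda>z. q1 z s) has_vector_derivative V z) (at z within S)" "((\<lambda>z. q2 z s) has_vector_derivative V z) (at z within S)"
     "((\<lambda>z. q3 z s) has_vector_derivative V z) (at z within S)" "((\<lambda>z. q4 z s) has_vector_derivative V z) (at z within S)" for z s S
    unfolding q1_def q2_def q3_def q4_def V_def
    by (auto intro!: derivative_eq_intros has_vector_derivative_at_within[OF P])
  have "((\<lambda>z. integral (cbox 0 1) (\<lambda>s. a2 (q1 z s) - a2 (q2 z s) - a1 (q3 z s) + a1 (q4 z s))) has_field_derivative
      integral (cbox 0 1) (D z)) (at z within UNIV)"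
  proof (rule leibniz_rule_field_derivative)
    show "((\<lambda>z. a2 (q1 z s) - a2 (q2 z s) - a1 (q3 z s) + a1 (q4 z s)) has_field_derivative D z s) (at z within UNIV)" for z s
      unfolding D_def by (intro derivative_intros C1_grad_chain[OF a(1)] C1_grad_chain[OF a(2)] dq)
    show "(\<lambda>s. a2 (q1 z s) - a2 (q2 z s) - a1 (q3 z s) + a1 (q4 z s)) integrable_on cbox 0 1" for z
      unfolding q1_def q2_def q3_def q4_def
      by (intro integrable_continuous continuous_intros subset_UNIV)
    show "continuous_on (UNIV \<times> cbox 0 1) (\<lambda>(z, s). D z s)"
      unfolding D_def q1_def q2_def q3_def q4_def V_def case_prod_beta'
      by (intro continuous_intros subset_UNIV)
  qed auto
  then have der: "((\<lambda>z. circ a1 a2 (P z) h) has_real_derivative integral {0..1} (D z)) (at z)"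
    by (simp add: circ_def q1_def q2_def q3_def q4_def)
  define f0 g0 where "f0 = f (P z)" and "g0 = g (P z)"
  define m where "m q = f0 * a1 q + g0 * a2 q + a3 q" for q
  define m' where "m' q = f0 *\<^sub>R a1' q + g0 *\<^sub>R a2' q + a3' q" for q
  have m: "C1_grad m m'"
    using a unfolding C1_grad_def m_def m'_def
    by (auto intro!: continuous_intros derivative_eq_intros simp: inner_add_left)
  \<comment> \<open>Along the frozen velocity, the derivatives of the two horizontal coefficients are gradients of one function m, up to the terms containing w.\<close>
  have A2: "a2' q \<bullet> V z = m' q \<bullet> e2 - (f q - f0) * w q" for q
  proof -
    have x: "a2' q $ 1 = w q + a1' q $ 2" "a2' q $ 3 = a3' q $ 2 - f q * w q"
      using w[of q] k2[of q] by simp_all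
    show ?thesis unfolding inner_3[of "a2' q"] V_def m'_def f0_def[symmetric] g0_def[symmetric] pt_nth x
      by (simp add: algebra_simps)
  qed
  have A1: "a1' q \<bullet> V z = m' q \<bullet> e1 + (g q - g0) * w q" for q
  proof -
    have x: "a1' q $ 2 = a2' q $ 1 - w q" "a1' q $ 3 = a3' q $ 1 + g q * w q"
      using w[of q] k1[of q] by simp_all
    show ?thesis unfolding inner_3[of "a1' q"] V_def m'_def f0_def[symmetric] g0_def[symmetric] pt_nth x
      by (simp add: algebra_simps)
  qed
  define F where "F s = (f (q1 z s) - f0) * w (q1 z s) - (f (q2 z s) - f0) * w (q2 z s)
       + ((g (q3 z s) - g0) * w (q3 z s) - (g (q4 z s) - g0) * w (q4 z s))" for s
  define L where "L s = m' (q1 z s) \<bullet> e2 - m' (q2 z s) \<bullet> e2 - m' (q3 z s) \<bullet> e1 + m' (q4 z s) \<bullet> e1" for s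
  have Fc: "F integrable_on {0..1}" 
    unfolding F_def q1_def q2_def q3_def q4_def
    by (intro integrable_continuous_real continuous_intros subset_UNIV)
  \<comment> \<open>The gradient part integrates to differences of m at the corners, which cancel around the square.\<close>
  have L0: "(L has_integral 0) {0..1}"
  proof (cases "h = 0")
    case True then show ?thesis by (simp add: L_def[abs_def] q1_def q2_def q3_def q4_def)
  next
    case False
    have "((\<lambda>s. h * (m' (q1 z s) \<bullet> e2) - h * (m' (q2 z s) \<bullet> e2) - h * (m' (q3 z s) \<bullet> e1) + h * (m' (q4 z s) \<bullet> e1)) has_integral
       (m (P z + h *\<^sub>R e1 + h *\<^sub>R e2) - m (P z + h *\<^sub>R e1)) - (m (P z + h *\<^sub>R e2) - m (P z))
       - (m (P z + h *\<^sub>R e2 + h *\<^sub>R e1) - m (P z + h *\<^sub>R e2)) + (m (P z + h *\<^sub>R e1) - m (P z))) {0..1}"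
      unfolding q1_def q2_def q3_def q4_def
      by (intro has_integral_add has_integral_diff integral_line[OF m])
    then have "((\<lambda>s. h * L s) has_integral h * 0) {0..1}"
      by (simp add: L_def algebra_simps)
    from has_integral_mult_right[OF this, of "1 / h"] show ?thesis using False by simp
  qed
  have "D z = (\<lambda>s. L s - F s)"
    unfolding D_def L_def F_def A1 A2 by (simp add: algebra_simps)
  then have "integral {0..1} (D z) = - integral {0..1} F"
    using integral_diff[OF has_integral_integrable[OF L0] Fc] L0 by (simp add: integral_unique)
  with der show ?thesis
    unfolding F_def q1_def q2_def q3_def q4_def f0_def g0_def flux_increment_def by (simp add: add_ac)
qed

text \<open>The first-order expansion of the integrand in \<open>circ_deriv\<close>. It uses that u is C^1 and
  w only continuous: the factor u-u(p) is already of order h, so the continuity of w suffices.\<close>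

lemma increment_estimate:
  assumes u: "C1_grad u u'"
    and d: "\<And>q. dist q p < d \<Longrightarrow> dist (u' q) (u' p) < \<eta>" "\<And>q. dist q p < d \<Longrightarrow> dist (w q) (w p) < \<eta>"
    and M: "norm (u' p) \<le> M" "\<bar>w p\<bar> \<le> M" and \<eta>: "0 < \<eta>" "\<eta> \<le> 1"
    and h: "0 < h" "2 * h < d" and q: "norm (q - p) \<le> h" and v: "norm v = 1"
  shows "\<bar>flux_increment u w p (h *\<^sub>R v) q - h * ((u' p \<bullet> v) * w p)\<bar> \<le> h * (6 * (M + 1) * \<eta>)"
proof -
  define q' where "q' = q + h *\<^sub>R v"
  have nv: "norm (q' - q) = h" using v h by (simp add: q'_def)
  have dq: "dist q p < d" using q h by (simp add: dist_norm)
  have "norm (q' - p) \<le> norm (q' - q) + norm (q - p)" using norm_triangle_ineq[of "q' - q" "q - p"] by simp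
  then have dq': "dist q' p < d" using q h nv by (simp add: dist_norm)
  have dp: "dist p p < d" using h by simp
  have M0: "0 \<le> M" using M(2) by linarith
  have A: "\<bar>u q' - u q - h * (u' p \<bullet> v)\<bar> \<le> h * \<eta>"
    using C1_grad_lin_approx[OF u d(1) dq dq'] nv by (simp add: q'_def)
  have B: "\<bar>u q - u p - u' p \<bullet> (q - p)\<bar> \<le> norm (q - p) * \<eta>"
    by (rule C1_grad_lin_approx[OF u d(1) dp dq])
  have "\<bar>u' p \<bullet> (q - p)\<bar> \<le> norm (u' p) * norm (q - p)" by (rule Cauchy_Schwarz_ineq2)
  also have "\<dots> \<le> M * h" using M q by (intro mult_mono) auto
  moreover have "norm (q - p) * \<eta> \<le> h * 1" using q \<eta> h by (intro mult_mono) auto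
  ultimately have B': "\<bar>u q - u p\<bar> \<le> h * (M + 1)" using B by (simp add: algebra_simps)
  have Cq: "\<bar>w q' - w p\<bar> \<le> \<eta>" using d(2)[OF dq'] by (simp add: dist_real_def)
  have Cq2: "\<bar>w q' - w q\<bar> \<le> 2 * \<eta>" using d(2)[OF dq'] d(2)[OF dq] by (simp add: dist_real_def)
  have wq': "\<bar>w q'\<bar> \<le> M + 1" using Cq M(2) \<eta> by linarith
  have uv: "\<bar>u' p \<bullet> v\<bar> \<le> M" using Cauchy_Schwarz_ineq2[of "u' p" v] v M by simp
  have split: "((u q' - u p) * w q' - (u q - u p) * w q) - h * ((u' p \<bullet> v) * w p)
     = (u q' - u q - h * (u' p \<bullet> v)) * w q' + (u q - u p) * (w q' - w q) + h * ((u' p \<bullet> v) * (w q' - w p))"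
    by (simp add: algebra_simps)
  have "\<bar>(u q' - u q - h * (u' p \<bullet> v)) * w q'\<bar> \<le> (h * \<eta>) * (M + 1)"
    unfolding abs_mult using A wq' h \<eta> M0 by (intro mult_mono) auto
  moreover have "\<bar>(u q - u p) * (w q' - w q)\<bar> \<le> (h * (M + 1)) * (2 * \<eta>)"
    unfolding abs_mult using B' Cq2 h \<eta> M0 by (intro mult_mono) auto
  moreover have "\<bar>h * ((u' p \<bullet> v) * (w q' - w p))\<bar> \<le> h * ((M + 1) * \<eta>)"
    unfolding abs_mult using uv Cq h \<eta> M0 by (intro mult_mono) auto
  ultimately have "\<bar>((u q' - u p) * w q' - (u q - u p) * w q) - h * ((u' p \<bullet> v) * w p)\<bar>
     \<le> (h * \<eta>) * (M + 1) + (h * (M + 1)) * (2 * \<eta>) + h * ((M + 1) * \<eta>)"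
    unfolding split by linarith
  also have "\<dots> \<le> h * (6 * (M + 1) * \<eta>)"
  proof -
    have "0 \<le> h * ((M + 1) * \<eta>)" using h M0 \<eta> by simp
    then show ?thesis by (simp add: algebra_simps)
  qed
  finally show ?thesis unfolding q'_def flux_increment_def .
qed

lemma circ_estimate:
  assumes a: "C1_grad a1 a1'" "C1_grad a2 a2'" 
    and d: "\<And>q. dist q p < d \<Longrightarrow> dist (a1' q) (a1' p) < \<eta>" "\<And>q. dist q p < d \<Longrightarrow> dist (a2' q) (a2' p) < \<eta>"
    and h: "0 < h" "2 * h < d"
  shows "\<bar>circ a1 a2 p h - h * (a2' p $ 1 - a1' p $ 2)\<bar> \<le> h * (2 * \<eta>)"
proof -
  define J where "J s = a2 (p + h *\<^sub>R e1 + (s * h) *\<^sub>R e2) - a2 (p + (s * h) *\<^sub>R e2)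
     - a1 (p + h *\<^sub>R e2 + (s * h) *\<^sub>R e1) + a1 (p + (s * h) *\<^sub>R e1)" for s
  note [continuous_intros] = continuous_on_compose2[OF C1_grad_cont(1)[OF a(1)]] continuous_on_compose2[OF C1_grad_cont(1)[OF a(2)]]
  have Jc: "continuous_on {0..1} J" unfolding J_def by (intro continuous_intros subset_UNIV)
  have J: "\<bar>J s - h * (a2' p $ 1 - a1' p $ 2)\<bar> \<le> h * (2 * \<eta>)" if s: "s \<in> {0..1}" for s
  proof -
    have sh: "0 \<le> s * h" "s * h \<le> h" using s h by (simp_all add: mult_left_le_one_le)
    have n: "dist (p + (s * h) *\<^sub>R v) p < d" "dist (p + h *\<^sub>R u + (s * h) *\<^sub>R v) p < d" if "norm u = 1" "norm v = 1" for u v :: "real^3"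
    proof -
      have "norm ((s * h) *\<^sub>R v) = s * h" "norm (h *\<^sub>R u) = h" using that sh(1) h by auto
      moreover from this have "norm (h *\<^sub>R u + (s * h) *\<^sub>R v) \<le> h + s * h"
        using norm_triangle_ineq[of "h *\<^sub>R u" "(s * h) *\<^sub>R v"] by linarith
      ultimately show "dist (p + (s * h) *\<^sub>R v) p < d" "dist (p + h *\<^sub>R u + (s * h) *\<^sub>R v) p < d"
        using sh(2) h by (simp_all only: dist_norm add.assoc add_diff_cancel_left')
    qed
    have "\<bar>a2 (p + h *\<^sub>R e1 + (s * h) *\<^sub>R e2) - a2 (p + (s * h) *\<^sub>R e2) - h * a2' p $ 1\<bar> \<le> h * \<eta>"
      using C1_grad_lin_approx[OF a(2) d(2) n(1)[of e1 e2] n(2)[of e1 e2]] h by simp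
    moreover have "\<bar>a1 (p + h *\<^sub>R e2 + (s * h) *\<^sub>R e1) - a1 (p + (s * h) *\<^sub>R e1) - h * a1' p $ 2\<bar> \<le> h * \<eta>"
      using C1_grad_lin_approx[OF a(1) d(1) n(1)[of e2 e1] n(2)[of e2 e1]] h by simp
    ultimately show ?thesis unfolding J_def right_diff_distrib by linarith
  qed
  have "norm (integral {0..1} (\<lambda>s. J s - h * (a2' p $ 1 - a1' p $ 2))) \<le> h * (2 * \<eta>) * (1 - 0)"
    by (rule integral_bound) (use J in \<open>auto intro!: continuous_intros Jc\<close>)
  also have "integral {0..1} (\<lambda>s. J s - h * (a2' p $ 1 - a1' p $ 2)) = circ a1 a2 p h - h * (a2' p $ 1 - a1' p $ 2)"
    using integral_diff[OF integrable_continuous_real[OF Jc] integrable_continuous_real[OF continuous_on_const], of "h * (a2' p $ 1 - a1' p $ 2)"]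
    by (simp add: circ_def J_def[abs_def])
  finally show ?thesis by simp
qed

text \<open>The quotient of w by the density \<nu> is a first integral, although w need not be
  differentiable. The circulation around a square of side h, divided by h^2\<nu>, is differentiable
  along an orbit; for h \<rightarrow> 0 it tends to w/\<nu> and its derivative to zero, uniformly on compact
  pieces of the orbit, since the circulation and \<nu> change at the same relative
  rate, minus the horizontal divergence of the velocity.\<close>

lemma vorticity_transport:
  assumes a: "C1_grad a1 a1'" "C1_grad a2 a2'" "C1_grad a3 a3'"
    and w: "\<And>q. w q = a2' q $ 1 - a1' q $ 2"
    and k1: "\<And>q. a3' q $ 1 - a1' q $ 3 = - g q * w q" and k2: "\<And>q. a3' q $ 2 - a2' q $ 3 = f q * w q"
    and fg: "C1_grad f f'" "C1_grad g g'" and \<nu>: "C1_grad \<nu> \<nu>'" "\<And>q. \<nu> q > 0"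
    and cons: "\<And>q. \<nu>' q $ 3 + f q * \<nu>' q $ 1 + g q * \<nu>' q $ 2 + (f' q $ 1 + g' q $ 2) * \<nu> q = 0"
    and P: "\<And>z. (P has_vector_derivative pt (f (P z)) (g (P z)) 1) (at z)"
    and AB: "A \<le> B"
  shows "w (P A) / \<nu> (P A) = w (P B) / \<nu> (P B)"
proof -
  note c = C1_grad_cont(2)[OF a(1)] C1_grad_cont(2)[OF a(2)] C1_grad_cont(2)[OF fg(1)] C1_grad_cont(2)[OF fg(2)]
  have Pc: "continuous_on UNIV P"
    by (rule continuous_on_vector_derivative[OF has_vector_derivative_at_within[OF P]])
  have wc: "continuous_on UNIV w" unfolding w by (intro continuous_intros c)
  have bdd: "\<exists>M. \<forall>z\<in>{A..B}. u (P z) \<le> M" if "continuous_on UNIV u" for u :: "real^3 \<Rightarrow> real"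
  proof -
    have "compact ((\<lambda>z. u (P z)) ` {A..B})"
      by (intro compact_continuous_image continuous_on_compose2[OF that continuous_on_subset[OF Pc]]) auto
    then have "bdd_above ((\<lambda>z. u (P z)) ` {A..B})" by (intro bounded_imp_bdd_above compact_imp_bounded)
    then show ?thesis by (auto simp: bdd_above_def)
  qed
  have "continuous_on UNIV (\<lambda>q. norm (f' q))" by (intro continuous_intros c)
  from bdd[OF this] obtain M1 where M1: "\<And>z. z \<in> {A..B} \<Longrightarrow> norm (f' (P z)) \<le> M1" by blast
  have "continuous_on UNIV (\<lambda>q. norm (g' q))" by (intro continuous_intros c)
  from bdd[OF this] obtain M2 where M2: "\<And>z. z \<in> {A..B} \<Longrightarrow> norm (g' (P z)) \<le> M2" by blast
  have "continuous_on UNIV (\<lambda>q. \<bar>w q\<bar>)" by (intro continuous_intros wc)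
  from bdd[OF this] obtain M3 where M3: "\<And>z. z \<in> {A..B} \<Longrightarrow> \<bar>w (P z)\<bar> \<le> M3" by blast
  have "continuous_on UNIV (\<lambda>q. 1 / \<nu> q)"
    using \<nu>(2) by (intro continuous_intros C1_grad_cont(1)[OF \<nu>(1)]) (simp add: less_imp_neq[THEN not_sym])
  from bdd[OF this] obtain N where N: "\<And>z. z \<in> {A..B} \<Longrightarrow> 1 / \<nu> (P z) \<le> N" by blast
  define M where "M = max (max M1 M2) M3"
  have M: "norm (f' (P z)) \<le> M" "norm (g' (P z)) \<le> M" "\<bar>w (P z)\<bar> \<le> M" if "z \<in> {A..B}" for z
    using M1[OF that] M2[OF that] M3[OF that] unfolding M_def by linarith+
  have N0: "0 < N" using N[of A] AB \<nu>(2)[of "P A"] by (auto intro: less_le_trans[of 0 "1 / \<nu> (P A)"])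
  have M0: "0 \<le> M" using M(3)[of A] AB by auto
  define C where "C = 16 * (M + 1) * N * (B - A) + 4 * N"
  have est: "\<bar>w (P B) / \<nu> (P B) - w (P A) / \<nu> (P A)\<bar> \<le> C * \<eta>" if \<eta>: "0 < \<eta>" "\<eta> \<le> 1" for \<eta>
  proof -
    obtain d1 where d1: "d1 > 0" "\<And>z q. z \<in> {A..B} \<Longrightarrow> dist q (P z) < d1 \<Longrightarrow> dist (a1' q) (a1' (P z)) < \<eta>"
      using tube_continuity[OF c(1) Pc \<eta>(1)] by blast
    obtain d2 where d2: "d2 > 0" "\<And>z q. z \<in> {A..B} \<Longrightarrow> dist q (P z) < d2 \<Longrightarrow> dist (a2' q) (a2' (P z)) < \<eta>"
      using tube_continuity[OF c(2) Pc \<eta>(1)] by blast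
    obtain d3 where d3: "d3 > 0" "\<And>z q. z \<in> {A..B} \<Longrightarrow> dist q (P z) < d3 \<Longrightarrow> dist (f' q) (f' (P z)) < \<eta>"
      using tube_continuity[OF c(3) Pc \<eta>(1)] by blast
    obtain d4 where d4: "d4 > 0" "\<And>z q. z \<in> {A..B} \<Longrightarrow> dist q (P z) < d4 \<Longrightarrow> dist (g' q) (g' (P z)) < \<eta>"
      using tube_continuity[OF c(4) Pc \<eta>(1)] by blast
    obtain d5 where d5: "d5 > 0" "\<And>z q. z \<in> {A..B} \<Longrightarrow> dist q (P z) < d5 \<Longrightarrow> dist (w q) (w (P z)) < \<eta>"
      using tube_continuity[OF wc Pc \<eta>(1)] by blast
    define d where "d = min (min d1 d2) (min (min d3 d4) d5)"
    have d: "d > 0" "d \<le> d1" "d \<le> d2" "d \<le> d3" "d \<le> d4" "d \<le> d5" using d1 d2 d3 d4 d5 by (auto simp: d_def)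
    define h where "h = d / 4"
    have h: "0 < h" "2 * h < d" using d by (auto simp: h_def)
    define c where "c z = circ a1 a2 (P z) h" for z
    define D where "D z = f' (P z) $ 1 + g' (P z) $ 2" for z
    have c1: "\<bar>c z - h * w (P z)\<bar> \<le> h * (2 * \<eta>)" if z: "z \<in> {A..B}" for z
      unfolding c_def w using d by (intro circ_estimate[OF a(1,2) _ _ h] d1(2)[OF z] d2(2)[OF z]) auto
    define F where "F z s = flux_increment f w (P z) (h *\<^sub>R e1) (P z + (s * h) *\<^sub>R e2)" for z s
    define G where "G z s = flux_increment g w (P z) (h *\<^sub>R e2) (P z + (s * h) *\<^sub>R e1)" for z s
    have c': "(c has_real_derivative - integral {0..1} (\<lambda>s. F z s + G z s)) (at z)" for z
      unfolding c_def F_def G_def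
      by (rule circ_deriv[OF a w k1 k2 C1_grad_cont(1)[OF fg(1)] C1_grad_cont(1)[OF fg(2)] P])
    have c2: "\<bar>integral {0..1} (\<lambda>s. F z s + G z s) - h * (D z * w (P z))\<bar> \<le> h * (12 * (M + 1) * \<eta>)" if z: "z \<in> {A..B}" for z
    proof -
      note [continuous_intros] = continuous_on_compose2[OF C1_grad_cont(1)[OF fg(1)]]
        continuous_on_compose2[OF C1_grad_cont(1)[OF fg(2)]] continuous_on_compose2[OF wc]
      have FGc: "continuous_on {0..1} (\<lambda>s. F z s + G z s)"
        unfolding F_def G_def flux_increment_def by (intro continuous_intros subset_UNIV)
      have FG: "\<bar>F z s + G z s - h * (D z * w (P z))\<bar> \<le> h * (12 * (M + 1) * \<eta>)" if s: "s \<in> {0..1}" for s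
      proof -
        have sh: "norm (P z + (s * h) *\<^sub>R v - P z) \<le> h" if "norm v = 1" for v :: "real^3"
          using s h that by (simp add: mult_left_le_one_le)
        have "\<bar>F z s - h * ((f' (P z) \<bullet> e1) * w (P z))\<bar> \<le> h * (6 * (M + 1) * \<eta>)"
          unfolding F_def using d
          by (intro increment_estimate[where w = w and p = "P z" and M = M and \<eta> = \<eta>, OF fg(1) _ _ M(1)[OF z] M(3)[OF z] \<eta> h] sh d3(2)[OF z] d5(2)[OF z]) auto
        moreover have "\<bar>G z s - h * ((g' (P z) \<bullet> e2) * w (P z))\<bar> \<le> h * (6 * (M + 1) * \<eta>)"
          unfolding G_def using d
          by (intro increment_estimate[where w = w and p = "P z" and M = M and \<eta> = \<eta>, OF fg(2) _ _ M(2)[OF z] M(3)[OF z] \<eta> h] sh d4(2)[OF z] d5(2)[OF z]) auto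
        moreover have "h * (D z * w (P z)) = h * ((f' (P z) \<bullet> e1) * w (P z)) + h * ((g' (P z) \<bullet> e2) * w (P z))"
          by (simp add: D_def algebra_simps)
        moreover have "h * (12 * (M + 1) * \<eta>) = h * (6 * (M + 1) * \<eta>) + h * (6 * (M + 1) * \<eta>)" by simp
        ultimately show ?thesis by linarith
      qed
      have "norm (integral {0..1} (\<lambda>s. F z s + G z s - h * (D z * w (P z)))) \<le> h * (12 * (M + 1) * \<eta>) * (1 - 0)"
        by (rule integral_bound) (use FG FGc in \<open>auto intro!: continuous_intros\<close>)
      also have "integral {0..1} (\<lambda>s. F z s + G z s - h * (D z * w (P z))) = integral {0..1} (\<lambda>s. F z s + G z s) - h * (D z * w (P z))"
        using integral_diff[OF integrable_continuous_real[OF FGc] integrable_continuous_real[OF continuous_on_const], of "h * (D z * w (P z))"] by simp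
      finally show ?thesis by simp
    qed
    have \<nu>': "((\<lambda>z. \<nu> (P z)) has_real_derivative - D z * \<nu> (P z)) (at z)" for z
    proof -
      have "\<nu>' (P z) \<bullet> pt (f (P z)) (g (P z)) 1 = - D z * \<nu> (P z)"
        using cons[of "P z"] by (simp add: inner_3 D_def algebra_simps)
      then show ?thesis using C1_grad_chain[OF \<nu>(1) P] by metis
    qed
    define r where "r z = c z / (h * \<nu> (P z))" for z
    define r' where "r' z = (- integral {0..1} (\<lambda>s. F z s + G z s) + c z * D z) / (h * \<nu> (P z))" for z
    have r': "(r has_real_derivative r' z) (at z)" for z
      unfolding r_def[abs_def]
      by (rule derivative_eq_intros c' \<nu>' refl)+
        (use \<nu>(2)[of "P z"] h in \<open>auto simp: r'_def field_simps\<close>)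
    have r'_bound: "\<bar>r' z\<bar> \<le> 16 * (M + 1) * N * \<eta>" if z: "z \<in> {A..B}" for z
    proof -
      have "\<bar>D z\<bar> \<le> 2 * M"
        using component_le_norm_cart[of "f' (P z)" 1] component_le_norm_cart[of "g' (P z)" 2] M(1,2)[OF z]
        by (simp add: D_def)
      then have "\<bar>(c z - h * w (P z)) * D z\<bar> \<le> (h * (2 * \<eta>)) * (2 * M)"
        unfolding abs_mult using c1[OF z] \<eta> h by (intro mult_mono) auto
      moreover have "- integral {0..1} (\<lambda>s. F z s + G z s) + c z * D z =
         - (integral {0..1} (\<lambda>s. F z s + G z s) - h * (D z * w (P z))) + (c z - h * w (P z)) * D z"
        by (simp add: algebra_simps)
      ultimately have "\<bar>- integral {0..1} (\<lambda>s. F z s + G z s) + c z * D z\<bar> \<le> h * (12 * (M + 1) * \<eta>) + (h * (2 * \<eta>)) * (2 * M)"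
        using c2[OF z] by linarith
      also have "\<dots> \<le> h * (16 * (M + 1) * \<eta>)"
        using h \<eta> by (simp add: algebra_simps)
      finally have *: "\<bar>- integral {0..1} (\<lambda>s. F z s + G z s) + c z * D z\<bar> \<le> h * (16 * (M + 1) * \<eta>)" .
      have "\<bar>r' z\<bar> = \<bar>- integral {0..1} (\<lambda>s. F z s + G z s) + c z * D z\<bar> / h * (1 / \<nu> (P z))"
        using h \<nu>(2)[of "P z"] by (simp add: r'_def abs_mult)
      also have "\<dots> \<le> (16 * (M + 1) * \<eta>) * N"
        using N[OF z] * h \<nu>(2)[of "P z"] M0 \<eta> by (intro mult_mono) (auto simp: field_simps)
      finally show ?thesis by (simp add: mult_ac)
    qed
    have r_near: "\<bar>r z - w (P z) / \<nu> (P z)\<bar> \<le> 2 * N * \<eta>" if z: "z \<in> {A..B}" for z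
    proof -
      have "\<bar>r z - w (P z) / \<nu> (P z)\<bar> = \<bar>c z - h * w (P z)\<bar> / h * (1 / \<nu> (P z))"
      proof -
        have "r z - w (P z) / \<nu> (P z) = (c z - h * w (P z)) / h * (1 / \<nu> (P z))"
          using h \<nu>(2)[of "P z"] by (simp add: r_def field_simps)
        then show ?thesis using h \<nu>(2)[of "P z"] by (simp add: abs_mult)
      qed
      also have "\<dots> \<le> (2 * \<eta>) * N"
        using N[OF z] c1[OF z] h \<nu>(2)[of "P z"] \<eta> by (intro mult_mono) (auto simp: field_simps)
      finally show ?thesis by (simp add: mult_ac)
    qed
    have "norm (r B - r A) \<le> 16 * (M + 1) * N * \<eta> * norm (B - A)"
      by (rule field_differentiable_bound[where S = "{A..B}" and f' = r'])
        (use r'_bound r' AB in \<open>auto intro: has_field_derivative_at_within\<close>)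
    then show ?thesis
      using r_near[of A] r_near[of B] AB by (simp add: C_def algebra_simps)
  qed
  have C0: "0 \<le> C" using M0 N0 AB by (simp add: C_def)
  have "\<bar>w (P B) / \<nu> (P B) - w (P A) / \<nu> (P A)\<bar> \<le> 0"
  proof (rule field_le_epsilon)
    fix e :: real assume e: "e > 0"
    define \<eta> where "\<eta> = min 1 (e / (C + 1))"
    have "C * \<eta> \<le> (C + 1) * (e / (C + 1))" unfolding \<eta>_def using C0 e by (intro mult_mono) auto
    then show "\<bar>w (P B) / \<nu> (P B) - w (P A) / \<nu> (P A)\<bar> \<le> 0 + e"
      using est[of \<eta>] C0 e by (simp add: \<eta>_def)
  qed
  then show ?thesis by simp
qed

section \<open>Harmonic fields\<close>

lemma axis3_nth [simp]:
  "e1 $ 1 = 1" "e1 $ 2 = 0" "e1 $ 3 = 0" "e2 $ 1 = 0" "e2 $ 2 = 1" "e2 $ 3 = 0" "e3 $ 1 = 0" "e3 $ 2 = 0" "e3 $ 3 = 1"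
  by (simp_all add: axis_def)

lemma has_vector_derivative_pt:
  assumes "(f has_real_derivative f') (at t within S)" "(g has_real_derivative g') (at t within S)"
    "(h has_real_derivative h') (at t within S)"
  shows "((\<lambda>t. pt (f t) (g t) (h t)) has_vector_derivative pt f' g' h') (at t within S)"
proof -
  note sc = has_vector_derivative_scaleR[OF _ has_vector_derivative_const, simplified]
  show ?thesis unfolding pt_def
    by (intro has_vector_derivative_add sc assms)
qed

lemma second_derivative_at_max:
  fixes \<phi> \<phi>' :: "real \<Rightarrow> real"
  assumes 1: "\<And>t. (\<phi> has_real_derivative \<phi>' t) (at t)" and 2: "(\<phi>' has_real_derivative D) (at 0)"
    and d: "d > 0" and max: "\<And>t. \<bar>t\<bar> < d \<Longrightarrow> \<phi> t \<le> \<phi> 0"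
  shows "D \<le> 0"
proof (rule ccontr)
  assume "\<not> D \<le> 0"
  then obtain e where e: "e > 0" "\<And>h. 0 < h \<Longrightarrow> h < e \<Longrightarrow> \<phi>' 0 < \<phi>' (0 + h)"
    using DERIV_pos_inc_right[OF 2] by auto
  have z: "\<phi>' 0 = 0"
    by (rule DERIV_local_max[OF 1[of 0] d]) (use max in auto)
  define t where "t = min d e / 2"
  have t: "0 < t" "t < d" "t < e" using d e by (auto simp: t_def)
  obtain s where s: "0 < s" "s < t" "\<phi> t - \<phi> 0 = (t - 0) * \<phi>' s"
    using MVT2[OF t(1) 1] by blast
  have "0 < (t - 0) * \<phi>' s" using e(2)[of s] s t z by simp
  then show False using max[of t] s t by simp
qed

text \<open>Affine functions of z are solutions, so they serve as barriers. Periodicity in the horizontal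
  directions replaces the missing compactness of the strip.\<close>

lemma strip_maximum_principle:
  fixes u :: "real^3 \<Rightarrow> real"
  assumes per: "\<And>a b q. (a, b) \<in> Lat \<Longrightarrow> u (deck 0 a b q) = u q"
    and d: "C1_grad u (\<lambda>q. pt (ux q) (uy q) (uz q))" "C1_grad ux ux'" "C1_grad uy uy'" "C1_grad uz uz'"
    and eq: "\<And>q. \<alpha> q * ux' q $ 1 + \<beta> q * uy' q $ 2 + uz' q $ 3 = 0" and pos: "\<And>q. \<alpha> q \<ge> 0" "\<And>q. \<beta> q \<ge> 0"
    and z: "z1 < z2" and bd: "\<And>q. q $ 3 = z1 \<Longrightarrow> u q \<le> m1" "\<And>q. q $ 3 = z2 \<Longrightarrow> u q \<le> m2"
    and q0: "z1 \<le> q0 $ 3" "q0 $ 3 \<le> z2"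
  shows "u q0 \<le> m1 + (m2 - m1) * (q0 $ 3 - z1) / (z2 - z1)"
proof (rule ccontr)
  define k where "k = (m2 - m1) / (z2 - z1)"
  define \<delta> where "\<delta> = u q0 - (m1 + k * (q0 $ 3 - z1))"
  assume "\<not> u q0 \<le> m1 + (m2 - m1) * (q0 $ 3 - z1) / (z2 - z1)"
  then have \<delta>: "\<delta> > 0" by (simp add: \<delta>_def k_def)
  \<comment> \<open>A quadratic term makes the comparison function strictly subharmonic without moving its maximum to the boundary.\<close>
  define \<epsilon> where "\<epsilon> = \<delta> / (2 * (z2 - z1)\<^sup>2)"
  have \<epsilon>: "\<epsilon> > 0" "\<epsilon> * (z2 - z1)\<^sup>2 < \<delta>" using \<delta> z by (auto simp: \<epsilon>_def)
  define r where "r t = - (m1 + k * (t - z1)) + \<epsilon> * (t - z1)\<^sup>2" for t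
  define v where "v q = u q + r (q $ 3)" for q
  have v: "continuous_on S v" for S unfolding v_def r_def by (intro continuous_intros continuous_on_subset[OF C1_grad_cont(1)[OF d(1)]]) auto
  define Q where "Q = {q :: real^3. \<bar>q $ 1\<bar> \<le> 3 \<and> \<bar>q $ 2\<bar> \<le> 3 \<and> z1 \<le> q $ 3 \<and> q $ 3 \<le> z2}"
  have "Q = cbox (pt (-3) (-3) z1) (pt 3 3 z2)"
    by (auto simp: Q_def mem_box_cart forall_3 abs_le_iff)
  then have cQ: "compact Q" by (metis compact_cbox)
  have into_Q: "\<exists>p\<in>Q. v p = v q" if q: "z1 \<le> q $ 3" "q $ 3 \<le> z2" for q
  proof -
    obtain a b where ab: "(a, b) \<in> Lat" "\<bar>q $ 1 + a\<bar> \<le> 3" "\<bar>q $ 2 + b\<bar> \<le> 3" using Lat_reduce by blast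
    then have "deck 0 a b q \<in> Q" using q by (simp add: Q_def deck_def)
    moreover have "v (deck 0 a b q) = v q" using per[OF ab(1)] by (simp add: v_def deck_def)
    ultimately show ?thesis by blast
  qed
  have "Q \<noteq> {}" using into_Q[OF q0] by blast
  then obtain p where p: "p \<in> Q" "\<And>q. q \<in> Q \<Longrightarrow> v q \<le> v p"
    using continuous_attains_sup[OF cQ _ v] by blast
  have max: "v q \<le> v p" if "z1 \<le> q $ 3" "q $ 3 \<le> z2" for q
    using into_Q[OF that] p(2) by metis
  have "\<delta> \<le> v q0" using \<epsilon>(1) by (simp add: v_def r_def \<delta>_def)
  then have vp: "\<delta> \<le> v p" using max[OF q0] by linarith
  have "p $ 3 \<noteq> z1" using vp \<delta> bd(1)[of p] by (auto simp: v_def r_def)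
  moreover have "p $ 3 \<noteq> z2"
  proof
    assume "p $ 3 = z2"
    moreover have "k * (z2 - z1) = m2 - m1" using z by (simp add: k_def)
    ultimately show False using vp \<epsilon>(2) bd(2)[of p] by (simp add: v_def r_def)
  qed
  ultimately have p3: "z1 < p $ 3" "p $ 3 < z2" using p(1) by (auto simp: Q_def)
  have line: "((\<lambda>t. u (p + t *\<^sub>R e1)) has_real_derivative ux (p + t *\<^sub>R e1)) (at t)"
    "((\<lambda>t. u (p + t *\<^sub>R e2)) has_real_derivative uy (p + t *\<^sub>R e2)) (at t)"
    "((\<lambda>t. u (p + t *\<^sub>R e3)) has_real_derivative uz (p + t *\<^sub>R e3)) (at t)" for t
    using C1_grad_line[OF d(1), of p e1 t UNIV] C1_grad_line[OF d(1), of p e2 t UNIV] C1_grad_line[OF d(1), of p e3 t UNIV]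
    by simp_all
  have line2: "((\<lambda>t. ux (p + t *\<^sub>R e1)) has_real_derivative ux' p $ 1) (at 0)"
    "((\<lambda>t. uy (p + t *\<^sub>R e2)) has_real_derivative uy' p $ 2) (at 0)"
    "((\<lambda>t. uz (p + t *\<^sub>R e3)) has_real_derivative uz' p $ 3) (at 0)"
    using C1_grad_line[OF d(2), of p e1 0 UNIV] C1_grad_line[OF d(3), of p e2 0 UNIV] C1_grad_line[OF d(4), of p e3 0 UNIV]
    by simp_all
  have "ux' p $ 1 \<le> 0"
    by (rule second_derivative_at_max[OF line(1) line2(1), of 1])
      (use max[of "p + t *\<^sub>R e1" for t] p3 in \<open>auto simp: v_def\<close>)
  moreover have "uy' p $ 2 \<le> 0"
    by (rule second_derivative_at_max[OF line(2) line2(2), of 1])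
      (use max[of "p + t *\<^sub>R e2" for t] p3 in \<open>auto simp: v_def\<close>)
  moreover have "uz' p $ 3 + 2 * \<epsilon> \<le> 0"
  proof (rule second_derivative_at_max[of "\<lambda>t. u (p + t *\<^sub>R e3) + r (p $ 3 + t)" "\<lambda>t. uz (p + t *\<^sub>R e3) + (- k + 2 * \<epsilon> * (p $ 3 + t - z1))" _ "min (p $ 3 - z1) (z2 - p $ 3)"])
    show "((\<lambda>t. u (p + t *\<^sub>R e3) + r (p $ 3 + t)) has_real_derivative uz (p + t *\<^sub>R e3) + (- k + 2 * \<epsilon> * (p $ 3 + t - z1))) (at t)" for t
      unfolding r_def by (rule derivative_eq_intros line(3) refl | simp)+
    show "((\<lambda>t. uz (p + t *\<^sub>R e3) + (- k + 2 * \<epsilon> * (p $ 3 + t - z1))) has_real_derivative uz' p $ 3 + 2 * \<epsilon>) (at 0)"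
      by (rule derivative_eq_intros line2(3) refl | simp)+
    show "u (p + t *\<^sub>R e3) + r (p $ 3 + t) \<le> u (p + 0 *\<^sub>R e3) + r (p $ 3 + 0)" if "\<bar>t\<bar> < min (p $ 3 - z1) (z2 - p $ 3)" for t
    proof -
      have "z1 \<le> p $ 3 + t" "p $ 3 + t \<le> z2" using that by linarith+
      then show ?thesis using max[of "p + t *\<^sub>R e3"] by (simp add: v_def)
    qed
  qed (use p3 in auto)
  ultimately show False
    using eq[of p] pos[of p] \<epsilon>(1) mult_nonneg_nonpos[of "\<alpha> p" "ux' p $ 1"] mult_nonneg_nonpos[of "\<beta> p" "uy' p $ 2"] by linarith
qed

definition fades_at_one_end :: "(real^3 \<Rightarrow> real) \<Rightarrow> bool" where
  "fades_at_one_end u \<longleftrightarrow> (\<forall>\<eta>>0. \<exists>z0. \<forall>q. q $ 3 \<ge> z0 \<longrightarrow> u q \<le> \<eta>) \<or>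
     (\<forall>\<eta>>0. \<exists>z0. \<forall>q. q $ 3 \<le> z0 \<longrightarrow> u q \<le> \<eta>)"

lemma fades_mono: "fades_at_one_end u \<Longrightarrow> (\<And>q. v q \<le> u q) \<Longrightarrow> fades_at_one_end v"
  unfolding fades_at_one_end_def by (meson order_trans)

text \<open>Apply the maximum principle on the strip between a level near the end where u fades and a level
  moving to the other end, where only boundedness is known; the affine barrier tends to a constant.\<close>

lemma strip_liouville:
  fixes u :: "real^3 \<Rightarrow> real"
  assumes per: "\<And>a b q. (a, b) \<in> Lat \<Longrightarrow> u (deck 0 a b q) = u q"
    and d: "C1_grad u (\<lambda>q. pt (ux q) (uy q) (uz q))" "C1_grad ux ux'" "C1_grad uy uy'" "C1_grad uz uz'"
    and eq: "\<And>q. \<alpha> q * ux' q $ 1 + \<beta> q * uy' q $ 2 + uz' q $ 3 = 0" and pos: "\<And>q. \<alpha> q \<ge> 0" "\<And>q. \<beta> q \<ge> 0"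
    and bd: "\<And>q. u q \<le> M"
    and decay: "fades_at_one_end u"
  shows "u p \<le> 0"
proof (rule ccontr)
  assume "\<not> u p \<le> 0"
  then have p: "u p > 0" by simp
  define \<eta> where "\<eta> = u p / 2"
  have \<eta>: "\<eta> > 0" "u p = 2 * \<eta>" using p by (simp_all add: \<eta>_def)
  note mp = strip_maximum_principle[OF per d eq pos]
  have M: "M > 0" using bd[of p] p by linarith
  have est: False if L: "L > 0" and le: "\<And>T. T > 0 \<Longrightarrow> u p \<le> \<eta> + M * (L / (L + T))" for L
  proof -
    \<comment> \<open>At this distance of the far level the boundedness contributes at most half of eta.\<close>
    define T where "T = 2 * M * L / \<eta>"
    have T: "T > 0" using L M \<eta> by (simp add: T_def)
    have "M * (L / (L + T)) \<le> M * (L / T)" using L M T by (intro mult_left_mono divide_left_mono) auto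
    also have "\<dots> = \<eta> / 2" using L M \<eta> by (simp add: T_def)
    finally show False using le[OF T] \<eta> by linarith
  qed
  from decay[unfolded fades_at_one_end_def] show False
  proof
    assume "\<forall>\<eta>>0. \<exists>z0. \<forall>q. q $ 3 \<ge> z0 \<longrightarrow> u q \<le> \<eta>"
    then obtain z0 where z0: "\<And>q. q $ 3 \<ge> z0 \<Longrightarrow> u q \<le> \<eta>" using \<eta>(1) by blast
    define L where "L = max z0 (p $ 3) + 1 - p $ 3"
    have L: "L > 0" "p $ 3 + L \<ge> z0" by (auto simp: L_def)
    show False
    proof (rule est[OF L(1)])
      fix T :: real assume T: "T > 0"
      have "u p \<le> M + (\<eta> - M) * (p $ 3 - (p $ 3 - T)) / ((p $ 3 + L) - (p $ 3 - T))"
        by (rule mp) (use L T bd z0 in auto)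
      also have "\<dots> = \<eta> * (T / (L + T)) + M * (L / (L + T))"
      proof -
        have LT: "L + T \<noteq> 0" using L T by linarith
        have "(p $ 3 + L) - (p $ 3 - T) = L + T" "(p $ 3 + T) - (p $ 3 - L) = L + T" by simp_all
        then show ?thesis using LT by (simp add: divide_simps) (simp add: algebra_simps)
      qed
      also have "\<dots> \<le> \<eta> * 1 + M * (L / (L + T))"
        using L T \<eta> by (intro add_right_mono mult_left_mono) auto
      finally show "u p \<le> \<eta> + M * (L / (L + T))" by simp
    qed
  next
    assume "\<forall>\<eta>>0. \<exists>z0. \<forall>q. q $ 3 \<le> z0 \<longrightarrow> u q \<le> \<eta>"
    then obtain z0 where z0: "\<And>q. q $ 3 \<le> z0 \<Longrightarrow> u q \<le> \<eta>" using \<eta>(1) by blast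
    define L where "L = p $ 3 - (min z0 (p $ 3) - 1)"
    have L: "L > 0" "p $ 3 - L \<le> z0" by (auto simp: L_def)
    show False
    proof (rule est[OF L(1)])
      fix T :: real assume T: "T > 0"
      have "u p \<le> \<eta> + (M - \<eta>) * (p $ 3 - (p $ 3 - L)) / ((p $ 3 + T) - (p $ 3 - L))"
        by (rule mp) (use L T bd z0 in auto)
      also have "\<dots> = \<eta> * (T / (L + T)) + M * (L / (L + T))"
      proof -
        have LT: "L + T \<noteq> 0" using L T by linarith
        have "(p $ 3 + L) - (p $ 3 - T) = L + T" "(p $ 3 + T) - (p $ 3 - L) = L + T" by simp_all
        then show ?thesis using LT by (simp add: divide_simps) (simp add: algebra_simps)
      qed
      also have "\<dots> \<le> \<eta> * 1 + M * (L / (L + T))"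
        using L T \<eta> by (intro add_right_mono mult_left_mono) auto
      finally show "u p \<le> \<eta> + M * (L / (L + T))" by simp
    qed
  qed
qed

text \<open>The primitive is the radial one, the integral of a(tq) \<bullet> q over 0 \<le> t \<le> 1. Because of the symmetry of the
  derivatives, the derivative of the integrand in q is d/dt (t a(tq)).\<close>

lemma poincare_lemma:
  assumes a: "C1_grad a1 a1'" "C1_grad a2 a2'" "C1_grad a3 a3'"
    and sym: "\<And>q. a2' q $ 1 = a1' q $ 2" "\<And>q. a3' q $ 1 = a1' q $ 3" "\<And>q. a3' q $ 2 = a2' q $ 3"
  shows "\<exists>F. C1_grad F (\<lambda>q. pt (a1 q) (a2 q) (a3 q))"
proof -
  note [continuous_intros] = C1_grad_cont[OF a(1), THEN continuous_on_compose2]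
    C1_grad_cont[OF a(2), THEN continuous_on_compose2] C1_grad_cont[OF a(3), THEN continuous_on_compose2]
  define A where "A q = pt (a1 q) (a2 q) (a3 q)" for q
  define Y where "Y q t = t *\<^sub>R (q $ 1 *\<^sub>R a1' (t *\<^sub>R q) + q $ 2 *\<^sub>R a2' (t *\<^sub>R q) + q $ 3 *\<^sub>R a3' (t *\<^sub>R q)) + A (t *\<^sub>R q)" for q t
  define f where "f q t = a1 (t *\<^sub>R q) * q $ 1 + a2 (t *\<^sub>R q) * q $ 2 + a3 (t *\<^sub>R q) * q $ 3" for q :: "real^3" and t
  define F where "F q = integral (cbox 0 1) (f q)" for q
  have comp: "((\<lambda>q. u (t *\<^sub>R q)) has_derivative (\<lambda>h. u' (t *\<^sub>R q) \<bullet> (t *\<^sub>R h))) (at q)"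
    if "C1_grad u u'" for u u' t q
  proof -
    have "((\<lambda>q. t *\<^sub>R q) has_derivative (\<lambda>h. t *\<^sub>R h)) (at q)" by (auto intro!: derivative_eq_intros)
    from has_derivative_compose[OF this] that show ?thesis unfolding C1_grad_def by blast
  qed
  have nth: "((\<lambda>q::real^3. q $ i) has_derivative (\<lambda>h. h $ i)) (at q)" for i q
    by (intro bounded_linear_imp_has_derivative bounded_linear_vec_nth)
  have df: "((\<lambda>q. f q t) has_derivative blinfun_apply (blinfun_inner_left (Y q t))) (at q)" for q t
    unfolding f_def
    by (rule derivative_eq_intros comp[OF a(1)] comp[OF a(2)] comp[OF a(3)] nth refl)+
      (auto simp: fun_eq_iff Y_def A_def inner_add_left inner_3 algebra_simps)
  have Yc: "continuous_on S (\<lambda>x. Y (fst x) (snd x))" for S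
    unfolding Y_def A_def by (intro continuous_intros subset_UNIV)
  have Yint: "(Y q has_integral A q) {0..1}" for q
  proof -
    have "((\<lambda>t. t *\<^sub>R A (t *\<^sub>R q)) has_vector_derivative Y q t) (at t within {0..1})" for t
    proof -
      have ray: "((\<lambda>t. t *\<^sub>R q) has_vector_derivative q) (at t within {0..1})"
        by (auto intro!: derivative_eq_intros)
      have comp: "u' (t *\<^sub>R q) \<bullet> q = q $ 1 * u' (t *\<^sub>R q) $ 1 + q $ 2 * u' (t *\<^sub>R q) $ 2 + q $ 3 * u' (t *\<^sub>R q) $ 3" for u'
        unfolding inner_3 by (simp add: algebra_simps)
      have "((\<lambda>t. A (t *\<^sub>R q)) has_vector_derivative pt (a1' (t *\<^sub>R q) \<bullet> q) (a2' (t *\<^sub>R q) \<bullet> q) (a3' (t *\<^sub>R q) \<bullet> q)) (at t within {0..1})"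
        unfolding A_def by (intro has_vector_derivative_pt C1_grad_chain[OF _ ray] a)
      moreover have "Y q t = t *\<^sub>R pt (a1' (t *\<^sub>R q) \<bullet> q) (a2' (t *\<^sub>R q) \<bullet> q) (a3' (t *\<^sub>R q) \<bullet> q) + A (t *\<^sub>R q)"
        unfolding comp vec3_eq_iff Y_def using sym[of "t *\<^sub>R q"] by simp
      ultimately show ?thesis
        by (auto intro!: derivative_eq_intros simp: has_vector_derivative_def algebra_simps)
    qed
    from fundamental_theorem_of_calculus[OF _ this] show ?thesis by simp
  qed
  have "(F has_derivative integral (cbox 0 1) (\<lambda>t. blinfun_inner_left (Y q t))) (at q within UNIV)" for q
    unfolding F_def
  proof (rule leibniz_rule)
    show "((\<lambda>q. f q t) has_derivative blinfun_apply (blinfun_inner_left (Y q t))) (at q within UNIV)" for q t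
      using df by simp
    show "f q integrable_on cbox 0 1" for q
      unfolding f_def by (intro integrable_continuous continuous_intros subset_UNIV)
    show "continuous_on (UNIV \<times> cbox 0 1) (\<lambda>(x, t). blinfun_inner_left (Y x t))"
      unfolding case_prod_beta' by (intro bounded_linear.continuous_on[OF bounded_linear_blinfun_inner_left] Yc)
  qed auto
  moreover have "integral (cbox 0 1) (\<lambda>t. blinfun_inner_left (Y q t)) = blinfun_inner_left (A q)" for q
    using has_integral_linear[OF Yint bounded_linear_blinfun_inner_left] by (simp add: integral_unique o_def)
  ultimately have "(F has_derivative blinfun_apply (blinfun_inner_left (A q))) (at q)" for q by simp
  moreover have "blinfun_apply (blinfun_inner_left (A q)) = (\<lambda>h. A q \<bullet> h)" for q
    by (simp add: fun_eq_iff inner_commute)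
  moreover have "continuous_on UNIV A" unfolding A_def by (intro continuous_intros subset_UNIV)
  ultimately have "C1_grad F A" by (simp add: C1_grad_def)
  then show ?thesis unfolding A_def by blast
qed

lemma deck_compose0: "deck 0 a b (deck n a' b' q) = deck n (a' + a) (b' + b) q"
  by (simp add: deck_def vec3_eq_iff)

lemma C1_grad_eqI:
  assumes "C1_grad F A" "C1_grad G A"
  shows "F q - G q = F 0 - G 0"
proof -
  have "((\<lambda>q. F q - G q) has_derivative (\<lambda>h. 0)) (at q within UNIV)" for q
    using assms unfolding C1_grad_def by (auto intro!: derivative_eq_intros)
  then obtain c where "\<forall>q\<in>UNIV. F q - G q = c"
    using has_derivative_zero_constant[OF convex_UNIV] by blast
  then show ?thesis by simp
qed

text \<open>The increments of a primitive under deck transformations are a homomorphism from the deck group to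
  the reals. It vanishes on the lattice of translations, because it is invariant under the
  hyperbolic automorphism, which does not have the eigenvalue 1. Subtracting a multiple of z
  removes the increment under the remaining generator. This is the statement that the first Betti
  number is one.\<close>

lemma invariant_closed_form_potential:
  assumes A: "C1_grad F A"
    and cov: "\<And>n a b q. (a, b) \<in> Lat \<Longrightarrow> A (deck n a b q) =
       pt (exp (- (of_int n * ell)) * A q $ 1) (exp (of_int n * ell) * A q $ 2) (A q $ 3)"
  shows "\<exists>c. invariant (\<lambda>q. F q - c * q $ 3)"
proof -
  have nth: "((\<lambda>q::real^3. q $ i) has_derivative (\<lambda>h. h $ i)) (at q)" for i q
    by (intro bounded_linear_imp_has_derivative bounded_linear_vec_nth)
  have "C1_grad (\<lambda>q. F (deck n a b q)) A" if ab: "(a, b) \<in> Lat" for n a b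
  proof -
    have "((\<lambda>q. F (deck n a b q)) has_derivative (\<lambda>h. A q \<bullet> h)) (at q)" for q
    proof -
      have "(deck n a b has_derivative (\<lambda>h. pt (exp (of_int n * ell) * h $ 1) (exp (- (of_int n * ell)) * h $ 2) (h $ 3))) (at q)"
        unfolding deck_def[abs_def] pt_def by (rule derivative_eq_intros nth refl | simp)+
      moreover have "(F has_derivative (\<lambda>h. A (deck n a b q) \<bullet> h)) (at (deck n a b q))"
        using A by (simp add: C1_grad_def)
      ultimately have "((\<lambda>q. F (deck n a b q)) has_derivative (\<lambda>h. A (deck n a b q) \<bullet> pt (exp (of_int n * ell) * h $ 1) (exp (- (of_int n * ell)) * h $ 2) (h $ 3))) (at q)"
        by (rule has_derivative_compose)
      moreover have "A (deck n a b q) \<bullet> pt (exp (of_int n * ell) * h $ 1) (exp (- (of_int n * ell)) * h $ 2) (h $ 3) = A q \<bullet> h" for h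
        unfolding cov[OF ab] inner_3 by (simp add: exp_minus field_simps)
      ultimately show ?thesis by simp
    qed
    then show ?thesis using A by (simp add: C1_grad_def)
  qed
  from C1_grad_eqI[OF this A] have diff: "F (deck n a b q) - F q = F (deck n a b 0) - F 0" if "(a, b) \<in> Lat" for n a b q
    using that by blast
  define per where "per a b = F (deck 0 a b 0) - F 0" for a b
  define s where "s = F (deck 1 0 0 0) - F 0"
  have T: "F (deck 0 a b q) = F q + per a b" if "(a, b) \<in> Lat" for a b q
    using diff[OF that, of 0 q] by (simp add: per_def)
  have S: "F (deck 1 0 0 q) = F q + s" for q
    using diff[OF Lat_zero, of 1 q] by (simp add: s_def)
  have add: "per (a + a') (b + b') = per a b + per a' b'" if "(a, b) \<in> Lat" "(a', b') \<in> Lat" for a b a' b'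
    using T[OF that(2), of "deck 0 a b 0"] T[OF that(1), of 0] T[OF Lat_add[OF that], of 0]
    unfolding deck_compose0 by simp
  have scale: "per (exp ell * a) (exp (- ell) * b) = per a b" if ab: "(a, b) \<in> Lat" for a b
  proof -
    have "deck 0 (exp ell * a) (exp (- ell) * b) (deck 1 0 0 0) = deck 1 0 0 (deck 0 a b 0)"
      by (simp add: deck_def vec3_eq_iff)
    then show ?thesis
      using T[OF Lat_scale1(1)[OF ab], of "deck 1 0 0 0"] S[of 0] S[of "deck 0 a b 0"] T[OF ab, of 0] by simp
  qed
  have per0: "per a b = 0" if ab: "(a, b) \<in> Lat" for a b
  proof -
    define a1 b1 a2 b2 where "a1 = exp ell * a" and "b1 = exp (- ell) * b" and "a2 = exp ell * a1" and "b2 = exp (- ell) * b1"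
    have L1: "(a1, b1) \<in> Lat" and L2: "(a2, b2) \<in> Lat"
      unfolding a2_def b2_def a1_def b1_def by (intro Lat_scale1 ab)+
    have "per a1 b1 = per a b" "per a2 b2 = per a b"
      unfolding a2_def b2_def using scale[OF L1] scale[OF ab] by (simp_all add: a1_def b1_def)
    \<comment> \<open>The characteristic equation of the automorphism: the square plus one is four times the automorphism.\<close>
    moreover have "a2 + a = (a1 + a1) + (a1 + a1)" "b2 + b = (b1 + b1) + (b1 + b1)"
      unfolding a2_def b2_def a1_def b1_def exp_ell by (simp_all add: algebra_simps)
    then have "per a2 b2 + per a b = (per a1 b1 + per a1 b1) + (per a1 b1 + per a1 b1)"
      using add[OF L2 ab] add[OF Lat_add[OF L1 L1] Lat_add[OF L1 L1]] add[OF L1 L1] by simp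
    ultimately show ?thesis by simp
  qed
  have step: "deck (i + 1) 0 0 q = deck 1 0 0 (deck i 0 0 q)" for i q
    by (simp add: deck_def vec3_eq_iff exp_add exp_minus algebra_simps exp_diff divide_inverse)
  have Sn: "F (deck n 0 0 q) = F q + of_int n * s" for n q
  proof (induction n rule: int_induct[where k = 0])
    case base then show ?case by (simp add: deck_def)
  next
    case (step1 i) then show ?case using S[of "deck i 0 0 q"] step[of i q] by (simp add: algebra_simps)
  next
    case (step2 i) then show ?case using S[of "deck (i - 1) 0 0 q"] step[of "i - 1" q] by (simp add: algebra_simps)
  qed
  have "ell \<noteq> 0" using ell_bounds by simp
  have "invariant (\<lambda>q. F q - s / ell * q $ 3)"
    unfolding invariant_def
  proof (intro allI impI)
    fix n a b q assume ab: "(a, b) \<in> Lat"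
    have "F (deck n a b q) = F q + of_int n * s"
      using T[OF ab, of "deck n 0 0 q"] per0[OF ab] Sn[of n q] unfolding deck_compose0 by simp
    then show "F (deck n a b q) - s / ell * deck n a b q $ 3 = F q - s / ell * q $ 3"
      using \<open>ell \<noteq> 0\<close> by (simp add: deck_def field_simps)
  qed
  then show ?thesis by blast
qed

lemma C1_grad_translate_diff:
  assumes "C1_grad u u'" shows "C1_grad (\<lambda>q. u (q + c) - u q) (\<lambda>q. u' (q + c) - u' q)"
  unfolding C1_grad_def
proof (intro conjI allI)
  show "continuous_on UNIV (\<lambda>q. u' (q + c) - u' q)"
    by (intro continuous_intros continuous_on_compose2[OF C1_grad_cont(2)[OF assms]] C1_grad_cont(2)[OF assms]) auto
  fix q
  have "((\<lambda>q. q + c) has_derivative (\<lambda>h. h)) (at q)" by (auto intro!: derivative_eq_intros)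
  from has_derivative_compose[OF this, of u] assms
  have "((\<lambda>q. u (q + c)) has_derivative (\<lambda>h. u' (q + c) \<bullet> h)) (at q)" unfolding C1_grad_def by blast
  moreover have "(u has_derivative (\<lambda>h. u' q \<bullet> h)) (at q)" using assms by (simp add: C1_grad_def)
  ultimately show "((\<lambda>q. u (q + c) - u q) has_derivative (\<lambda>h. (u' (q + c) - u' q) \<bullet> h)) (at q)"
    by (auto intro!: derivative_eq_intros simp: inner_diff_left)
qed

text \<open>A horizontal translation preserves the coefficients of the Laplacian and commutes with the lattice,
  though not with the whole deck group; that is enough for the Liouville property in the strip.\<close>

lemma harmonic_translation_invariant:
  assumes G: "C1_grad G (\<lambda>q. pt (a1 q) (a2 q) (a3 q - c))" "invariant G"
    and a: "C1_grad a1 a1'" "C1_grad a2 a2'" "C1_grad a3 a3'"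
    and eq: "\<And>q. exp (2 * q $ 3) * a1' q $ 1 + exp (- (2 * q $ 3)) * a2' q $ 2 + a3' q $ 3 = 0"
    and v3: "v $ 3 = 0"
    and decay: "\<And>h. fades_at_one_end (\<lambda>q. \<bar>G (q + h *\<^sub>R v) - G q\<bar>)"
  shows "G (q + h *\<^sub>R v) = G q"
proof -
  obtain M where M: "\<And>q. \<bar>G q\<bar> \<le> M" using invariant_bounded[OF G(2) C1_grad_cont(1)[OF G(1)]] by blast
  have le: "G (p + h *\<^sub>R v) - G p \<le> 0" for h p
  proof (rule strip_liouville[where u = "\<lambda>q. G (q + h *\<^sub>R v) - G q" and M = "2 * M"
      and \<alpha> = "\<lambda>q. exp (2 * q $ 3)" and \<beta> = "\<lambda>q. exp (- (2 * q $ 3))"])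
    show "G (deck 0 a b q + h *\<^sub>R v) - G (deck 0 a b q) = G (q + h *\<^sub>R v) - G q" if "(a, b) \<in> Lat" for a b q
    proof -
      have "deck 0 a b q + h *\<^sub>R v = deck 0 a b (q + h *\<^sub>R v)" by (simp add: deck_def vec3_eq_iff v3)
      then show ?thesis using invariantD[OF G(2) that] by simp
    qed
    have "pt (a1 q) (a2 q) (a3 q - c) - pt (a1 q') (a2 q') (a3 q' - c) = pt (a1 q - a1 q') (a2 q - a2 q') (a3 q - a3 q')" for q q'
      by (simp add: vec3_eq_iff)
    then show "C1_grad (\<lambda>q. G (q + h *\<^sub>R v) - G q)
        (\<lambda>q. pt (a1 (q + h *\<^sub>R v) - a1 q) (a2 (q + h *\<^sub>R v) - a2 q) (a3 (q + h *\<^sub>R v) - a3 q))"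
      using C1_grad_translate_diff[OF G(1), of "h *\<^sub>R v"] by simp
    show "C1_grad (\<lambda>q. a1 (q + h *\<^sub>R v) - a1 q) (\<lambda>q. a1' (q + h *\<^sub>R v) - a1' q)"
      "C1_grad (\<lambda>q. a2 (q + h *\<^sub>R v) - a2 q) (\<lambda>q. a2' (q + h *\<^sub>R v) - a2' q)"
      "C1_grad (\<lambda>q. a3 (q + h *\<^sub>R v) - a3 q) (\<lambda>q. a3' (q + h *\<^sub>R v) - a3' q)"
      by (intro C1_grad_translate_diff a)+
    show "exp (2 * q $ 3) * (a1' (q + h *\<^sub>R v) - a1' q) $ 1 + exp (- (2 * q $ 3)) * (a2' (q + h *\<^sub>R v) - a2' q) $ 2
      + (a3' (q + h *\<^sub>R v) - a3' q) $ 3 = 0" for q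
      using eq[of q] eq[of "q + h *\<^sub>R v"] v3 by (simp add: algebra_simps)
    show "G (q + h *\<^sub>R v) - G q \<le> 2 * M" for q using M[of q] M[of "q + h *\<^sub>R v"] by linarith
    show "fades_at_one_end (\<lambda>q. G (q + h *\<^sub>R v) - G q)"
      by (rule fades_mono[OF decay[of h]]) simp
  qed auto
  show ?thesis using le[of q h] le[of "q + h *\<^sub>R v" "- h"] by simp
qed

lemma increment_decay:
  assumes G: "C1_grad G G'" and b: "\<And>q. \<bar>G' q \<bullet> v\<bar> \<le> K * exp (\<sigma> * q $ 3)" and v3: "v $ 3 = 0"
  shows "\<bar>G (q + h *\<^sub>R v) - G q\<bar> \<le> \<bar>h\<bar> * K * exp (\<sigma> * q $ 3)"
proof -
  have "norm (G (q + h *\<^sub>R v) - G (q + 0 *\<^sub>R v)) \<le> (K * exp (\<sigma> * q $ 3)) * norm (h - 0)"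
    by (rule field_differentiable_bound[where S = UNIV and f' = "\<lambda>t. G' (q + t *\<^sub>R v) \<bullet> v"])
      (use C1_grad_line[OF G] b[of "q + t *\<^sub>R v" for t] v3 in auto)
  then show ?thesis by (simp add: mult_ac)
qed

text \<open>The invariant frame components of dG are bounded, so \<partial>_xG=O(e^(-z)) and
  \<partial>_yG=O(e^z). Thus differences of translates in x fade at the upper end and those in
  y at the lower end.\<close>

lemma closed_coclosed_rigid:
  assumes a: "C1_grad a1 a1'" "C1_grad a2 a2'" "C1_grad a3 a3'"
    and sym: "\<And>q. a2' q $ 1 = a1' q $ 2" "\<And>q. a3' q $ 1 = a1' q $ 3" "\<And>q. a3' q $ 2 = a2' q $ 3"
    and eq: "\<And>q. exp (2 * q $ 3) * a1' q $ 1 + exp (- (2 * q $ 3)) * a2' q $ 2 + a3' q $ 3 = 0"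
    and cov: "\<And>n a b q. (a, b) \<in> Lat \<Longrightarrow> a1 (deck n a b q) = exp (- (of_int n * ell)) * a1 q"
      "\<And>n a b q. (a, b) \<in> Lat \<Longrightarrow> a2 (deck n a b q) = exp (of_int n * ell) * a2 q"
      "\<And>n a b q. (a, b) \<in> Lat \<Longrightarrow> a3 (deck n a b q) = a3 q"
  shows "a1 q = 0" "a2 q = 0" "a3 q = a3 0"
proof -
  obtain F where F: "C1_grad F (\<lambda>q. pt (a1 q) (a2 q) (a3 q))" using poincare_lemma[OF a sym] by blast
  obtain c where inv: "invariant (\<lambda>q. F q - c * q $ 3)"
    using invariant_closed_form_potential[OF F] cov by auto
  define G where "G q = F q - c * q $ 3" for q
  have nth: "((\<lambda>q::real^3. q $ i) has_derivative (\<lambda>h. h $ i)) (at q)" for i q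
    by (intro bounded_linear_imp_has_derivative bounded_linear_vec_nth)
  have G: "C1_grad G (\<lambda>q. pt (a1 q) (a2 q) (a3 q - c))"
    unfolding C1_grad_def
  proof (intro conjI allI)
    show "continuous_on UNIV (\<lambda>q. pt (a1 q) (a2 q) (a3 q - c))"
      by (intro continuous_intros C1_grad_cont[OF a(1)] C1_grad_cont[OF a(2)] C1_grad_cont[OF a(3)])
    have Fd: "(F has_derivative (\<lambda>h. pt (a1 q) (a2 q) (a3 q) \<bullet> h)) (at q)" for q using F by (simp add: C1_grad_def)
    show "(G has_derivative (\<lambda>h. pt (a1 q) (a2 q) (a3 q - c) \<bullet> h)) (at q)" for q
      unfolding G_def[abs_def]
      by (rule has_derivative_eq_rhs[OF has_derivative_diff[OF Fd has_derivative_mult_right[OF nth]]])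
        (auto simp: inner_3 algebra_simps)
  qed
  have Ginv: "invariant G" using inv by (simp add: G_def[abs_def])
  have scaled: "\<exists>K\<ge>0. \<forall>q. \<bar>u q\<bar> \<le> K * exp (\<sigma> * q $ 3)"
    if u: "continuous_on UNIV u" and i: "invariant (\<lambda>q. exp (- \<sigma> * q $ 3) * u q)" for u :: "real^3 \<Rightarrow> real" and \<sigma>
  proof -
    have "continuous_on UNIV (\<lambda>q. exp (- \<sigma> * q $ 3) * u q)" by (intro continuous_intros u)
    from invariant_bounded[OF i this] obtain K where K: "\<And>q. \<bar>exp (- \<sigma> * q $ 3) * u q\<bar> \<le> K" by blast
    have "0 \<le> K" using K[of 0] by linarith
    moreover have "\<bar>u q\<bar> \<le> K * exp (\<sigma> * q $ 3)" for q
      using K[of q] by (simp add: abs_mult exp_minus field_simps)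
    ultimately show ?thesis by blast
  qed
  obtain K1 where K1: "K1 \<ge> 0" "\<And>q. \<bar>a1 q\<bar> \<le> K1 * exp (- 1 * q $ 3)"
    using scaled[OF C1_grad_cont(1)[OF a(1)], of "- 1"] cov(1)
    by (auto simp: invariant_def deck_def exp_add exp_minus field_simps)
  obtain K2 where K2: "K2 \<ge> 0" "\<And>q. \<bar>a2 q\<bar> \<le> K2 * exp (1 * q $ 3)"
    using scaled[OF C1_grad_cont(1)[OF a(2)], of 1] cov(2)
    by (auto simp: invariant_def deck_def exp_add exp_minus exp_diff field_simps)
  have D1: "\<bar>G (q + h *\<^sub>R e1) - G q\<bar> \<le> \<bar>h\<bar> * K1 * exp (- 1 * q $ 3)" for q h
    by (rule increment_decay[OF G]) (use K1 in auto)
  have D2: "\<bar>G (q + h *\<^sub>R e2) - G q\<bar> \<le> \<bar>h\<bar> * K2 * exp (1 * q $ 3)" for q h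
    by (rule increment_decay[OF G]) (use K2 in auto)
  have small: "\<exists>z0. \<forall>z\<ge>z0. C * exp (- z) \<le> \<eta>" if "C \<ge> 0" "\<eta> > 0" for C \<eta> :: real
  proof -
    have "((\<lambda>z. C * exp (- z)) \<longlongrightarrow> C * 0) at_top"
      by (intro tendsto_mult tendsto_const filterlim_compose[OF exp_at_bot] filterlim_uminus_at_bot_at_top)
    then have "\<forall>\<^sub>F z in at_top. C * exp (- z) < \<eta>" using that(2) by (simp add: order_tendstoD)
    then show ?thesis by (auto simp: eventually_at_top_linorder intro: less_imp_le)
  qed
  have inv1: "G (q + h *\<^sub>R e1) = G q" for q h
  proof (rule harmonic_translation_invariant[OF G Ginv a eq])
    fix h
    have "\<exists>z0. \<forall>q. q $ 3 \<ge> z0 \<longrightarrow> \<bar>G (q + h *\<^sub>R e1) - G q\<bar> \<le> \<eta>" if eta: "\<eta> > 0" for \<eta>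
    proof -
      have "0 \<le> \<bar>h\<bar> * K1" using K1(1) by simp
      from small[OF this eta] obtain z0 where z0: "\<And>z. z \<ge> z0 \<Longrightarrow> \<bar>h\<bar> * K1 * exp (- z) \<le> \<eta>" by blast
      have "\<bar>G (q + h *\<^sub>R e1) - G q\<bar> \<le> \<eta>" if "q $ 3 \<ge> z0" for q
        using D1[of q h] z0[OF that] by simp
      then show ?thesis by blast
    qed
    then show "fades_at_one_end (\<lambda>q. \<bar>G (q + h *\<^sub>R e1) - G q\<bar>)" by (simp add: fades_at_one_end_def)
  qed simp
  have inv2: "G (q + h *\<^sub>R e2) = G q" for q h
  proof (rule harmonic_translation_invariant[OF G Ginv a eq])
    fix h
    have "\<exists>z0. \<forall>q. q $ 3 \<le> z0 \<longrightarrow> \<bar>G (q + h *\<^sub>R e2) - G q\<bar> \<le> \<eta>" if eta: "\<eta> > 0" for \<eta>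
    proof -
      have "0 \<le> \<bar>h\<bar> * K2" using K2(1) by simp
      from small[OF this eta] obtain z0 where z0: "\<And>z. z \<ge> z0 \<Longrightarrow> \<bar>h\<bar> * K2 * exp (- z) \<le> \<eta>" by blast
      have "\<bar>G (q + h *\<^sub>R e2) - G q\<bar> \<le> \<eta>" if "q $ 3 \<le> - z0" for q
        using D2[of q h] z0[of "- (q $ 3)"] that by simp
      then show ?thesis by blast
    qed
    then show "fades_at_one_end (\<lambda>q. \<bar>G (q + h *\<^sub>R e2) - G q\<bar>)" by (simp add: fades_at_one_end_def)
  qed simp
  have zero1: "a1 q = 0" for q
    using C1_grad_line[OF G, of q e1 0 UNIV] DERIV_unique[OF _ DERIV_const[of "G q"]] by (simp add: inv1)
  have zero2: "a2 q = 0" for q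
    using C1_grad_line[OF G, of q e2 0 UNIV] DERIV_unique[OF _ DERIV_const[of "G q"]] by (simp add: inv2)
  show "a1 q = 0" "a2 q = 0" by (rule zero1, rule zero2)
  have z: "a1' q \<bullet> v = 0" "a2' q \<bullet> v = 0" for q v
    using DERIV_unique[OF C1_grad_line[OF a(1), of q v 0 UNIV] , of 0] DERIV_unique[OF C1_grad_line[OF a(2), of q v 0 UNIV], of 0]
    by (simp_all add: zero1 zero2)
  have "a3' q = 0" for q
    using sym[of q] eq[of q] z[of q e1] z[of q e2] z[of q e3] by (simp add: vec3_eq_iff)
  then have "C1_grad a3 (\<lambda>q. 0)" using a(3) by (simp add: C1_grad_def)
  moreover have "C1_grad (\<lambda>q. 0) (\<lambda>q. 0)" by (simp add: C1_grad_def)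
  ultimately show "a3 q = a3 0" using C1_grad_eqI by fastforce
qed

section \<open>Rigidity of Euler flows close to the suspension\<close>

lemma C1_grad_mult:
  assumes "C1_grad u u'" "C1_grad v v'"
  shows "C1_grad (\<lambda>q. u q * v q) (\<lambda>q. u q *\<^sub>R v' q + v q *\<^sub>R u' q)"
  using assms C1_grad_cont[OF assms(1)] C1_grad_cont[OF assms(2)] unfolding C1_grad_def
  by (auto intro!: continuous_intros derivative_eq_intros simp: inner_add_left)

lemma C1_grad_divide:
  assumes "C1_grad u u'" "C1_grad v v'" and pos: "\<And>q. v q > 0"
  shows "C1_grad (\<lambda>q. u q / v q) (\<lambda>q. (1 / (v q)\<^sup>2) *\<^sub>R (v q *\<^sub>R u' q - u q *\<^sub>R v' q))"
  unfolding C1_grad_def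
proof (intro conjI allI)
  have nz: "v q \<noteq> 0" for q using pos[of q] by simp
  show "continuous_on UNIV (\<lambda>q. (1 / (v q)\<^sup>2) *\<^sub>R (v q *\<^sub>R u' q - u q *\<^sub>R v' q))"
    using nz by (intro continuous_intros C1_grad_cont[OF assms(1)] C1_grad_cont[OF assms(2)]) auto
  fix q
  have "(u has_derivative (\<lambda>h. u' q \<bullet> h)) (at q)" "(v has_derivative (\<lambda>h. v' q \<bullet> h)) (at q)"
    using assms by (simp_all add: C1_grad_def)
  from has_derivative_divide'[OF this nz]
  show "((\<lambda>q. u q / v q) has_derivative (\<lambda>h. (1 / (v q)\<^sup>2) *\<^sub>R (v q *\<^sub>R u' q - u q *\<^sub>R v' q) \<bullet> h)) (at q)"
    by (rule has_derivative_eq_rhs) (simp add: fun_eq_iff inner_diff_left power2_eq_square mult_ac)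
qed

lemma C1_grad_exp3: "C1_grad (\<lambda>q. exp (c * q $ 3)) (\<lambda>q. (c * exp (c * q $ 3)) *\<^sub>R e3)"
  unfolding C1_grad_def
proof (intro conjI allI)
  have nth: "((\<lambda>q::real^3. q $ 3) has_derivative (\<lambda>h. h $ 3)) (at q)" for q
    by (intro bounded_linear_imp_has_derivative bounded_linear_vec_nth)
  show "((\<lambda>q. exp (c * q $ 3)) has_derivative (\<bullet>) ((c * exp (c * q $ 3)) *\<^sub>R e3)) (at q)" for q :: "real^3"
    by (rule has_derivative_eq_rhs[OF has_derivative_exp[OF has_derivative_mult_right[OF nth]]])
      (auto simp: fun_eq_iff inner_axis' mult_ac)
qed (intro continuous_intros)

lemma C1_grad_add:
  "C1_grad u u' \<Longrightarrow> C1_grad v v' \<Longrightarrow> C1_grad (\<lambda>q. u q + v q) (\<lambda>q. u' q + v' q)"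
  unfolding C1_grad_def by (auto intro!: continuous_intros derivative_eq_intros simp: inner_add_left)

lemma C1_grad_cmult:
  "C1_grad u u' \<Longrightarrow> C1_grad (\<lambda>q. c * u q) (\<lambda>q. c *\<^sub>R u' q)"
  unfolding C1_grad_def by (auto intro!: continuous_intros derivative_eq_intros)

lemma C1_grad_covariant:
  assumes u: "C1_grad u u'" and cov: "\<And>q. u (deck n a b q) = c * u q"
  shows "u' (deck n a b q) $ 1 * exp (of_int n * ell) = c * u' q $ 1"
    "u' (deck n a b q) $ 2 * exp (- (of_int n * ell)) = c * u' q $ 2"
    "u' (deck n a b q) $ 3 = c * u' q $ 3"
proof -
  have der: "u' (deck n a b q) \<bullet> w = c * (u' q \<bullet> v)"
    if "\<And>t. deck n a b (q + t *\<^sub>R v) = deck n a b q + t *\<^sub>R w" for v w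
  proof -
    have "((\<lambda>t. u (deck n a b q + t *\<^sub>R w)) has_real_derivative c * (u' q \<bullet> v)) (at 0)"
      using DERIV_cmult[OF C1_grad_line[OF u, of q v 0 UNIV], of c] unfolding that[symmetric] cov by simp
    then show ?thesis using DERIV_unique[OF C1_grad_line[OF u, of "deck n a b q" w 0 UNIV]] by simp
  qed
  show "u' (deck n a b q) $ 1 * exp (of_int n * ell) = c * u' q $ 1"
    using der[of e1 "exp (of_int n * ell) *\<^sub>R e1"] by (simp add: deck_def vec3_eq_iff algebra_simps)
  show "u' (deck n a b q) $ 2 * exp (- (of_int n * ell)) = c * u' q $ 2"
    using der[of e2 "exp (- (of_int n * ell)) *\<^sub>R e2"] by (simp add: deck_def vec3_eq_iff algebra_simps)
  show "u' (deck n a b q) $ 3 = c * u' q $ 3"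
    using der[of e3 "e3"] by (simp add: deck_def vec3_eq_iff algebra_simps)
qed

lemma frame_lipschitz_gradient:
  assumes u: "C1_grad u u'" and 1: "\<And>q. \<bar>u' q $ 1\<bar> \<le> 1 / 8 * exp (- (q $ 3))" and 2: "\<And>q. \<bar>u' q $ 2\<bar> \<le> 1 / 8 * exp (q $ 3)"
  shows "frame_lipschitz u"
  unfolding frame_lipschitz_def
proof (intro allI)
  fix x y x' y' z
  have p1: "pt 0 y z + t *\<^sub>R e1 = pt t y z" for t by (simp add: vec3_eq_iff)
  have p2: "pt x' 0 z + t *\<^sub>R e2 = pt x' t z" for t by (simp add: vec3_eq_iff)
  have "norm (u (pt x y z) - u (pt x' y z)) \<le> 1 / 8 * exp (- z) * norm (x - x')"
    by (rule field_differentiable_bound[where S = UNIV and f' = "\<lambda>t. u' (pt t y z) $ 1"])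
      (use C1_grad_line[OF u, of "pt 0 y z" e1] 1[of "pt t y z" for t] in \<open>auto simp: p1\<close>)
  moreover have "norm (u (pt x' y z) - u (pt x' y' z)) \<le> 1 / 8 * exp z * norm (y - y')"
    by (rule field_differentiable_bound[where S = UNIV and f' = "\<lambda>t. u' (pt x' t z) $ 2"])
      (use C1_grad_line[OF u, of "pt x' 0 z" e2] 2[of "pt x' t z" for t] in \<open>auto simp: p2\<close>)
  ultimately show "\<bar>u (pt x y z) - u (pt x' y' z)\<bar> \<le> 1 / 8 * (exp (- z) * \<bar>x - x'\<bar> + exp z * \<bar>y - y'\<bar>)"
    unfolding real_norm_def distrib_left by linarith
qed

text \<open>Compare the circulation around a large square in the plane z=0, which is of the order of the
  side, with its lower bound by Stokes' theorem, which is of the order of the area.\<close>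

lemma constant_vorticity_zero:
  assumes a: "C1_grad a1 a1'" "C1_grad a2 a2'" and w: "\<And>q. a2' q $ 1 - a1' q $ 2 = c * \<nu> q"
    and \<nu>: "\<And>q. \<nu> q \<ge> m" "m > 0"
    and K: "\<And>q. q $ 3 = 0 \<Longrightarrow> \<bar>a1 q\<bar> \<le> K" "\<And>q. q $ 3 = 0 \<Longrightarrow> \<bar>a2 q\<bar> \<le> K"
  shows "c = 0"
proof -
  have K0: "0 \<le> K" using K(1)[of 0] by simp
  have circ_le: "\<bar>circ b1 b2 0 h\<bar> \<le> 4 * K"
    if "continuous_on UNIV b1" "continuous_on UNIV b2" "\<And>q. q $ 3 = 0 \<Longrightarrow> \<bar>b1 q\<bar> \<le> K" "\<And>q. q $ 3 = 0 \<Longrightarrow> \<bar>b2 q\<bar> \<le> K" for b1 b2 h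
  proof -
    note [continuous_intros] = continuous_on_compose2[OF that(1)] continuous_on_compose2[OF that(2)]
    have "\<bar>b2 (0 + h *\<^sub>R e1 + (s * h) *\<^sub>R e2) - b2 (0 + (s * h) *\<^sub>R e2) - b1 (0 + h *\<^sub>R e2 + (s * h) *\<^sub>R e1) + b1 (0 + (s * h) *\<^sub>R e1)\<bar> \<le> 4 * K" for s
      using that(4)[of "0 + h *\<^sub>R e1 + (s * h) *\<^sub>R e2"] that(4)[of "0 + (s * h) *\<^sub>R e2"]
        that(3)[of "0 + h *\<^sub>R e2 + (s * h) *\<^sub>R e1"] that(3)[of "0 + (s * h) *\<^sub>R e1"] by simp
    then have "norm (circ b1 b2 0 h) \<le> 4 * K * (1 - 0)"
      unfolding circ_def by (intro integral_bound continuous_intros subset_UNIV) auto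
    then show ?thesis by simp
  qed
  have main: "c' \<le> 0" if b: "C1_grad b1 b1'" "C1_grad b2 b2'" "\<And>q. b2' q $ 1 - b1' q $ 2 = c' * \<nu> q"
      "\<And>q. q $ 3 = 0 \<Longrightarrow> \<bar>b1 q\<bar> \<le> K" "\<And>q. q $ 3 = 0 \<Longrightarrow> \<bar>b2 q\<bar> \<le> K" for b1 b1' b2 b2' c'
  proof (rule ccontr)
    assume "\<not> c' \<le> 0"
    then have c': "c' > 0" by simp
    \<comment> \<open>The side for which the area term exceeds the bound of the circulation by one.\<close>
    define h where "h = (4 * K + 1) / (c' * m)"
    have h: "h \<ge> 0" using c' \<nu>(2) K0 by (simp add: h_def)
    have "h * (c' * m) \<le> circ b1 b2 0 h"
      by (rule circ_stokes[OF b(1,2) _ h]) (use b(3) \<nu>(1) c' in auto)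
    moreover have "circ b1 b2 0 h \<le> 4 * K"
      using circ_le[OF C1_grad_cont(1)[OF b(1)] C1_grad_cont(1)[OF b(2)] b(4,5)] by (meson abs_le_D1)
    moreover have "h * (c' * m) = 4 * K + 1" using c' \<nu>(2) by (simp add: h_def)
    ultimately show False by linarith
  qed
  have "c \<le> 0" by (rule main[OF a w K])
  moreover have "- c \<le> 0"
    by (rule main[OF C1_grad_cmult[OF a(1), of "- 1"] C1_grad_cmult[OF a(2), of "- 1"]])
      (use w K in \<open>auto simp: algebra_simps\<close>)
  ultimately show ?thesis by simp
qed

text \<open>The rigidity theorem on the universal cover. Here W_1,W_2,W_3 are the coordinate components of
  W; \<open>eq1\<close>, \<open>eq2\<close> and \<open>eq3\<close> are the Euler equations in the Sol metric. The orbits are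
  parametrized by z, that is, W is replaced by W/W_3. The bound 1/1000 leaves ample room:
  on the fundamental box the frame changes lengths by a factor of at most 4, and the
  frame components of W/W_3 have to be Lipschitz with constant 1/8.\<close>

theorem euler_rigidity:
  assumes W: "C1_grad W1 W1'" "C1_grad W2 W2'" "C1_grad W3 W3'" and p: "C1_grad p p'" "invariant p"
    and eq1: "\<And>q. W1' q $ 1 * W1 q + W1' q $ 2 * W2 q + W1' q $ 3 * W3 q - 2 * W1 q * W3 q = - exp (2 * q $ 3) * p' q $ 1"
    and eq2: "\<And>q. W2' q $ 1 * W1 q + W2' q $ 2 * W2 q + W2' q $ 3 * W3 q + 2 * W2 q * W3 q = - exp (- 2 * q $ 3) * p' q $ 2"
    and eq3: "\<And>q. W3' q $ 1 * W1 q + W3' q $ 2 * W2 q + W3' q $ 3 * W3 q + exp (- 2 * q $ 3) * (W1 q)\<^sup>2 - exp (2 * q $ 3) * (W2 q)\<^sup>2 = - p' q $ 3"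
    and div: "\<And>q. W1' q $ 1 + W2' q $ 2 + W3' q $ 3 = 0"
    and cov: "\<And>n a b q. (a, b) \<in> Lat \<Longrightarrow> W1 (deck n a b q) = exp (of_int n * ell) * W1 q"
      "\<And>n a b q. (a, b) \<in> Lat \<Longrightarrow> W2 (deck n a b q) = exp (- (of_int n * ell)) * W2 q"
      "\<And>n a b q. (a, b) \<in> Lat \<Longrightarrow> W3 (deck n a b q) = W3 q"
    and small: "\<And>q. q \<in> fund_box \<Longrightarrow> \<bar>W1 q\<bar> \<le> 1 / 1000" "\<And>q. q \<in> fund_box \<Longrightarrow> \<bar>W2 q\<bar> \<le> 1 / 1000" "\<And>q. q \<in> fund_box \<Longrightarrow> \<bar>W3 q - 1\<bar> \<le> 1 / 1000"
      "\<And>q i. q \<in> fund_box \<Longrightarrow> \<bar>W1' q $ i\<bar> \<le> 1 / 1000" "\<And>q i. q \<in> fund_box \<Longrightarrow> \<bar>W2' q $ i\<bar> \<le> 1 / 1000" "\<And>q i. q \<in> fund_box \<Longrightarrow> \<bar>W3' q $ i\<bar> \<le> 1 / 1000"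
  shows "\<exists>c>0. \<forall>q. W1 q = 0 \<and> W2 q = 0 \<and> W3 q = c"
proof -
  have W3_inv: "invariant W3" using cov(3) by (simp add: invariant_def)
  have W3_ge: "W3 q \<ge> 999 / 1000" for q
  proof (rule invariant_from_fund_box[OF W3_inv, where P = "\<lambda>x. x \<ge> 999 / 1000"])
    show "W3 q \<ge> 999 / 1000" if "q \<in> fund_box" for q using small(3)[OF that] by linarith
  qed
  have W3_pos: "W3 q > 0" for q using W3_ge[of q] by linarith
  have W3_nz: "W3 q \<noteq> 0" for q using W3_pos[of q] by simp
  define f where "f q = W1 q / W3 q" for q
  define f' where "f' q = (1 / (W3 q)\<^sup>2) *\<^sub>R (W3 q *\<^sub>R W1' q - W1 q *\<^sub>R W3' q)" for q
  define g where "g q = W2 q / W3 q" for q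
  define g' where "g' q = (1 / (W3 q)\<^sup>2) *\<^sub>R (W3 q *\<^sub>R W2' q - W2 q *\<^sub>R W3' q)" for q
  have f: "C1_grad f f'" unfolding f_def[abs_def] f'_def[abs_def] by (rule C1_grad_divide[OF W(1,3) W3_pos])
  have g: "C1_grad g g'" unfolding g_def[abs_def] g'_def[abs_def] by (rule C1_grad_divide[OF W(2,3) W3_pos])
  have fcov: "f (deck n a b q) = exp (of_int n * ell) * f q" if "(a, b) \<in> Lat" for n a b q
    using cov[OF that] by (simp add: f_def)
  have gcov: "g (deck n a b q) = exp (- (of_int n * ell)) * g q" if "(a, b) \<in> Lat" for n a b q
    using cov[OF that] by (simp add: g_def)
  have slope_bound: "\<bar>((1 / (W3 q)\<^sup>2) *\<^sub>R (W3 q *\<^sub>R V' - V *\<^sub>R W3' q)) $ i\<bar> \<le> 1 / 200"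
    if q: "q \<in> fund_box" and V: "\<bar>V\<bar> \<le> 1 / 1000" "\<bar>V' $ i\<bar> \<le> 1 / 1000" for q V V' i
  proof -
    have W3le: "\<bar>W3 q\<bar> \<le> 2" using small(3)[OF q] by linarith
    have "\<bar>W3 q * V' $ i\<bar> \<le> 2 * (1 / 1000)" unfolding abs_mult using W3le V by (intro mult_mono) auto
    moreover have "\<bar>V * W3' q $ i\<bar> \<le> 1 * (1 / 1000)" unfolding abs_mult using V small(6)[OF q, of i] by (intro mult_mono) auto
    ultimately have n: "\<bar>W3 q * V' $ i - V * W3' q $ i\<bar> \<le> 3 / 1000" by linarith
    have "(9 / 10)\<^sup>2 \<le> (W3 q)\<^sup>2" using W3_ge[of q] by (intro power_mono) auto
    then have d: "1 / (W3 q)\<^sup>2 \<le> 5 / 3" using W3_nz[of q] by (simp add: power2_eq_square field_simps)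
    have "\<bar>(1 / (W3 q)\<^sup>2) * (W3 q * V' $ i - V * W3' q $ i)\<bar> \<le> (5 / 3) * (3 / 1000)"
      unfolding abs_mult using d n by (intro mult_mono) auto
    then show ?thesis by simp
  qed
  have e2z: "exp (2 * q $ 3) \<le> 16" "exp (- 2 * q $ 3) \<le> 1" if "q \<in> fund_box" for q
  proof -
    have "exp (q $ 3) \<le> exp ell" using that by (simp add: fund_box_def)
    then have "exp (q $ 3) \<le> 4" using ell_bounds by linarith
    then have "exp (q $ 3) * exp (q $ 3) \<le> 4 * 4" by (intro mult_mono) auto
    then show "exp (2 * q $ 3) \<le> 16" by (simp flip: exp_add)
    show "exp (- 2 * q $ 3) \<le> 1" using that by (simp add: fund_box_def)
  qed
  have f1: "\<bar>f' q $ 1\<bar> \<le> 1 / 8" for q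
  proof (rule invariant_from_fund_box[where \<phi> = "\<lambda>q. f' q $ 1" and P = "\<lambda>x. \<bar>x\<bar> \<le> 1 / 8"])
    show "invariant (\<lambda>q. f' q $ 1)" unfolding invariant_def
      using C1_grad_covariant(1)[OF f fcov] by auto
    show "\<bar>f' q $ 1\<bar> \<le> 1 / 8" if "q \<in> fund_box" for q
      using slope_bound[OF that small(1,4)[OF that]] unfolding f'_def[symmetric] by (rule order_trans) simp
  qed
  have f2: "\<bar>exp (- 2 * q $ 3) * f' q $ 2\<bar> \<le> 1 / 8" for q
  proof (rule invariant_from_fund_box[where \<phi> = "\<lambda>q. exp (- 2 * q $ 3) * f' q $ 2" and P = "\<lambda>x. \<bar>x\<bar> \<le> 1 / 8"])
    show "invariant (\<lambda>q. exp (- 2 * q $ 3) * f' q $ 2)" unfolding invariant_def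
    proof (intro allI impI)
      fix n a b q assume ab: "(a, b) \<in> Lat"
      have "f' (deck n a b q) $ 2 = exp (of_int n * ell) * exp (of_int n * ell) * f' q $ 2"
        using C1_grad_covariant(2)[OF f fcov[OF ab], of n q] by (simp add: exp_minus field_simps)
      then show "exp (- 2 * deck n a b q $ 3) * f' (deck n a b q) $ 2 = exp (- 2 * q $ 3) * f' q $ 2"
        by (simp add: deck_def flip: exp_add mult.assoc)
    qed
    show "\<bar>exp (- 2 * q $ 3) * f' q $ 2\<bar> \<le> 1 / 8" if "q \<in> fund_box" for q
    proof -
      have "\<bar>f' q $ 2\<bar> \<le> 1 / 200" unfolding f'_def by (rule slope_bound[OF that small(1,4)[OF that]])
      then have "\<bar>exp (- 2 * q $ 3) * f' q $ 2\<bar> \<le> 1 * (1 / 200)"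
        unfolding abs_mult using e2z[OF that] by (intro mult_mono) auto
      then show ?thesis by simp
    qed
  qed
  have g1: "\<bar>exp (2 * q $ 3) * g' q $ 1\<bar> \<le> 1 / 8" for q
  proof (rule invariant_from_fund_box[where \<phi> = "\<lambda>q. exp (2 * q $ 3) * g' q $ 1" and P = "\<lambda>x. \<bar>x\<bar> \<le> 1 / 8"])
    show "invariant (\<lambda>q. exp (2 * q $ 3) * g' q $ 1)" unfolding invariant_def
    proof (intro allI impI)
      fix n a b q assume ab: "(a, b) \<in> Lat"
      have "g' (deck n a b q) $ 1 = exp (- (of_int n * ell)) * exp (- (of_int n * ell)) * g' q $ 1"
        using C1_grad_covariant(1)[OF g gcov[OF ab], of n q] by (simp add: exp_minus field_simps)
      then show "exp (2 * deck n a b q $ 3) * g' (deck n a b q) $ 1 = exp (2 * q $ 3) * g' q $ 1"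
        by (simp add: deck_def flip: exp_add mult.assoc)
    qed
    show "\<bar>exp (2 * q $ 3) * g' q $ 1\<bar> \<le> 1 / 8" if "q \<in> fund_box" for q
    proof -
      have "\<bar>g' q $ 1\<bar> \<le> 1 / 200" unfolding g'_def by (rule slope_bound[OF that small(2,5)[OF that]])
      then have "\<bar>exp (2 * q $ 3) * g' q $ 1\<bar> \<le> 16 * (1 / 200)"
        unfolding abs_mult using e2z[OF that] by (intro mult_mono) auto
      then show ?thesis by simp
    qed
  qed
  have g2: "\<bar>g' q $ 2\<bar> \<le> 1 / 8" for q
  proof (rule invariant_from_fund_box[where \<phi> = "\<lambda>q. g' q $ 2" and P = "\<lambda>x. \<bar>x\<bar> \<le> 1 / 8"])
    show "invariant (\<lambda>q. g' q $ 2)" unfolding invariant_def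
      using C1_grad_covariant(2)[OF g gcov] by auto
    show "\<bar>g' q $ 2\<bar> \<le> 1 / 8" if "q \<in> fund_box" for q
      using slope_bound[OF that small(2,5)[OF that]] unfolding g'_def[symmetric] by (rule order_trans) simp
  qed
  define ft where "ft q = exp (- 1 * q $ 3) * f q" for q
  define gt where "gt q = exp (1 * q $ 3) * g q" for q
  have ft: "C1_grad ft (\<lambda>q. exp (- 1 * q $ 3) *\<^sub>R f' q + f q *\<^sub>R (- 1 * exp (- 1 * q $ 3)) *\<^sub>R e3)"
    unfolding ft_def[abs_def] by (rule C1_grad_mult[OF C1_grad_exp3 f])
  have gt: "C1_grad gt (\<lambda>q. exp (1 * q $ 3) *\<^sub>R g' q + g q *\<^sub>R (1 * exp (1 * q $ 3)) *\<^sub>R e3)"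
    unfolding gt_def[abs_def] by (rule C1_grad_mult[OF C1_grad_exp3 g])
  have ft_lip: "frame_lipschitz ft"
  proof (rule frame_lipschitz_gradient[OF ft])
    fix q
    show "\<bar>(exp (- 1 * q $ 3) *\<^sub>R f' q + f q *\<^sub>R (- 1 * exp (- 1 * q $ 3)) *\<^sub>R e3) $ 1\<bar> \<le> 1 / 8 * exp (- (q $ 3))"
      using f1[of q] by (simp add: abs_mult)
    have "exp (- (q $ 3)) = exp (q $ 3) * exp (- 2 * q $ 3)" by (simp flip: exp_add)
    then show "\<bar>(exp (- 1 * q $ 3) *\<^sub>R f' q + f q *\<^sub>R (- 1 * exp (- 1 * q $ 3)) *\<^sub>R e3) $ 2\<bar> \<le> 1 / 8 * exp (q $ 3)"
      using f2[of q] by (simp add: abs_mult)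
  qed
  have gt_lip: "frame_lipschitz gt"
  proof (rule frame_lipschitz_gradient[OF gt])
    fix q
    show "\<bar>(exp (1 * q $ 3) *\<^sub>R g' q + g q *\<^sub>R (1 * exp (1 * q $ 3)) *\<^sub>R e3) $ 2\<bar> \<le> 1 / 8 * exp (q $ 3)"
      using g2[of q] by (simp add: abs_mult)
    have "exp (q $ 3) = exp (- (q $ 3)) * exp (2 * q $ 3)" by (simp flip: exp_add)
    then show "\<bar>(exp (1 * q $ 3) *\<^sub>R g' q + g q *\<^sub>R (1 * exp (1 * q $ 3)) *\<^sub>R e3) $ 1\<bar> \<le> 1 / 8 * exp (- (q $ 3))"
      using g1[of q] by (simp add: abs_mult)
  qed
  have ft_inv: "invariant ft" unfolding invariant_def ft_def
    using fcov by (simp add: deck_def exp_add exp_minus exp_diff field_simps)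
  have gt_inv: "invariant gt" unfolding invariant_def gt_def
    using gcov by (simp add: deck_def exp_add exp_minus exp_diff field_simps)
  have orbit_constant: "\<exists>c. \<forall>q. \<phi> q = c"
    if \<phi>: "continuous_on UNIV \<phi>" "invariant \<phi>"
      and fi: "\<And>P z. (\<And>z. (P has_vector_derivative pt (f (P z)) (g (P z)) 1) (at z)) \<Longrightarrow> \<phi> (P z) = \<phi> (P 0)" for \<phi> :: "real^3 \<Rightarrow> real"
  proof (rule first_integral_constant[OF C1_grad_cont(1)[OF ft] ft_inv ft_lip C1_grad_cont(1)[OF gt] gt_inv gt_lip \<phi>])
    fix X Y and z :: real
    assume X: "\<And>z. (X has_real_derivative exp z * ft (pt (X z) (Y z) z)) (at z)"
      and Y: "\<And>z. (Y has_real_derivative exp (- z) * gt (pt (X z) (Y z) z)) (at z)"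
    have "exp z * ft (pt (X z) (Y z) z) = f (pt (X z) (Y z) z)" "exp (- z) * gt (pt (X z) (Y z) z) = g (pt (X z) (Y z) z)" for z
      by (simp_all add: ft_def gt_def flip: exp_add mult.assoc)
    then have "((\<lambda>z. pt (X z) (Y z) z) has_vector_derivative pt (f (pt (X z) (Y z) z)) (g (pt (X z) (Y z) z)) 1) (at z)" for z
      using X[of z] Y[of z] by (intro has_vector_derivative_pt) auto
    from fi[OF this] show "\<phi> (pt (X z) (Y z) z) = \<phi> (pt (X 0) (Y 0) 0)" .
  qed
  \<comment> \<open>The dual 1-form; its third coefficient is W3.\<close>
  define a1 where "a1 q = exp (- 2 * q $ 3) * W1 q" for q
  define a1' where "a1' q = exp (- 2 * q $ 3) *\<^sub>R W1' q + W1 q *\<^sub>R (- 2 * exp (- 2 * q $ 3)) *\<^sub>R e3" for q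
  define a2 where "a2 q = exp (2 * q $ 3) * W2 q" for q
  define a2' where "a2' q = exp (2 * q $ 3) *\<^sub>R W2' q + W2 q *\<^sub>R (2 * exp (2 * q $ 3)) *\<^sub>R e3" for q
  have a1: "C1_grad a1 a1'" unfolding a1_def[abs_def] a1'_def[abs_def] by (rule C1_grad_mult[OF C1_grad_exp3 W(1)])
  have a2: "C1_grad a2 a2'" unfolding a2_def[abs_def] a2'_def[abs_def] by (rule C1_grad_mult[OF C1_grad_exp3 W(2)])
  have ee: "exp (2 * q $ 3) * exp (- 2 * q $ 3) = 1" for q :: "real^3" by (simp flip: exp_add)
  \<comment> \<open>The Bernoulli function. Its gradient is the contraction of the vorticity with W, up to sign.\<close>
  define B where "B q = p q + 1 / 2 * (a1 q * W1 q + (a2 q * W2 q + W3 q * W3 q))" for q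
  define B' where "B' q = p' q + (1 / 2) *\<^sub>R ((a1 q *\<^sub>R W1' q + W1 q *\<^sub>R a1' q) + ((a2 q *\<^sub>R W2' q + W2 q *\<^sub>R a2' q) + (W3 q *\<^sub>R W3' q + W3 q *\<^sub>R W3' q)))" for q
  have B: "C1_grad B B'" unfolding B_def[abs_def] B'_def[abs_def]
    by (intro C1_grad_add C1_grad_cmult C1_grad_mult p a1 a2 W)
  have B1: "B' q $ 1 = W2 q * (a2' q $ 1 - a1' q $ 2) + W3 q * (W3' q $ 1 - a1' q $ 3)" for q
  proof -
    have "p' q $ 1 = - exp (- 2 * q $ 3) * (W1' q $ 1 * W1 q + W1' q $ 2 * W2 q + W1' q $ 3 * W3 q - 2 * W1 q * W3 q)"
      unfolding eq1 using ee[of q] by (simp add: mult.commute)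
    then show ?thesis unfolding B'_def a1_def a2_def a1'_def a2'_def by (simp add: algebra_simps)
  qed
  have B2: "B' q $ 2 = - W1 q * (a2' q $ 1 - a1' q $ 2) + W3 q * (W3' q $ 2 - a2' q $ 3)" for q
  proof -
    have "p' q $ 2 = - exp (2 * q $ 3) * (W2' q $ 1 * W1 q + W2' q $ 2 * W2 q + W2' q $ 3 * W3 q + 2 * W2 q * W3 q)"
      unfolding eq2 using ee[of q] by simp
    then show ?thesis unfolding B'_def a1_def a2_def a1'_def a2'_def by (simp add: algebra_simps)
  qed
  have B3: "B' q $ 3 = - W1 q * (W3' q $ 1 - a1' q $ 3) - W2 q * (W3' q $ 2 - a2' q $ 3)" for q
  proof -
    have "p' q $ 3 = - (W3' q $ 1 * W1 q + W3' q $ 2 * W2 q + W3' q $ 3 * W3 q + exp (- 2 * q $ 3) * (W1 q)\<^sup>2 - exp (2 * q $ 3) * (W2 q)\<^sup>2)"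
      using eq3[of q] by simp
    then show ?thesis unfolding B'_def a1_def a2_def a1'_def a2'_def by (simp add: algebra_simps power2_eq_square)
  qed
  have B_orth: "f q * B' q $ 1 + g q * B' q $ 2 + B' q $ 3 = 0" for q
    unfolding B1 B2 B3 f_def g_def using W3_nz[of q] by (simp add: field_simps)
  have exp_deck: "exp (- 2 * deck n a b q $ 3) = exp (- 2 * q $ 3) * exp (- (of_int n * ell)) * exp (- (of_int n * ell))"
    "exp (2 * deck n a b q $ 3) = exp (2 * q $ 3) * exp (of_int n * ell) * exp (of_int n * ell)" for n a b q
    by (simp_all add: deck_def algebra_simps flip: exp_add)
  have a1_cov: "a1 (deck n a b q) = exp (- (of_int n * ell)) * a1 q" if "(a, b) \<in> Lat" for n a b q
    unfolding a1_def exp_deck cov(1)[OF that] by (simp add: exp_minus field_simps)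
  have a2_cov: "a2 (deck n a b q) = exp (of_int n * ell) * a2 q" if "(a, b) \<in> Lat" for n a b q
    unfolding a2_def exp_deck cov(2)[OF that] by (simp add: exp_minus field_simps)
  have B_inv: "invariant B" unfolding invariant_def B_def
    using a1_cov a2_cov cov invariantD[OF p(2)] by (simp add: exp_minus field_simps)
  obtain cB where cB: "\<And>q. B q = cB"
  proof -
    have "\<exists>c. \<forall>q. B q = c"
    proof (rule orbit_constant[OF C1_grad_cont(1)[OF B] B_inv])
      fix P and z :: real
      assume P: "\<And>z. (P has_vector_derivative pt (f (P z)) (g (P z)) 1) (at z)"
      have "((\<lambda>z. B (P z)) has_real_derivative 0) (at z)" for z
        using C1_grad_chain[OF B P, of z] B_orth[of "P z"] by (simp add: inner_3 mult_ac)
      then show "B (P z) = B (P 0)" by (intro DERIV_isconst_all) auto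
    qed
    then show thesis using that by blast
  qed
  have B'0: "B' q = 0" for q
  proof -
    have "B' q \<bullet> v = 0" for v using DERIV_unique[OF C1_grad_line[OF B, of q v 0 UNIV], of 0] by (simp add: cB)
    from this[of e1] this[of e2] this[of e3] show ?thesis by (simp add: vec3_eq_iff)
  qed
  define w where "w q = a2' q $ 1 - a1' q $ 2" for q
  have k1: "W3' q $ 1 - a1' q $ 3 = - g q * w q" for q
    using B1[of q] B'0[of q] W3_nz[of q] by (simp add: g_def w_def field_simps) 
  have k2: "W3' q $ 2 - a2' q $ 3 = f q * w q" for q
    using B2[of q] B'0[of q] W3_nz[of q] by (simp add: f_def w_def field_simps)
  have cons: "W3' q $ 3 + f q * W3' q $ 1 + g q * W3' q $ 2 + (f' q $ 1 + g' q $ 2) * W3 q = 0" for q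
  proof -
    have "(f' q $ 1 + g' q $ 2) * W3 q = W1' q $ 1 + W2' q $ 2 - f q * W3' q $ 1 - g q * W3' q $ 2"
      unfolding f'_def g'_def f_def g_def using W3_nz[of q] by (simp add: field_simps power2_eq_square)
    then show ?thesis using div[of q] by simp
  qed
  have wc: "continuous_on UNIV w" unfolding w_def by (intro continuous_intros C1_grad_cont[OF a1] C1_grad_cont[OF a2])
  \<comment> \<open>The proportionality factor of curl and field.\<close>
  obtain lam where lam: "\<And>q. w q / W3 q = lam"
  proof -
    have "\<exists>c. \<forall>q. w q / W3 q = c"
    proof (rule orbit_constant)
      show "continuous_on UNIV (\<lambda>q. w q / W3 q)" using W3_nz by (intro continuous_intros wc C1_grad_cont[OF W(3)]) auto
      show "invariant (\<lambda>q. w q / W3 q)" unfolding invariant_def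
      proof (intro allI impI)
        fix n a b q assume ab: "(a, b) \<in> Lat"
        have "w (deck n a b q) = w q" unfolding w_def
          using C1_grad_covariant(2)[where n = n and q = q, OF a1 a1_cov[OF ab]] C1_grad_covariant(1)[where n = n and q = q, OF a2 a2_cov[OF ab]] by simp
        then show "w (deck n a b q) / W3 (deck n a b q) = w q / W3 q" using cov(3)[OF ab] by simp
      qed
      fix P and z :: real
      assume P: "\<And>z. (P has_vector_derivative pt (f (P z)) (g (P z)) 1) (at z)"
      have vt: "w (P A) / W3 (P A) = w (P C) / W3 (P C)" if "A \<le> C" for A C
        by (rule vorticity_transport[where f = f and f' = f' and g = g and g' = g' and w = w and \<nu> = W3 and P = P])
          (rule a1 a2 W(3) w_def k1 k2 f g W3_pos cons P that)+
      show "w (P z) / W3 (P z) = w (P 0) / W3 (P 0)"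
        using vt[of 0 z, symmetric] vt[of z 0] linear[of 0 z] by blast
    qed
    then show thesis using that by blast
  qed
  have "lam = 0"
  proof -
    have c: "continuous_on UNIV (\<lambda>q. exp (1 * q $ 3) * a1 q)" "continuous_on UNIV (\<lambda>q. exp (- 1 * q $ 3) * a2 q)"
      by (intro continuous_intros C1_grad_cont[OF a1] C1_grad_cont[OF a2])+
    have i: "invariant (\<lambda>q. exp (1 * q $ 3) * a1 q)" "invariant (\<lambda>q. exp (- 1 * q $ 3) * a2 q)"
      unfolding invariant_def using a1_cov a2_cov by (simp_all add: deck_def exp_add exp_minus exp_diff field_simps)
    obtain K1 where K1: "\<And>q. \<bar>exp (1 * q $ 3) * a1 q\<bar> \<le> K1" using invariant_bounded[OF i(1) c(1)] by blast
    obtain K2 where K2: "\<And>q. \<bar>exp (- 1 * q $ 3) * a2 q\<bar> \<le> K2" using invariant_bounded[OF i(2) c(2)] by blast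
    show ?thesis
    proof (rule constant_vorticity_zero[OF a1 a2 _ W3_ge])
      show "a2' q $ 1 - a1' q $ 2 = lam * W3 q" for q
        using lam[of q] W3_nz[of q] by (simp add: w_def field_simps)
      show "\<bar>a1 q\<bar> \<le> max K1 K2" if "q $ 3 = 0" for q using K1[of q] that by (simp add: le_max_iff_disj)
      show "\<bar>a2 q\<bar> \<le> max K1 K2" if "q $ 3 = 0" for q using K2[of q] that by (simp add: le_max_iff_disj)
    qed simp
  qed
  then have w0: "w q = 0" for q using lam[of q] W3_nz[of q] by simp
  have sym: "a2' q $ 1 = a1' q $ 2" "W3' q $ 1 = a1' q $ 3" "W3' q $ 2 = a2' q $ 3" for q
    using w0[of q] k1[of q] k2[of q] by (simp_all add: w_def)
  have cocl: "exp (2 * q $ 3) * a1' q $ 1 + exp (- (2 * q $ 3)) * a2' q $ 2 + W3' q $ 3 = 0" for q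
    using div[of q] ee[of q] unfolding a1'_def a2'_def by (simp add: mult_ac flip: mult.assoc)
  note rigid = closed_coclosed_rigid[OF a1 a2 W(3) sym cocl a1_cov a2_cov cov(3)]
  have "W1 q = 0 \<and> W2 q = 0 \<and> W3 q = W3 0" for q
    using rigid[of q] by (simp add: a1_def a2_def)
  then show ?thesis using W3_pos[of 0] by blast
qed

section \<open>The quotient manifold\<close>

lemma deck_compose:
  "deck n a b (deck n' a' b' q) =
     deck (n + n') (exp (of_int n * ell) * a' + a) (exp (- (of_int n * ell)) * b' + b) q"
  by (simp add: deck_def vec3_eq_iff algebra_simps exp_add exp_diff exp_minus divide_inverse)

lemma deck_zero [simp]: "deck 0 0 0 q = q"
  by (simp add: deck_def vec3_eq_iff)

definition deck_rel :: "real^3 \<Rightarrow> real^3 \<Rightarrow> bool" where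
  "deck_rel p q \<longleftrightarrow> (\<exists>n a b. (a, b) \<in> Lat \<and> q = deck n a b p)"

lemma deck_rel_refl: "deck_rel p p"
  unfolding deck_rel_def by (intro exI[of _ 0]) simp

lemma deck_rel_trans: "deck_rel p q \<Longrightarrow> deck_rel q r \<Longrightarrow> deck_rel p r"
  unfolding deck_rel_def by (metis deck_compose Lat_add Lat_scale)

lemma deck_rel_sym: "deck_rel p q \<Longrightarrow> deck_rel q p"
proof -
  assume "deck_rel p q"
  then obtain n a b where ab: "(a, b) \<in> Lat" and q: "q = deck n a b p" unfolding deck_rel_def by blast
  have L: "(- (exp (of_int (- n) * ell) * a), - (exp (- (of_int (- n) * ell)) * b)) \<in> Lat"
    by (intro Lat_uminus Lat_scale ab)
  have "p = deck (- n) (- (exp (of_int (- n) * ell) * a)) (- (exp (- (of_int (- n) * ell)) * b)) q"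
    unfolding q deck_compose by simp
  then show "deck_rel q p" unfolding deck_rel_def using L by blast
qed

text \<open>The quotient map by the deck group, with the points of the quotient labelled by real numbers. Such
  a labelling exists since \<real>^3 has the cardinality of \<real>.\<close>

definition proj :: "real^3 \<Rightarrow> real" where
  "proj = (SOME f. \<forall>p q. f p = f q \<longleftrightarrow> deck_rel p q)"

lemma proj_eq_iff: "proj p = proj q \<longleftrightarrow> deck_rel p q"
proof -
  obtain j :: "real \<times> real \<Rightarrow> real" where "bij_betw j (UNIV \<times> UNIV) UNIV"
    using card_of_Times_same_infinite[OF infinite_UNIV_char_0[where 'a = real]]
    unfolding card_of_ordIso[symmetric] by blast
  then have j: "j u = j v \<longleftrightarrow> u = v" for u v by (auto simp: bij_betw_def inj_eq)
  define J where "J v = j (v $ 1, j (v $ 2, v $ 3))" for v :: "real^3"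
  have J: "J u = J v \<longleftrightarrow> u = v" for u v by (simp add: J_def j vec3_eq_iff)
  define rep where "rep p = (SOME q. deck_rel p q)" for p
  have rep: "deck_rel p (rep p)" for p unfolding rep_def by (rule someI[of _ p]) (rule deck_rel_refl)
  have "rep p = rep q \<longleftrightarrow> deck_rel p q" for p q
  proof
    assume "rep p = rep q"
    then show "deck_rel p q" using rep[of p] rep[of q] deck_rel_sym deck_rel_trans by metis
  next
    assume "deck_rel p q"
    then have "deck_rel p = deck_rel q" using deck_rel_sym deck_rel_trans by blast
    then show "rep p = rep q" by (simp add: rep_def)
  qed
  then have "\<forall>p q. (J \<circ> rep) p = (J \<circ> rep) q \<longleftrightarrow> deck_rel p q" by (simp add: J)
  from someI[of "\<lambda>f. \<forall>p q. f p = f q \<longleftrightarrow> deck_rel p q", OF this] show ?thesis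
    unfolding proj_def by blast
qed

lemma proj_deck [simp]: "(a, b) \<in> Lat \<Longrightarrow> proj (deck n a b q) = proj q"
  using proj_eq_iff deck_rel_def deck_rel_sym by metis

lemma proj_eqE:
  assumes "proj p = proj q" obtains n a b where "(a, b) \<in> Lat" "q = deck n a b p"
  using assms unfolding proj_eq_iff deck_rel_def by blast

lemma continuous_on_deck: "continuous_on S (deck n a b)"
  unfolding deck_def[abs_def] by (intro continuous_intros)

definition sol_space :: "real topology" where
  "sol_space = topology (\<lambda>U. U \<subseteq> range proj \<and> open (proj -` U))"

lemma openin_sol_space: "openin sol_space U \<longleftrightarrow> U \<subseteq> range proj \<and> open (proj -` U)"
proof -
  have "istopology (\<lambda>U. U \<subseteq> range proj \<and> open (proj -` U))"
    unfolding istopology_def by (auto simp: vimage_Union intro: open_Int)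
  then show ?thesis by (simp add: sol_space_def)
qed

lemma topspace_sol_space: "topspace sol_space = range proj"
proof -
  have "openin sol_space (range proj)" unfolding openin_sol_space by (simp add: vimage_def)
  moreover have "openin sol_space (topspace sol_space)" by simp
  ultimately show ?thesis using openin_sol_space openin_subset by blast
qed

lemma openin_proj_image: assumes "open U" shows "openin sol_space (proj ` U)"
proof -
  have "proj -` (proj ` U) = (\<Union>(n, a, b)\<in>{(n, a, b). (a, b) \<in> Lat}. deck n a b -` U)"
  proof (intro set_eqI iffI)
    fix q assume "q \<in> proj -` (proj ` U)"
    then obtain p where p: "p \<in> U" "proj q = proj p" by auto
    then obtain n a b where "(a, b) \<in> Lat" "p = deck n a b q" by (auto elim: proj_eqE)
    then show "q \<in> (\<Union>(n, a, b)\<in>{(n, a, b). (a, b) \<in> Lat}. deck n a b -` U)" using p(1) by auto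
  next
    fix q assume "q \<in> (\<Union>(n, a, b)\<in>{(n, a, b). (a, b) \<in> Lat}. deck n a b -` U)"
    then obtain n a b where "(a, b) \<in> Lat" "deck n a b q \<in> U" by auto
    then have "proj q \<in> proj ` U" using proj_deck by (metis imageI)
    then show "q \<in> proj -` (proj ` U)" by simp
  qed
  moreover have "open (deck n a b -` U)" for n a b
    using continuous_on_deck[of UNIV] assms by (simp add: continuous_on_open_vimage)
  ultimately show ?thesis unfolding openin_sol_space by auto
qed

lemma continuous_map_proj: "continuous_map euclidean sol_space proj"
  by (auto simp: continuous_map_def topspace_sol_space openin_sol_space vimage_def)

lemma proj_local_inj: "inj_on proj (ball p (1/2))"
proof (rule inj_onI)
  fix q r assume q: "q \<in> ball p (1/2)" and r: "r \<in> ball p (1/2)" and "proj q = proj r"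
  then obtain n a b where ab: "(a, b) \<in> Lat" and rq: "r = deck n a b q" by (auto elim: proj_eqE)
  have "dist q r \<le> dist p q + dist p r" by (metis dist_commute dist_triangle)
  then have "norm (r - q) < 1" using q r by (simp add: dist_norm norm_minus_commute)
  then have c: "\<bar>(r - q) $ i\<bar> < 1" for i using component_le_norm_cart[of "r - q" i] by linarith
  have "\<bar>of_int n * ell\<bar> < 1" using c[of 3] by (simp add: rq deck_def)
  moreover have "\<bar>of_int n\<bar> * 1 \<le> \<bar>of_int n :: real\<bar> * ell" using ell_bounds by (intro mult_left_mono) auto
  ultimately have "\<bar>of_int n :: real\<bar> < 1" using ell_bounds by (simp add: abs_mult)
  then have n: "n = 0" by linarith
  then have "\<bar>a\<bar> < 1" "\<bar>b\<bar> < 1" using c[of 1] c[of 2] by (simp_all add: rq deck_def)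
  then show "q = r" using Lat_discrete[OF ab] n rq by simp
qed

text \<open>The deck group acts properly: along convergent sequences the integers n and then the lattice
  vectors are eventually constant, by discreteness. Closedness of the orbit relation is
  what the Hausdorff property requires.\<close>

lemma deck_rel_closed:
  assumes "p \<longlonglongrightarrow> x" "q \<longlonglongrightarrow> y" and "\<And>k. deck_rel (p k) (q k)"
  shows "deck_rel x y"
proof -
  from assms(3) obtain n a b where L: "\<And>k. (a k, b k) \<in> Lat" and q: "\<And>k. q k = deck (n k) (a k) (b k) (p k)"
    unfolding deck_rel_def by metis
  have comp: "(\<lambda>k. p k $ i) \<longlonglongrightarrow> x $ i" "(\<lambda>k. q k $ i) \<longlonglongrightarrow> y $ i" for i
    by (rule tendsto_vec_nth[OF assms(1)], rule tendsto_vec_nth[OF assms(2)])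
  have late: "\<exists>N. \<forall>k\<ge>N. \<forall>m\<ge>N. \<bar>s k - s m\<bar> < 1" if "s \<longlonglongrightarrow> l" for s :: "nat \<Rightarrow> real" and l
    using LIMSEQ_imp_Cauchy[OF that] unfolding Cauchy_def dist_real_def by (meson zero_less_one)
  have "(\<lambda>k. q k $ 3 - p k $ 3) \<longlonglongrightarrow> y $ 3 - x $ 3" by (intro tendsto_diff comp)
  from late[OF this] obtain N where N: "\<And>k m. k \<ge> N \<Longrightarrow> m \<ge> N \<Longrightarrow> \<bar>(q k $ 3 - p k $ 3) - (q m $ 3 - p m $ 3)\<bar> < 1" by blast
  \<comment> \<open>Distinct integers multiplied by ell differ by more than one.\<close>
  have nN: "n k = n N" if "k \<ge> N" for k
  proof -
    have "\<bar>(of_int (n k) - of_int (n N)) * ell\<bar> < 1"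
      using N[OF that, of N] by (simp add: q deck_def algebra_simps)
    moreover have "\<bar>of_int (n k) - of_int (n N)\<bar> * 1 \<le> \<bar>of_int (n k) - of_int (n N) :: real\<bar> * ell"
      using ell_bounds by (intro mult_left_mono) auto
    ultimately have "\<bar>of_int (n k) - of_int (n N) :: real\<bar> < 1" using ell_bounds by (simp add: abs_mult)
    then show ?thesis by linarith
  qed
  define E where "E = exp (of_int (n N) * ell)"
  define E' where "E' = exp (- (of_int (n N) * ell))"
  have "(\<lambda>k. q k $ 1 - E * p k $ 1) \<longlonglongrightarrow> y $ 1 - E * x $ 1" by (intro tendsto_intros comp)
  from late[OF this] obtain N1 where N1: "\<And>k m. k \<ge> N1 \<Longrightarrow> m \<ge> N1 \<Longrightarrow> \<bar>(q k $ 1 - E * p k $ 1) - (q m $ 1 - E * p m $ 1)\<bar> < 1" by blast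
  have "(\<lambda>k. q k $ 2 - E' * p k $ 2) \<longlonglongrightarrow> y $ 2 - E' * x $ 2" by (intro tendsto_intros comp)
  from late[OF this] obtain N2 where N2: "\<And>k m. k \<ge> N2 \<Longrightarrow> m \<ge> N2 \<Longrightarrow> \<bar>(q k $ 2 - E' * p k $ 2) - (q m $ 2 - E' * p m $ 2)\<bar> < 1" by blast
  define M where "M = max N (max N1 N2)"
  have ab: "a k = a M" "b k = b M" if k: "k \<ge> M" for k
  proof -
    have n: "n k = n N" "n M = n N" using nN[of k] nN[of M] k by (simp_all add: M_def)
    have "\<bar>a k - a M\<bar> < 1" "\<bar>b k - b M\<bar> < 1"
      using N1[of k M] N2[of k M] k n by (simp_all add: M_def q deck_def E_def E'_def)
    moreover have "(a k - a M, b k - b M) \<in> Lat" using Lat_add[OF L[of k] Lat_uminus[OF L[of M]]] by simp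
    ultimately show "a k = a M" "b k = b M" using Lat_discrete[of "a k - a M" "b k - b M"] by simp_all
  qed
  have "q k = deck (n N) (a M) (b M) (p k)" if "k \<ge> M" for k
    using ab[OF that] nN[of k] that q[of k] by (simp add: M_def)
  then have "\<forall>\<^sub>F k in sequentially. deck (n N) (a M) (b M) (p k) = q k"
    unfolding eventually_sequentially by (intro exI[of _ M]) simp
  moreover have "(\<lambda>k. deck (n N) (a M) (b M) (p k)) \<longlonglongrightarrow> deck (n N) (a M) (b M) x"
    using continuous_on_tendsto_compose[OF continuous_on_deck[of UNIV] assms(1)] by simp
  ultimately have "q \<longlonglongrightarrow> deck (n N) (a M) (b M) x" by (rule Lim_transform_eventually[rotated])
  then have "y = deck (n N) (a M) (b M) x" using assms(2) LIMSEQ_unique by blast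
  then show ?thesis unfolding deck_rel_def using L by blast
qed

lemma Hausdorff_sol_space: "Hausdorff_space sol_space"
  unfolding Hausdorff_space_def topspace_sol_space
proof (intro allI impI)
  fix x y assume xy: "x \<in> range proj \<and> y \<in> range proj \<and> x \<noteq> y"
  then obtain p q where pq: "x = proj p" "y = proj q" by auto
  have "closed {u. deck_rel (fst u) (snd u)}"
    unfolding closed_sequential_limits
  proof (intro allI impI)
    fix s l assume s: "(\<forall>n. s n \<in> {u. deck_rel (fst u) (snd u)}) \<and> s \<longlonglongrightarrow> l"
    have "deck_rel (fst l) (snd l)"
      by (rule deck_rel_closed[of "\<lambda>n. fst (s n)" _ "\<lambda>n. snd (s n)"]) (use s in \<open>auto intro: tendsto_fst tendsto_snd\<close>)
    then show "l \<in> {u. deck_rel (fst u) (snd u)}" by simp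
  qed
  then have "open (- {u. deck_rel (fst u) (snd u)})" by (simp add: closed_def)
  moreover have "(p, q) \<in> - {u. deck_rel (fst u) (snd u)}" using xy pq proj_eq_iff by auto
  ultimately obtain A B where AB: "open A" "open B" "p \<in> A" "q \<in> B" "A \<times> B \<subseteq> - {u. deck_rel (fst u) (snd u)}"
    by (auto elim!: open_prod_elim)
  have "disjnt (proj ` A) (proj ` B)"
    using AB(5) by (auto simp: disjnt_def proj_eq_iff)
  then show "\<exists>U V. openin sol_space U \<and> openin sol_space V \<and> x \<in> U \<and> y \<in> V \<and> disjnt U V"
    using openin_proj_image AB pq by blast
qed

lemma compact_sol_space: "compact_space sol_space"
proof -
  have "compactin sol_space (proj ` fund_box)"
    by (rule image_compactin[OF _ continuous_map_proj]) (simp add: compact_fund_box)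
  moreover have "proj ` fund_box = topspace sol_space"
  proof -
    have "proj q \<in> proj ` fund_box" for q
      using deck_into_fund_box[of q] proj_deck by (metis imageI)
    then show ?thesis unfolding topspace_sol_space by blast
  qed
  ultimately show ?thesis by (simp add: compact_space_def)
qed

lemma connected_sol_space: "connected_space sol_space"
proof -
  have "connectedin sol_space (proj ` UNIV)"
    by (rule connectedin_continuous_map_image[OF continuous_map_proj])
      (simp add: convex_connected)
  then show ?thesis by (simp add: connectedin_topspace flip: topspace_sol_space)
qed

lemma second_countable_sol_space: "second_countable sol_space"
proof (rule second_countable_open_map_image[OF continuous_map_proj])
  show "open_map euclidean sol_space proj" unfolding open_map_def by (auto intro: openin_proj_image)
  obtain \<B> :: "(real^3) set set" where B: "countable \<B>" "topological_basis \<B>" using ex_countable_basis by blast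
  show "second_countable (euclidean :: (real^3) topology)"
    unfolding second_countable_def
    by (rule exI[of _ \<B>]) (use B in \<open>auto simp: topological_basis_open elim!: topological_basisE\<close>)
qed (simp add: topspace_sol_space)

text \<open>The charts are the inverses of the quotient map on all open sets on which it is injective.\<close>

definition sheet :: "(real^3) set \<Rightarrow> bool" where
  "sheet U \<longleftrightarrow> open U \<and> inj_on proj U"

definition sheet_chart :: "(real^3) set \<Rightarrow> (real, 3) chart" where
  "sheet_chart U = (proj ` U, inv_into U proj)"

definition sol_atlas :: "(real, 3) chart set" where
  "sol_atlas = sheet_chart ` Collect sheet"

lemma sheet_ball: "sheet (ball p (1/2))"
  by (simp add: sheet_def proj_local_inj)

lemma chart_dom_sheet [simp]: "chart_dom (sheet_chart U) = proj ` U"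
  by (simp add: sheet_chart_def)

lemma chart_map_sheet [simp]: "sheet U \<Longrightarrow> y \<in> U \<Longrightarrow> chart_map (sheet_chart U) (proj y) = y"
  by (simp add: sheet_chart_def sheet_def)

lemma chart_img_sheet [simp]: assumes "sheet U" shows "chart_img (sheet_chart U) = U"
  unfolding chart_img_def chart_dom_sheet image_image using assms by simp

lemma chart_inv_sheet [simp]:
  assumes U: "sheet U" and y: "y \<in> U" shows "chart_inv (sheet_chart U) y = proj y"
proof -
  have "inj_on (chart_map (sheet_chart U)) (proj ` U)"
    by (intro inj_onI) (use U in auto)
  then have "inv_into (proj ` U) (chart_map (sheet_chart U)) (chart_map (sheet_chart U) (proj y)) = proj y"
    using y by (intro inv_into_f_f) auto
  then show ?thesis using assms by (simp add: chart_inv_def)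
qed

lemma sol_atlasE: assumes "c \<in> sol_atlas" obtains U where "sheet U" "c = sheet_chart U"
  using assms unfolding sol_atlas_def by blast

lemma sol_atlasI: "sheet U \<Longrightarrow> sheet_chart U \<in> sol_atlas"
  unfolding sol_atlas_def by blast

definition dlin :: "int \<Rightarrow> real^3 \<Rightarrow> real^3" where
  "dlin n h = pt (exp (of_int n * ell) * h $ 1) (exp (- (of_int n * ell)) * h $ 2) (h $ 3)"

lemma deck_has_derivative: "(deck n a b has_derivative dlin n) (at q)"
proof -
  have nth: "((\<lambda>q::real^3. q $ i) has_derivative (\<lambda>h. h $ i)) (at q)" for i q
    by (intro bounded_linear_imp_has_derivative bounded_linear_vec_nth)
  show ?thesis unfolding deck_def[abs_def] dlin_def[abs_def] pt_def
    by (rule derivative_eq_intros nth refl | simp)+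
qed

lemma transition_deck:
  assumes U: "sheet U" "sheet V" and y: "y \<in> U" and ab: "(a, b) \<in> Lat" "deck n a b y \<in> V"
  shows "\<exists>T. open T \<and> y \<in> T \<and> T \<subseteq> U \<and> (\<forall>z\<in>T. transition (sheet_chart U) (sheet_chart V) z = deck n a b z)"
proof (intro exI conjI ballI)
  let ?T = "U \<inter> deck n a b -` V"
  show "open ?T"
    using U continuous_on_deck[of UNIV] by (auto simp: sheet_def continuous_on_open_vimage)
  show "transition (sheet_chart U) (sheet_chart V) z = deck n a b z" if "z \<in> ?T" for z
    using that U ab chart_map_sheet[OF U(2), of "deck n a b z"] by (simp add: transition_def)
qed (use y ab in auto)

lemma frechet_transition:
  assumes "sheet U" "sheet V" "y \<in> U" "(a, b) \<in> Lat" "deck n a b y \<in> V"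
  shows "frechet_derivative (transition (sheet_chart U) (sheet_chart V)) (at y) = dlin n"
proof -
  obtain T where T: "open T" "y \<in> T" "\<And>z. z \<in> T \<Longrightarrow> transition (sheet_chart U) (sheet_chart V) z = deck n a b z"
    using transition_deck[OF assms] by blast
  have "(transition (sheet_chart U) (sheet_chart V) has_derivative dlin n) (at y)"
    using has_derivative_transform_within_open[OF deck_has_derivative T(1,2)] T(3) by simp
  then show ?thesis using frechet_derivative_at by metis
qed

lemma common_point:
  assumes "sheet U" "sheet V" "y \<in> chart_map (sheet_chart U) ` (chart_dom (sheet_chart U) \<inter> chart_dom (sheet_chart V))"
  obtains n a b where "y \<in> U" "(a, b) \<in> Lat" "deck n a b y \<in> V"
proof -
  obtain u v where "u \<in> U" "v \<in> V" "proj u = proj v" "y = chart_map (sheet_chart U) (proj u)"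
    using assms(3) by auto
  then show thesis using that assms(1) by (metis chart_map_sheet proj_eqE)
qed

lemma Ck_on_const: "Ck_on k S (\<lambda>_. c)" for S :: "(real^'n) set"
proof (induction k arbitrary: c)
  case (Suc k)
  have "partial i (\<lambda>_. c) = (\<lambda>_. 0)" for i :: 'n
    by (simp add: partial_def fun_eq_iff)
  then show ?case using Suc by simp
qed (simp add: continuous_on_const)

lemma Ck_on_local:
  assumes "\<And>y. y \<in> S \<Longrightarrow> \<exists>T f'. open T \<and> y \<in> T \<and> (\<forall>z\<in>T. f z = f' z) \<and> Ck_on k T f'"
  shows "Ck_on k S f"
  using assms
proof (induction k arbitrary: S f)
  case 0
  have "continuous (at y within S) f" if "y \<in> S" for y
  proof -
    from 0[OF that] obtain T f' where T: "open T" "y \<in> T" "\<forall>z\<in>T. f z = f' z" "continuous_on T f'"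
      by auto
    have "continuous_on T f \<longleftrightarrow> continuous_on T f'" by (rule continuous_on_cong) (use T in auto)
    then have "continuous (at y) f" using T(1,2,4) continuous_on_eq_continuous_at by blast
    then show ?thesis by (rule continuous_at_imp_continuous_at_within)
  qed
  then show ?case by (simp add: continuous_on_eq_continuous_within)
next
  case (Suc k)
  show ?case unfolding Ck_on.simps
  proof (intro conjI ballI allI)
    fix y assume "y \<in> S"
    then obtain T f' where T: "open T" "y \<in> T" "\<forall>z\<in>T. f z = f' z" "Ck_on (Suc k) T f'" using Suc.prems by blast
    then obtain D where "(f' has_derivative D) (at y)" by (auto simp: differentiable_def)
    then have "(f has_derivative D) (at y)"
      using has_derivative_transform_within_open[of f' D y UNIV T f] T by auto
    then show "f differentiable (at y)" by (auto simp: differentiable_def)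
  next
    fix i
    show "Ck_on k S (partial i f)"
    proof (rule Suc.IH)
      fix y assume "y \<in> S"
      then obtain T f' where T: "open T" "y \<in> T" "\<forall>z\<in>T. f z = f' z" "Ck_on (Suc k) T f'" using Suc.prems by blast
      have eq: "\<forall>z\<in>T. partial i f z = partial i f' z" using T by (auto intro: partial_cong_open)
      then show "\<exists>T f'. open T \<and> y \<in> T \<and> (\<forall>z\<in>T. partial i f z = f' z) \<and> Ck_on k T f'"
        by (intro exI[of _ T] exI[of _ "partial i f'"]) (use T eq in auto)
    qed
  qed
qed

lemma Ck_on_cong:
  assumes "open S" "\<And>z. z \<in> S \<Longrightarrow> f z = f' z" "Ck_on k S f'" shows "Ck_on k S f"
  by (rule Ck_on_local) (use assms in blast)

lemma Ck_on_deck: "Ck_on k S (deck n a b)"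
proof (cases k)
  case 0 then show ?thesis by (simp add: continuous_on_deck)
next
  case (Suc m)
  have "partial i (deck n a b) = (\<lambda>_. dlin n (axis i 1))" for i
    unfolding partial_def frechet_derivative_at[OF deck_has_derivative, symmetric] ..
  moreover have "deck n a b differentiable (at y)" for y
    unfolding differentiable_def using deck_has_derivative by blast
  ultimately show ?thesis using Suc by (simp add: Ck_on_const)
qed

lemma det_dlin: "det (matrix (dlin n)) = 1"
  unfolding det_3 matrix_def
  by (simp add: dlin_def axis_def flip: exp_add)

lemma sol_oriented_atlas: "oriented_atlas sol_space sol_atlas"
  unfolding oriented_atlas_def
proof (intro conjI ballI)
  fix c assume "c \<in> sol_atlas"
  then obtain U where U: "sheet U" and c: "c = sheet_chart U" by (rule sol_atlasE)
  show "openin sol_space (chart_dom c)" using U by (simp add: c sheet_def openin_proj_image)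
  show "open (chart_img c)" using U by (simp add: c) (simp add: sheet_def)
  have "homeomorphic_maps (subtopology sol_space (proj ` U)) (top_of_set U) (chart_map c) proj"
    unfolding homeomorphic_maps_def
  proof (intro conjI ballI)
    show "continuous_map (top_of_set U) (subtopology sol_space (proj ` U)) proj"
      by (auto simp: continuous_map_in_subtopology intro: continuous_map_from_subtopology continuous_map_proj)
    show "continuous_map (subtopology sol_space (proj ` U)) (top_of_set U) (chart_map c)"
      unfolding continuous_map_def
    proof (intro conjI allI impI)
      show "chart_map c \<in> topspace (subtopology sol_space (proj ` U)) \<rightarrow> topspace (top_of_set U)"
        using U by (auto simp: c topspace_subtopology)
      fix W assume "openin (top_of_set U) W"
      then have W: "open W" "W \<subseteq> U" using U by (auto simp: openin_open sheet_def)
      have "{x \<in> topspace (subtopology sol_space (proj ` U)). chart_map c x \<in> W} = proj ` W"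
        using W U by (auto simp: c topspace_subtopology topspace_sol_space subset_eq)
      moreover have "openin (subtopology sol_space (proj ` U)) (proj ` W)"
        unfolding openin_subtopology using openin_proj_image[OF W(1)] W(2) by blast
      ultimately show "openin (subtopology sol_space (proj ` U)) {x \<in> topspace (subtopology sol_space (proj ` U)). chart_map c x \<in> W}"
        by simp
    qed
  qed (use U in \<open>auto simp: c topspace_subtopology\<close>)
  then show "homeomorphic_map (subtopology sol_space (chart_dom c)) (top_of_set (chart_img c)) (chart_map c)"
    using U by (auto simp: c homeomorphic_map_maps)
next
  have "proj y \<in> (\<Union>c\<in>sol_atlas. chart_dom c)" for y
    by (rule UN_I[OF sol_atlasI[OF sheet_ball[of y]]]) simp
  moreover have "(\<Union>c\<in>sol_atlas. chart_dom c) \<subseteq> range proj" by (auto elim!: sol_atlasE)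
  ultimately show "(\<Union>c\<in>sol_atlas. chart_dom c) = topspace sol_space" unfolding topspace_sol_space by auto
next
  fix c d assume "c \<in> sol_atlas" "d \<in> sol_atlas"
  then obtain U V where U: "sheet U" "sheet V" and cd: "c = sheet_chart U" "d = sheet_chart V" by (auto elim!: sol_atlasE)
  show "smooth_on (chart_map c ` (chart_dom c \<inter> chart_dom d)) (transition c d)"
    unfolding smooth_on_def
  proof
    fix k
    show "Ck_on k (chart_map c ` (chart_dom c \<inter> chart_dom d)) (transition c d)"
    proof (rule Ck_on_local)
      fix y assume "y \<in> chart_map c ` (chart_dom c \<inter> chart_dom d)"
      then obtain n a b where "y \<in> U" "(a, b) \<in> Lat" "deck n a b y \<in> V"
        unfolding cd by (rule common_point[OF U])
      from transition_deck[OF U this]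
      show "\<exists>T f'. open T \<and> y \<in> T \<and> (\<forall>z\<in>T. transition c d z = f' z) \<and> Ck_on k T f'"
        unfolding cd using Ck_on_deck by blast
    qed
  qed
  fix y assume "y \<in> chart_map c ` (chart_dom c \<inter> chart_dom d)"
  then obtain n a b where "y \<in> U" "(a, b) \<in> Lat" "deck n a b y \<in> V"
    unfolding cd by (rule common_point[OF U])
  from frechet_transition[OF U this] show "det (matrix (frechet_derivative (transition c d) (at y))) > 0"
    by (simp add: cd det_dlin)
qed

lemma sol_closed_oriented_manifold: "closed_oriented_manifold sol_space sol_atlas"
  unfolding closed_oriented_manifold_def
  using connected_sol_space compact_sol_space Hausdorff_sol_space second_countable_sol_space sol_oriented_atlas
  by (simp add: topspace_sol_space)

section \<open>The Sol metric\<close>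

definition sol_form :: "real^3 \<Rightarrow> real^3 \<Rightarrow> real^3 \<Rightarrow> real" where
  "sol_form y \<xi> \<eta> = exp (- 2 * y $ 3) * \<xi> $ 1 * \<eta> $ 1 + exp (2 * y $ 3) * \<xi> $ 2 * \<eta> $ 2 + \<xi> $ 3 * \<eta> $ 3"

lemma sol_form_deck: "sol_form (deck n a b y) (dlin n \<xi>) (dlin n \<eta>) = sol_form y \<xi> \<eta>"
proof -
  have e: "exp (- 2 * (y $ 3 + of_int n * ell)) * exp (of_int n * ell) * exp (of_int n * ell) = exp (- 2 * y $ 3)"
    "exp (2 * (y $ 3 + of_int n * ell)) * exp (- (of_int n * ell)) * exp (- (of_int n * ell)) = exp (2 * y $ 3)"
    by (simp_all add: algebra_simps flip: exp_add)
  have "sol_form (deck n a b y) (dlin n \<xi>) (dlin n \<eta>) =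
     (exp (- 2 * (y $ 3 + of_int n * ell)) * exp (of_int n * ell) * exp (of_int n * ell)) * \<xi> $ 1 * \<eta> $ 1 +
     (exp (2 * (y $ 3 + of_int n * ell)) * exp (- (of_int n * ell)) * exp (- (of_int n * ell))) * \<xi> $ 2 * \<eta> $ 2 + \<xi> $ 3 * \<eta> $ 3"
    unfolding sol_form_def deck_def dlin_def pt_nth by (simp only: mult_ac)
  then show ?thesis unfolding e sol_form_def .
qed

text \<open>The scalar product is evaluated in an arbitrary chart around the point; deck
  transformations are isometries of the form on the cover, so the choice is irrelevant.\<close>

definition sol_metric :: "(real, 3) metric" where
  "sol_metric x \<xi> \<eta> = (let c = (SOME c. c \<in> sol_atlas \<and> x \<in> chart_dom c) in
     sol_form (chart_map c x) (\<xi> c) (\<eta> c))"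

lemma tangent_transport:
  assumes \<xi>: "\<xi> \<in> tangent_space sol_atlas (proj y)" and U: "sheet U" "sheet V" "y \<in> U" "(a, b) \<in> Lat" "deck n a b y \<in> V"
  shows "\<xi> (sheet_chart V) = dlin n (\<xi> (sheet_chart U))"
proof -
  have "proj y \<in> proj ` V" using U(4,5) by (metis imageI proj_deck)
  then have dom: "proj y \<in> chart_dom (sheet_chart U) \<inter> chart_dom (sheet_chart V)" using U(3) by simp
  have "\<forall>c\<in>sol_atlas. \<forall>d\<in>sol_atlas. proj y \<in> chart_dom c \<inter> chart_dom d \<longrightarrow>
      \<xi> d = frechet_derivative (transition c d) (at (chart_map c (proj y))) (\<xi> c)"
    using \<xi> unfolding tangent_space_def by blast
  from this[rule_format, OF sol_atlasI[OF U(1)] sol_atlasI[OF U(2)] dom]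
  have "\<xi> (sheet_chart V) = frechet_derivative (transition (sheet_chart U) (sheet_chart V)) (at (chart_map (sheet_chart U) (proj y))) (\<xi> (sheet_chart U))" .
  then show ?thesis using U frechet_transition[OF U] by simp
qed

lemma chosen_chart:
  obtains V n a b where "sheet V" "(SOME c. c \<in> sol_atlas \<and> proj y \<in> chart_dom c) = sheet_chart V"
    "(a, b) \<in> Lat" "deck n a b y \<in> V" "chart_map (sheet_chart V) (proj y) = deck n a b y"
proof -
  let ?c = "SOME c. c \<in> sol_atlas \<and> proj y \<in> chart_dom c"
  have "sheet_chart (ball y (1/2)) \<in> sol_atlas \<and> proj y \<in> chart_dom (sheet_chart (ball y (1/2)))"
    using sol_atlasI[OF sheet_ball] by simp
  then have c: "?c \<in> sol_atlas \<and> proj y \<in> chart_dom ?c" by (rule someI)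
  then obtain V where V: "sheet V" "?c = sheet_chart V" by (blast elim: sol_atlasE)
  have "proj y \<in> proj ` V" using c unfolding V(2) by simp
  then obtain v where v: "v \<in> V" "proj y = proj v" by blast
  then obtain n a b where ab: "(a, b) \<in> Lat" "v = deck n a b y" by (auto elim: proj_eqE)
  show thesis
    by (rule that[OF V ab(1)]) (use v ab chart_map_sheet[OF V(1) v(1)] in auto)
qed

lemma coord_vector_sheet:
  assumes "sheet U" "sheet V" "y \<in> U" "(a, b) \<in> Lat" "deck n a b y \<in> V"
  shows "coord_vector sol_atlas (sheet_chart U) i (proj y) (sheet_chart V) = dlin n (axis i 1)"
proof -
  have "proj y \<in> proj ` V" using assms(4,5) by (metis imageI proj_deck)
  then show ?thesis
    using assms frechet_transition[OF assms] sol_atlasI by (simp add: coord_vector_def partial_def)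
qed

definition sol_matrix :: "real^3 \<Rightarrow> real^3^3" where
  "sol_matrix y = (\<chi> i j. if i = j then (if i = 1 then exp (- 2 * y $ 3) else if i = 2 then exp (2 * y $ 3) else 1) else 0)"

lemma sol_form_axis: "sol_form y (axis i 1) (axis j 1) = sol_matrix y $ i $ j"
  using exhaust_3[of i] exhaust_3[of j] by (auto simp: sol_form_def sol_matrix_def axis_def)

lemma metric_loc_sheet:
  assumes "sheet U" "y \<in> U"
  shows "metric_loc sol_atlas sol_metric (sheet_chart U) y = sol_matrix y"
proof -
  obtain V n a b where V: "sheet V" "(SOME c. c \<in> sol_atlas \<and> proj y \<in> chart_dom c) = sheet_chart V"
    "(a, b) \<in> Lat" "deck n a b y \<in> V" "chart_map (sheet_chart V) (proj y) = deck n a b y" by (rule chosen_chart)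
  show ?thesis
    unfolding metric_loc_def chart_inv_sheet[OF assms] sol_metric_def Let_def V(2,5)
      coord_vector_sheet[OF assms(1) V(1) assms(2) V(3,4)] sol_form_deck sol_form_axis
    by (simp add: vec_eq_iff)
qed

lemma Ck_on_exp_matrix:
  "Ck_on k S (\<lambda>y :: real^3. exp (- 2 * y $ 3) *\<^sub>R M1 + exp (2 * y $ 3) *\<^sub>R M2 + M3)"
  for M1 M2 M3 :: "real^3^3"
proof (induction k arbitrary: M1 M2 M3)
  case 0 then show ?case by (simp, intro continuous_intros)
next
  case (Suc k)
  have nth: "((\<lambda>q::real^3. q $ i) has_derivative (\<lambda>h. h $ i)) (at q)" for i q
    by (intro bounded_linear_imp_has_derivative bounded_linear_vec_nth)
  have d: "((\<lambda>y :: real^3. exp (- 2 * y $ 3) *\<^sub>R M1 + exp (2 * y $ 3) *\<^sub>R M2 + M3) has_derivative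
      (\<lambda>h. exp (- 2 * y $ 3) *\<^sub>R ((- 2 * h $ 3) *\<^sub>R M1) + exp (2 * y $ 3) *\<^sub>R ((2 * h $ 3) *\<^sub>R M2) + 0)) (at y)" for y
    by (rule derivative_eq_intros nth refl | simp add: mult_ac)+
  have p: "partial i (\<lambda>y :: real^3. exp (- 2 * y $ 3) *\<^sub>R M1 + exp (2 * y $ 3) *\<^sub>R M2 + M3) =
     (\<lambda>y. exp (- 2 * y $ 3) *\<^sub>R ((- 2 * axis i 1 $ 3) *\<^sub>R M1) + exp (2 * y $ 3) *\<^sub>R ((2 * axis i 1 $ 3) *\<^sub>R M2) + 0)" for i
    unfolding partial_def frechet_derivative_at[OF d, symmetric] ..
  show ?case unfolding Ck_on.simps p
    using d by (intro conjI ballI allI Suc.IH) (unfold differentiable_def, blast)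
qed

lemma sol_matrix_smooth: "Ck_on k S sol_matrix"
proof -
  have eq: "sol_matrix = (\<lambda>y. exp (- 2 * y $ 3) *\<^sub>R (\<chi> i j. if i = j \<and> i = 1 then 1 else 0)
      + exp (2 * y $ 3) *\<^sub>R (\<chi> i j. if i = j \<and> i = 2 then 1 else 0) + (\<chi> i j. if i = j \<and> i = 3 then 1 else 0))"
    by (rule ext) (simp add: vec_eq_iff forall_3 sol_matrix_def)
  show ?thesis unfolding eq by (rule Ck_on_exp_matrix)
qed

lemma sol_smooth_riemannian_metric: "smooth_riemannian_metric sol_space sol_atlas sol_metric"
  unfolding smooth_riemannian_metric_def
proof (intro conjI ballI allI impI)
  fix x \<xi> \<eta> \<zeta> and a b :: real
  show "sol_metric x \<xi> \<eta> = sol_metric x \<eta> \<xi>" by (simp add: sol_metric_def Let_def sol_form_def mult_ac)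
  show "sol_metric x (\<lambda>c. a *\<^sub>R \<xi> c + b *\<^sub>R \<eta> c) \<zeta> = a * sol_metric x \<xi> \<zeta> + b * sol_metric x \<eta> \<zeta>"
    by (simp add: sol_metric_def Let_def sol_form_def algebra_simps)
  assume x: "x \<in> topspace sol_space" and \<xi>: "\<xi> \<in> tangent_space sol_atlas x" and nz: "\<xi> \<noteq> (\<lambda>c. 0)"
  obtain y where y: "x = proj y" using x by (auto simp: topspace_sol_space)
  obtain V n a b where V: "sheet V" "(SOME c. c \<in> sol_atlas \<and> proj y \<in> chart_dom c) = sheet_chart V"
    "(a, b) \<in> Lat" "deck n a b y \<in> V" "chart_map (sheet_chart V) (proj y) = deck n a b y" by (rule chosen_chart)
  define z where "z = deck n a b y"
  have z: "proj y = proj z" "z \<in> V" using V by (simp_all add: z_def)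
  have "\<xi> (sheet_chart V) \<noteq> 0"
  proof
    assume zero: "\<xi> (sheet_chart V) = 0"
    have "\<xi> c = 0" for c
    proof (cases "c \<in> sol_atlas \<and> x \<in> chart_dom c")
      case True
      then obtain U where U: "sheet U" "c = sheet_chart U" "proj z \<in> proj ` U" using y z by (auto elim!: sol_atlasE)
      then obtain u where "u \<in> U" "proj z = proj u" by blast
      then obtain m a' b' where "(a', b') \<in> Lat" "deck m a' b' z \<in> U" by (auto elim: proj_eqE)
      then have "\<xi> c = dlin m (\<xi> (sheet_chart V))"
        using tangent_transport[of \<xi> z V U] \<xi> y z V(1) U by simp
      then show ?thesis by (simp add: zero dlin_def vec3_eq_iff)
    next
      case False
      then show ?thesis using \<xi> unfolding tangent_space_def by blast
    qed
    then show False using nz by blast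
  qed
  then obtain h where h: "h = \<xi> (sheet_chart V)" "h $ 1 \<noteq> 0 \<or> h $ 2 \<noteq> 0 \<or> h $ 3 \<noteq> 0" by (auto simp: vec3_eq_iff)
  have "sol_metric x \<xi> \<xi> = exp (- 2 * z $ 3) * (h $ 1)\<^sup>2 + exp (2 * z $ 3) * (h $ 2)\<^sup>2 + (h $ 3)\<^sup>2"
    unfolding sol_metric_def Let_def y V(2,5) sol_form_def z_def h(1) by (simp add: power2_eq_square)
  moreover have "\<dots> > 0"
  proof -
    have nn: "0 \<le> exp (- 2 * z $ 3) * (h $ 1)\<^sup>2" "0 \<le> exp (2 * z $ 3) * (h $ 2)\<^sup>2" "0 \<le> (h $ 3)\<^sup>2" by simp_all
    have "0 < exp (- 2 * z $ 3) * (h $ 1)\<^sup>2 \<or> 0 < exp (2 * z $ 3) * (h $ 2)\<^sup>2 \<or> 0 < (h $ 3)\<^sup>2" using h(2) by auto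
    with nn show ?thesis by linarith
  qed
  ultimately show "sol_metric x \<xi> \<xi> > 0" by simp
next
  fix c assume "c \<in> sol_atlas"
  then obtain U where U: "sheet U" "c = sheet_chart U" by (rule sol_atlasE)
  have "Ck_on k U (metric_loc sol_atlas sol_metric c)" for k
    by (rule Ck_on_cong[OF _ _ sol_matrix_smooth]) (use U in \<open>auto simp: metric_loc_sheet sheet_def\<close>)
  then show "smooth_on (chart_img c) (metric_loc sol_atlas sol_metric c)" using U by (simp add: smooth_on_def)
qed

lemma partial_C1_grad: assumes "C1_grad u u'" shows "partial i u q = u' q $ i"
proof -
  have "(u has_derivative (\<lambda>h. u' q \<bullet> h)) (at q)" using assms by (simp add: C1_grad_def)
  from frechet_derivative_at[OF this, symmetric] show ?thesis by (simp add: partial_def inner_axis)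
qed

lemma partial_sol_matrix:
  "partial l (\<lambda>z. sol_matrix z $ i $ j) y =
     (if i = j \<and> l = 3 then (if i = 1 then - 2 * exp (- 2 * y $ 3) else if i = 2 then 2 * exp (2 * y $ 3) else 0) else 0)"
proof -
  have const: "partial l (\<lambda>z::real^3. c) y = 0" for c :: real by (simp add: partial_def)
  have e: "partial l (\<lambda>z. exp (c * z $ 3)) y = (if l = 3 then c * exp (c * y $ 3) else 0)" for c :: real
    unfolding partial_C1_grad[OF C1_grad_exp3] by (simp add: axis_def)
  show ?thesis
  proof (cases "i = j")
    case True
    then show ?thesis using exhaust_3[of j] const e[of 2] e[of "- 2"] by (elim disjE) (auto simp: sol_matrix_def)
  next
    case False
    then show ?thesis using const by (simp add: sol_matrix_def)
  qed
qed

definition sol_matrix_inv :: "real^3 \<Rightarrow> real^3^3" where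
  "sol_matrix_inv y = (\<chi> i j. if i = j then (if i = 1 then exp (2 * y $ 3) else if i = 2 then exp (- 2 * y $ 3) else 1) else 0)"

lemma matrix_inv_sol_matrix: "matrix_inv (sol_matrix y) = sol_matrix_inv y"
proof -
  have e: "exp (2 * y $ 3) * exp (- (2 * y $ 3)) = 1" "exp (- (2 * y $ 3)) * exp (2 * y $ 3) = 1" by (simp_all flip: exp_add)
  have 1: "sol_matrix y ** sol_matrix_inv y = mat 1" "sol_matrix_inv y ** sol_matrix y = mat 1"
    by (simp_all add: vec_eq_iff forall_3 matrix_matrix_mult_def sum_3 mat_def sol_matrix_def sol_matrix_inv_def e)
  then have "invertible (sol_matrix y)" unfolding invertible_def by blast
  then have "matrix_inv (sol_matrix y) ** sol_matrix y = mat 1"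
    unfolding matrix_inv_def invertible_def by (rule someI2_ex) blast
  then have "matrix_inv (sol_matrix y) ** (sol_matrix y ** sol_matrix_inv y) = sol_matrix_inv y"
    by (simp add: matrix_mul_assoc)
  then show ?thesis by (simp add: 1)
qed

lemma christoffel_sol:
  "christoffel sol_matrix k i j y =
     (if k = 1 \<and> (i = 1 \<and> j = 3 \<or> i = 3 \<and> j = 1) then - 1
      else if k = 2 \<and> (i = 2 \<and> j = 3 \<or> i = 3 \<and> j = 2) then 1
      else if k = 3 \<and> i = 1 \<and> j = 1 then exp (- 2 * y $ 3)
      else if k = 3 \<and> i = 2 \<and> j = 2 then - exp (2 * y $ 3) else 0)"
proof -
  have e: "exp (2 * y $ 3) * exp (- (2 * y $ 3)) = 1" "exp (- (2 * y $ 3)) * exp (2 * y $ 3) = 1" by (simp_all flip: exp_add)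
  show ?thesis
    unfolding christoffel_def matrix_inv_sol_matrix partial_sol_matrix sum_3
    using exhaust_3[of k] exhaust_3[of i] exhaust_3[of j]
    by (elim disjE) (simp_all add: sol_matrix_inv_def e)
qed

lemma frechet_cong_open:
  assumes "open S" "y \<in> S" "\<And>z. z \<in> S \<Longrightarrow> f z = f' z"
  shows "frechet_derivative f (at y) = frechet_derivative f' (at y)"
proof -
  have "(f has_derivative D) (at y) \<longleftrightarrow> (f' has_derivative D) (at y)" for D
    using has_derivative_transform_within_open[of f D y UNIV S f']
      has_derivative_transform_within_open[of f' D y UNIV S f] assms by auto
  then show ?thesis by (simp add: frechet_derivative_def)
qed

lemma frechet_partial:
  fixes W :: "real^3 \<Rightarrow> 'b::real_normed_vector"
  assumes "W differentiable (at y)"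
  shows "frechet_derivative W (at y) h = h $ 1 *\<^sub>R partial 1 W y + h $ 2 *\<^sub>R partial 2 W y + h $ 3 *\<^sub>R partial 3 W y"
proof -
  have "(W has_derivative frechet_derivative W (at y)) (at y)" using assms frechet_derivative_works by blast
  then interpret linear "frechet_derivative W (at y)" by (rule has_derivative_linear)
  have "frechet_derivative W (at y) (h $ 1 *\<^sub>R e1 + h $ 2 *\<^sub>R e2 + h $ 3 *\<^sub>R e3) = h $ 1 *\<^sub>R partial 1 W y + h $ 2 *\<^sub>R partial 2 W y + h $ 3 *\<^sub>R partial 3 W y"
    by (simp add: add scale partial_def)
  then show ?thesis using pt_collapse[of h] by (simp add: pt_def)
qed

text \<open>In every chart the operators of the Euler equations are those of the Sol metric in the standard
  coordinates of the cover; the divergence is the Euclidean one, as the volume form is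
  dx dy dz.\<close>

lemma local_operators:
  assumes U: "sheet U" "y \<in> U" and w: "\<And>z. z \<in> U \<Longrightarrow> w z = W z" and W: "W differentiable (at y)"
    and P: "\<And>z. z \<in> U \<Longrightarrow> pp z = P z"
  defines "G \<equiv> metric_loc sol_atlas sol_metric (sheet_chart U)"
  shows "cov_deriv G (w y) w y = pt
       (partial 1 W y $ 1 * W y $ 1 + partial 2 W y $ 1 * W y $ 2 + partial 3 W y $ 1 * W y $ 3 - 2 * W y $ 1 * W y $ 3)
       (partial 1 W y $ 2 * W y $ 1 + partial 2 W y $ 2 * W y $ 2 + partial 3 W y $ 2 * W y $ 3 + 2 * W y $ 2 * W y $ 3)
       (partial 1 W y $ 3 * W y $ 1 + partial 2 W y $ 3 * W y $ 2 + partial 3 W y $ 3 * W y $ 3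
          + exp (- 2 * y $ 3) * (W y $ 1)\<^sup>2 - exp (2 * y $ 3) * (W y $ 2)\<^sup>2)" (is ?cov)
    and "divergence G w y = partial 1 W y $ 1 + partial 2 W y $ 2 + partial 3 W y $ 3" (is ?div)
    and "gradient G pp y = pt (exp (2 * y $ 3) * partial 1 P y) (exp (- 2 * y $ 3) * partial 2 P y) (partial 3 P y)" (is ?grad)
proof -
  have oU: "open U" using U by (simp add: sheet_def)
  have G: "G z = sol_matrix z" if "z \<in> U" for z unfolding G_def by (rule metric_loc_sheet[OF U(1) that])
  have chr: "christoffel G k i j y = christoffel sol_matrix k i j y" for k i j
  proof -
    have "partial l (\<lambda>z. G z $ i $ j) y = partial l (\<lambda>z. sol_matrix z $ i $ j) y" for l i j
      by (rule partial_cong_open[OF oU U(2)]) (simp add: G)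
    then show ?thesis unfolding christoffel_def G[OF U(2)] by simp
  qed
  have fr: "frechet_derivative w (at y) h = h $ 1 *\<^sub>R partial 1 W y + h $ 2 *\<^sub>R partial 2 W y + h $ 3 *\<^sub>R partial 3 W y" for h
    using frechet_cong_open[OF oU U(2) w] frechet_partial[OF W] by simp
  have cov: "cov_deriv G u w y = pt
     (u $ 1 * partial 1 W y $ 1 + u $ 2 * partial 2 W y $ 1 + u $ 3 * partial 3 W y $ 1 - u $ 1 * W y $ 3 - u $ 3 * W y $ 1)
     (u $ 1 * partial 1 W y $ 2 + u $ 2 * partial 2 W y $ 2 + u $ 3 * partial 3 W y $ 2 + u $ 2 * W y $ 3 + u $ 3 * W y $ 2)
     (u $ 1 * partial 1 W y $ 3 + u $ 2 * partial 2 W y $ 3 + u $ 3 * partial 3 W y $ 3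
       + exp (- 2 * y $ 3) * u $ 1 * W y $ 1 - exp (2 * y $ 3) * u $ 2 * W y $ 2)" for u
    unfolding cov_deriv_def chr fr w[OF U(2)] vec3_eq_iff
    by (simp add: sum_3 christoffel_sol)
  show ?cov
    unfolding cov w[OF U(2)] vec3_eq_iff by (simp add: algebra_simps power2_eq_square)
  show ?div
    unfolding divergence_def cov sum_3 by simp
  have "partial l pp y = partial l P y" for l by (rule partial_cong_open[OF oU U(2) P])
  then show ?grad
    unfolding gradient_def G[OF U(2)] matrix_inv_sol_matrix vec3_eq_iff
    by (simp add: matrix_vector_mult_def sum_3 sol_matrix_inv_def)
qed

section \<open>The suspension flow is isolated\<close>

definition vertical_field :: "real \<Rightarrow> (real, 3) tangent" where
  "vertical_field = (\<lambda>x\<in>topspace sol_space. \<lambda>c. if c \<in> sol_atlas \<and> x \<in> chart_dom c then e3 else 0)"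

lemma dlin_e3 [simp]: "dlin n e3 = e3"
  by (simp add: dlin_def vec3_eq_iff)

lemma field_loc_vertical:
  assumes "sheet U" "y \<in> U" shows "field_loc (sheet_chart U) vertical_field y = e3"
  using assms sol_atlasI by (simp add: field_loc_def vertical_field_def topspace_sol_space)

lemma smooth_vertical_field: "smooth_vector_field sol_space sol_atlas vertical_field"
  unfolding smooth_vector_field_def Ck_vector_field_def
proof (intro allI conjI ballI)
  show "vertical_field \<in> (\<Pi>\<^sub>E x\<in>topspace sol_space. tangent_space sol_atlas x)"
    unfolding vertical_field_def
  proof (rule restrict_PiE_iff[THEN iffD2], intro ballI)
    fix x assume "x \<in> topspace sol_space"
    show "(\<lambda>c. if c \<in> sol_atlas \<and> x \<in> chart_dom c then e3 else 0) \<in> tangent_space sol_atlas x"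
      unfolding tangent_space_def
    proof (intro CollectI conjI allI impI ballI)
      fix c d assume c: "c \<in> sol_atlas" and d: "d \<in> sol_atlas" and x: "x \<in> chart_dom c \<inter> chart_dom d"
      obtain U V where UV: "sheet U" "sheet V" "c = sheet_chart U" "d = sheet_chart V" using c d by (auto elim!: sol_atlasE)
      obtain u v where u: "u \<in> U" "v \<in> V" "x = proj u" "proj u = proj v" using x UV by auto
      from u(4) obtain n a b where ab: "(a, b) \<in> Lat" "v = deck n a b u" by (rule proj_eqE)
      have "deck n a b u \<in> V" using u(2) ab(2) by simp
      then have "frechet_derivative (transition c d) (at (chart_map c x)) = dlin n"
        unfolding UV(3,4) u(3) chart_map_sheet[OF UV(1) u(1)] by (rule frechet_transition[OF UV(1,2) u(1) ab(1)])
      then show "(if d \<in> sol_atlas \<and> x \<in> chart_dom d then e3 else 0) =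
         frechet_derivative (transition c d) (at (chart_map c x)) (if c \<in> sol_atlas \<and> x \<in> chart_dom c then e3 else 0)"
        using IntD1[OF x] IntD2[OF x] c d by simp
    qed auto
  qed
  fix k c assume "c \<in> sol_atlas"
  then obtain U where U: "sheet U" "c = sheet_chart U" by (rule sol_atlasE)
  have "Ck_on k U (field_loc c vertical_field)"
    by (rule Ck_on_cong[OF _ _ Ck_on_const[of _ _ e3]]) (use U in \<open>auto simp: field_loc_vertical sheet_def\<close>)
  then show "Ck_on k (chart_img c) (field_loc c vertical_field)" using U by simp
qed

lemma partial_const [simp]: "partial i (\<lambda>_. c) y = 0"
  by (simp add: partial_def)

lemma steady_vertical_field: "steady_euler sol_space sol_atlas sol_metric vertical_field"
  unfolding steady_euler_def
proof (intro conjI exI[of _ "\<lambda>_. 0"] ballI)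
  show "Ck_vector_field 1 sol_space sol_atlas vertical_field"
    using smooth_vertical_field by (simp add: smooth_vector_field_def)
  show "Ck_function 1 sol_atlas (\<lambda>_. 0)"
    unfolding Ck_function_def o_def by (intro ballI Ck_on_const)
  fix c y assume "c \<in> sol_atlas" and y: "y \<in> chart_img c"
  from \<open>c \<in> sol_atlas\<close> obtain U where U: "sheet U" "c = sheet_chart U" by (rule sol_atlasE)
  have yU: "y \<in> U" using U y by simp
  let ?w = "field_loc (sheet_chart U) vertical_field" and ?p = "(\<lambda>_. 0 :: real) \<circ> chart_inv (sheet_chart U)"
  have w: "?w z = e3" if "z \<in> U" for z
    using field_loc_vertical[OF U(1) that] .
  note l = local_operators[OF U(1) yU, of ?w "\<lambda>_. e3" ?p "\<lambda>_. 0", simplified, OF w]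
  show "cov_deriv (metric_loc sol_atlas sol_metric c) (field_loc c vertical_field y) (field_loc c vertical_field) y =
          - gradient (metric_loc sol_atlas sol_metric c) ((\<lambda>_. 0) \<circ> chart_inv c) y"
    unfolding U(2) using l by (simp add: vec3_eq_iff o_def)
  show "divergence (metric_loc sol_atlas sol_metric c) (field_loc c vertical_field) y = 0"
    unfolding U(2) using l by simp
qed

lemma C1_grad_of_Ck:
  assumes f: "Ck_on 1 UNIV f" and T: "bounded_linear T"
  shows "C1_grad (\<lambda>q. T (f q)) (\<lambda>q. \<chi> i. T (partial i f q))"
  unfolding C1_grad_def
proof (intro conjI allI)
  have d: "f differentiable (at q)" and c: "continuous_on UNIV (partial i f)" for q i
    using f by (simp_all add: numeral_eq_Suc)
  show "continuous_on UNIV (\<lambda>q. \<chi> i. T (partial i f q))"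
    by (intro continuous_on_vec_lambda bounded_linear.continuous_on[OF T] c)
  fix q
  interpret T: bounded_linear T by (rule T)
  have "(f has_derivative frechet_derivative f (at q)) (at q)" using d frechet_derivative_works by blast
  from bounded_linear.has_derivative[OF T this]
  show "((\<lambda>q. T (f q)) has_derivative (\<lambda>h. (\<chi> i. T (partial i f q)) \<bullet> h)) (at q)"
    by (rule has_derivative_eq_rhs) (simp add: fun_eq_iff frechet_partial[OF d] T.add T.scale inner_3 mult_ac)
qed

text \<open>The coordinate representation of a field on the universal cover. The chart chosen around the point
  has no influence, because two sheets through the same point differ there by the identity.\<close>

definition lift_field :: "(real \<Rightarrow> (real, 3) tangent) \<Rightarrow> real^3 \<Rightarrow> real^3" where
  "lift_field v y = v (proj y) (sheet_chart (ball y (1/2)))"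

context
  fixes v :: "real \<Rightarrow> (real, 3) tangent"
  assumes v: "Ck_vector_field 1 sol_space sol_atlas v"
begin

lemma field_tangent: "v (proj y) \<in> tangent_space sol_atlas (proj y)"
  using v unfolding Ck_vector_field_def by (auto simp: topspace_sol_space)

lemma lift_deck: "(a, b) \<in> Lat \<Longrightarrow> lift_field v (deck n a b y) = dlin n (lift_field v y)"
  using tangent_transport[OF field_tangent[of y] sheet_ball sheet_ball, of y a b n "deck n a b y"]
  by (simp add: lift_field_def)

lemma field_loc_lift:
  assumes "sheet U" "y \<in> U" shows "field_loc (sheet_chart U) v y = lift_field v y"
proof -
  have "v (proj y) (sheet_chart U) = dlin 0 (lift_field v y)"
    unfolding lift_field_def
    by (rule tangent_transport[OF field_tangent sheet_ball assms(1), where a = 0 and b = 0]) (use assms in auto)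
  also have "\<dots> = lift_field v y" by (simp add: dlin_def)
  finally show ?thesis using assms by (simp add: field_loc_def)
qed

lemma lift_C1: "Ck_on 1 UNIV (lift_field v)"
proof (rule Ck_on_local)
  fix y :: "real^3"
  let ?U = "ball y (1/2)"
  have "Ck_on 1 (chart_img (sheet_chart ?U)) (field_loc (sheet_chart ?U) v)"
    using v sol_atlasI[OF sheet_ball] unfolding Ck_vector_field_def by blast
  then have "Ck_on 1 ?U (field_loc (sheet_chart ?U) v)" by (simp only: chart_img_sheet[OF sheet_ball])
  then show "\<exists>T f'. open T \<and> y \<in> T \<and> (\<forall>z\<in>T. lift_field v z = f' z) \<and> Ck_on 1 T f'"
    by (intro exI[of _ ?U] exI[of _ "field_loc (sheet_chart ?U) v"]) (simp add: field_loc_lift[OF sheet_ball])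
qed

lemma lift_vertical_imp_scale:
  assumes c: "\<And>q. lift_field v q = c *\<^sub>R e3"
  shows "v = scale_field sol_space c vertical_field"
proof (rule ext)
  fix x
  show "v x = scale_field sol_space c vertical_field x"
  proof (cases "x \<in> topspace sol_space")
    case True
    have "v x d = c *\<^sub>R vertical_field x d" for d
    proof (cases "d \<in> sol_atlas \<and> x \<in> chart_dom d")
      case d: True
      then obtain U where U: "sheet U" "d = sheet_chart U" by (auto elim: sol_atlasE)
      then obtain u where u: "u \<in> U" "x = proj u" using d by auto
      have "v x d = lift_field v u"
        using field_loc_lift[OF U(1) u(1)] U u by (simp add: field_loc_def)
      then show ?thesis using d True by (simp add: c vertical_field_def)
    next
      case False
      moreover from this have "v x d = 0"
        using True field_tangent unfolding topspace_sol_space tangent_space_def by blast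
      ultimately show ?thesis using True by (auto simp: vertical_field_def)
    qed
    then show ?thesis using True by (simp add: scale_field_def fun_eq_iff)
  next
    case False
    then show ?thesis
      using PiE_arb[OF conjunct1[OF v[unfolded Ck_vector_field_def]] False] by (simp add: scale_field_def)
  qed
qed

lemma steady_lift_rigid:
  assumes steady: "steady_euler sol_space sol_atlas sol_metric v"
    and near: "\<And>q. q \<in> fund_box \<Longrightarrow> norm (lift_field v q - e3) \<le> 1 / 1000"
      "\<And>q i. q \<in> fund_box \<Longrightarrow> norm (partial i (lift_field v) q) \<le> 1 / 1000"
  shows "\<exists>c>0. \<forall>q. lift_field v q = c *\<^sub>R e3"
proof -
  obtain p where p: "Ck_function 1 sol_atlas p" and euler: "\<And>c y. c \<in> sol_atlas \<Longrightarrow> y \<in> chart_img c \<Longrightarrow>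
      cov_deriv (metric_loc sol_atlas sol_metric c) (field_loc c v y) (field_loc c v) y =
        - gradient (metric_loc sol_atlas sol_metric c) (p \<circ> chart_inv c) y \<and>
      divergence (metric_loc sol_atlas sol_metric c) (field_loc c v) y = 0"
    using steady unfolding steady_euler_def by blast
  define W where "W = lift_field v"
  define P where "P q = p (proj q)" for q
  have PC1: "Ck_on 1 UNIV P"
  proof (rule Ck_on_local)
    fix y :: "real^3"
    let ?U = "ball y (1/2)"
    have "Ck_on 1 (chart_img (sheet_chart ?U)) (p \<circ> chart_inv (sheet_chart ?U))"
      using p sol_atlasI[OF sheet_ball] unfolding Ck_function_def by blast
    then have "Ck_on 1 ?U (p \<circ> chart_inv (sheet_chart ?U))" by (simp only: chart_img_sheet[OF sheet_ball])
    then show "\<exists>T f'. open T \<and> y \<in> T \<and> (\<forall>z\<in>T. P z = f' z) \<and> Ck_on 1 T f'"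
      by (intro exI[of _ ?U] exI[of _ "p \<circ> chart_inv (sheet_chart ?U)"]) (simp add: P_def chart_inv_sheet[OF sheet_ball])
  qed
  have WC1: "Ck_on 1 UNIV W" unfolding W_def by (rule lift_C1)
  have Wd: "W differentiable (at y)" for y using WC1 by (simp add: numeral_eq_Suc)
  have W: "C1_grad (\<lambda>q. W q $ j) (\<lambda>q. \<chi> i. partial i W q $ j)" for j
    by (rule C1_grad_of_Ck[OF WC1 bounded_linear_vec_nth])
  have P: "C1_grad P (\<lambda>q. \<chi> i. partial i P q)"
    using C1_grad_of_Ck[OF PC1 bounded_linear_ident] by simp
  have pde: "pt (partial 1 W y $ 1 * W y $ 1 + partial 2 W y $ 1 * W y $ 2 + partial 3 W y $ 1 * W y $ 3 - 2 * W y $ 1 * W y $ 3)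
       (partial 1 W y $ 2 * W y $ 1 + partial 2 W y $ 2 * W y $ 2 + partial 3 W y $ 2 * W y $ 3 + 2 * W y $ 2 * W y $ 3)
       (partial 1 W y $ 3 * W y $ 1 + partial 2 W y $ 3 * W y $ 2 + partial 3 W y $ 3 * W y $ 3
          + exp (- 2 * y $ 3) * (W y $ 1)\<^sup>2 - exp (2 * y $ 3) * (W y $ 2)\<^sup>2)
     = - pt (exp (2 * y $ 3) * partial 1 P y) (exp (- 2 * y $ 3) * partial 2 P y) (partial 3 P y)" (is "?pde y")
    and div: "partial 1 W y $ 1 + partial 2 W y $ 2 + partial 3 W y $ 3 = 0" (is "?div y") for y
  proof -
    let ?U = "ball y (1/2)"
    let ?w = "field_loc (sheet_chart ?U) v" and ?p = "p \<circ> chart_inv (sheet_chart ?U)"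
    have y: "y \<in> ?U" by simp
    have w: "?w z = W z" if "z \<in> ?U" for z unfolding W_def by (rule field_loc_lift[OF sheet_ball that])
    have pp: "?p z = P z" if "z \<in> ?U" for z using chart_inv_sheet[OF sheet_ball that] by (simp add: P_def)
    note l = local_operators[OF sheet_ball y, of ?w W ?p P, OF w Wd pp]
    have "y \<in> chart_img (sheet_chart ?U)" using chart_img_sheet[OF sheet_ball, of y] y by simp
    note e = euler[OF sol_atlasI[OF sheet_ball] this]
    show "?pde y"
      using conjunct1[OF e] by (simp only: l(1) l(3))
    show "?div y"
      using conjunct2[OF e] by (simp only: l(2))
  qed
  have Wdeck: "W (deck n a b q) = dlin n (W q)" if "(a, b) \<in> Lat" for n a b q
    unfolding W_def by (rule lift_deck[OF that])
  have P_inv: "invariant P" by (simp add: invariant_def P_def)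
  have nearW: "\<bar>(W q - e3) $ j\<bar> \<le> 1 / 1000" if "q \<in> fund_box" for q j
    using near(1)[OF that] component_le_norm_cart[of "W q - e3" j] unfolding W_def by linarith
  have nearW': "\<bar>partial i W q $ j\<bar> \<le> 1 / 1000" if "q \<in> fund_box" for q i j
    using near(2)[OF that, of i] component_le_norm_cart[of "partial i W q" j] unfolding W_def by linarith
  have "\<exists>c>0. \<forall>q. W q $ 1 = 0 \<and> W q $ 2 = 0 \<and> W q $ 3 = c"
  proof (rule euler_rigidity[OF W W W P P_inv])
    fix q :: "real^3"
    show "(\<chi> i. partial i W q $ 1) $ 1 * W q $ 1 + (\<chi> i. partial i W q $ 1) $ 2 * W q $ 2 + (\<chi> i. partial i W q $ 1) $ 3 * W q $ 3
        - 2 * W q $ 1 * W q $ 3 = - exp (2 * q $ 3) * (\<chi> i. partial i P q) $ 1"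
      "(\<chi> i. partial i W q $ 2) $ 1 * W q $ 1 + (\<chi> i. partial i W q $ 2) $ 2 * W q $ 2 + (\<chi> i. partial i W q $ 2) $ 3 * W q $ 3
        + 2 * W q $ 2 * W q $ 3 = - exp (- 2 * q $ 3) * (\<chi> i. partial i P q) $ 2"
      "(\<chi> i. partial i W q $ 3) $ 1 * W q $ 1 + (\<chi> i. partial i W q $ 3) $ 2 * W q $ 2 + (\<chi> i. partial i W q $ 3) $ 3 * W q $ 3
        + exp (- 2 * q $ 3) * (W q $ 1)\<^sup>2 - exp (2 * q $ 3) * (W q $ 2)\<^sup>2 = - (\<chi> i. partial i P q) $ 3"
      using pde[of q] unfolding vec3_eq_iff by simp_all
    show "(\<chi> i. partial i W q $ 1) $ 1 + (\<chi> i. partial i W q $ 2) $ 2 + (\<chi> i. partial i W q $ 3) $ 3 = 0"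
      using div[of q] by simp
  next
    fix n a b q assume ab: "(a, b) \<in> Lat"
    show "W (deck n a b q) $ 1 = exp (of_int n * ell) * W q $ 1" "W (deck n a b q) $ 2 = exp (- (of_int n * ell)) * W q $ 2"
      "W (deck n a b q) $ 3 = W q $ 3"
      unfolding Wdeck[OF ab] by (simp_all add: dlin_def)
  next
    fix q i assume q: "q \<in> fund_box"
    show "\<bar>W q $ 1\<bar> \<le> 1 / 1000" "\<bar>W q $ 2\<bar> \<le> 1 / 1000" "\<bar>W q $ 3 - 1\<bar> \<le> 1 / 1000"
      using nearW[OF q, of 1] nearW[OF q, of 2] nearW[OF q, of 3] by simp_all
    show "\<bar>(\<chi> i. partial i W q $ 1) $ i\<bar> \<le> 1 / 1000" "\<bar>(\<chi> i. partial i W q $ 2) $ i\<bar> \<le> 1 / 1000" "\<bar>(\<chi> i. partial i W q $ 3) $ i\<bar> \<le> 1 / 1000"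
      using nearW'[OF q] by simp_all
  qed
  then show ?thesis unfolding W_def by (simp add: vec3_eq_iff)
qed

end

text \<open>Finitely many quarter balls cover the fundamental box, so finitely many of the subbasic
  sets of the C^1 topology control the lifted field and its derivatives on it.\<close>

lemma vertical_field_isolated: "C1_isolated sol_space sol_atlas sol_metric vertical_field"
  unfolding C1_isolated_def
proof -
  define U where "U p = ball p (1/2)" for p :: "real^3"
  have U: "sheet (U p)" for p unfolding U_def by (rule sheet_ball)
  define S where "S p = {w. Ck_vector_field 1 sol_space sol_atlas w \<and>
     (\<forall>y\<in>cball p (1/4). norm (field_loc (sheet_chart (U p)) w y - field_loc (sheet_chart (U p)) vertical_field y) < 1 / 1000 \<and>
       (\<forall>i. norm (partial i (field_loc (sheet_chart (U p)) w) y - partial i (field_loc (sheet_chart (U p)) vertical_field) y) < 1 / 1000))}" for p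
  have v0: "Ck_vector_field 1 sol_space sol_atlas vertical_field"
    using smooth_vertical_field unfolding smooth_vector_field_def by blast
  have S_open: "openin (C1_topology sol_space sol_atlas) (S p)" for p
    unfolding C1_topology_def
  proof (rule topology_generated_by_Basis, unfold mem_Collect_eq, intro exI conjI)
    show "cball p (1/4) \<subseteq> chart_img (sheet_chart (U p))"
      unfolding chart_img_sheet[OF U] by (auto simp: U_def)
  qed (rule S_def, use sol_atlasI[OF U] v0 in auto)
  obtain I where I: "I \<subseteq> fund_box" "finite I" "fund_box \<subseteq> (\<Union>p\<in>I. ball p (1/4))"
    by (rule compactE_image[OF compact_fund_box, of fund_box "\<lambda>p. ball p (1/4)"]) auto
  have "0 \<in> fund_box" using ell_bounds by (simp add: fund_box_def)
  then have "I \<noteq> {}" using I(3) by auto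
  define N where "N = (\<Inter>p\<in>I. S p)"
  have "openin (C1_topology sol_space sol_atlas) N"
    unfolding N_def by (rule openin_INT2[OF I(2) \<open>I \<noteq> {}\<close> S_open])
  moreover have "vertical_field \<in> N" using v0 by (simp add: N_def S_def)
  moreover have "v \<in> symmetry_orbit sol_space sol_atlas sol_metric vertical_field"
    if vN: "v \<in> N" and steady: "steady_euler sol_space sol_atlas sol_metric v" for v
  proof -
    have v: "Ck_vector_field 1 sol_space sol_atlas v" using steady by (simp add: steady_euler_def)
    have near: "norm (lift_field v q - e3) \<le> 1 / 1000" "norm (partial i (lift_field v) q) \<le> 1 / 1000"
      if q: "q \<in> fund_box" for q i
    proof -
      obtain p where p: "p \<in> I" "q \<in> ball p (1/4)" using I(3) q by blast
      have qU: "q \<in> U p" and qc: "q \<in> cball p (1/4)" using p(2) by (auto simp: U_def)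
      have oU: "open (U p)" by (simp add: U_def)
      have "partial i (field_loc (sheet_chart (U p)) v) q = partial i (lift_field v) q"
        by (rule partial_cong_open[OF oU qU]) (rule field_loc_lift[OF v U])
      moreover have "partial i (field_loc (sheet_chart (U p)) vertical_field) q = partial i (\<lambda>_. e3) q"
        by (rule partial_cong_open[OF oU qU]) (rule field_loc_vertical[OF U])
      moreover have "norm (field_loc (sheet_chart (U p)) v q - field_loc (sheet_chart (U p)) vertical_field q) < 1 / 1000"
        "norm (partial i (field_loc (sheet_chart (U p)) v) q - partial i (field_loc (sheet_chart (U p)) vertical_field) q) < 1 / 1000"
        using vN p(1) qc unfolding N_def S_def by blast+
      ultimately show "norm (lift_field v q - e3) \<le> 1 / 1000" "norm (partial i (lift_field v) q) \<le> 1 / 1000"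
        using field_loc_lift[OF v U qU] field_loc_vertical[OF U qU] by simp_all
    qed
    obtain c where c: "c > 0" "\<And>q. lift_field v q = c *\<^sub>R e3"
      using steady_lift_rigid[OF v steady near] by blast
    have "v = scale_field sol_space c vertical_field" by (rule lift_vertical_imp_scale[OF v c(2)])
    moreover have "c \<noteq> 0" using c(1) by simp
    ultimately show ?thesis using symmetry_orbit.scale[OF symmetry_orbit.base] by metis
  qed
  ultimately show "\<exists>N. openin (C1_topology sol_space sol_atlas) N \<and> vertical_field \<in> N \<and>
     (\<forall>v\<in>N. steady_euler sol_space sol_atlas sol_metric v \<longrightarrow> v \<in> symmetry_orbit sol_space sol_atlas sol_metric vertical_field)"
    by blast
qed

(* The points of M are labelled by real numbers.  This is no restriction: the topology X is
   arbitrary, and every manifold has at most the cardinality of the continuum. *)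
theorem theorem1:
  shows "\<exists>(X :: real topology) (A :: (real, 3) chart set) (g :: (real, 3) metric)
            (v0 :: real \<Rightarrow> (real, 3) tangent).
     closed_oriented_manifold X A \<and> smooth_riemannian_metric X A g \<and>
     smooth_vector_field X A v0 \<and> steady_euler X A g v0 \<and> C1_isolated X A g v0"
  using sol_closed_oriented_manifold sol_smooth_riemannian_metric smooth_vertical_field
    steady_vertical_field vertical_field_isolated by blast

end
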